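(* Let $f$ be an inner function and $0<D<1$ with $\sup_{z\in\mathbb D}D_h(f)(z)<D$. Then there exists $t=t(D)\in(0,1)$ such that $$\dim\Big\{\xi\in I:\limsup_{r\to1}|f(r\xi)|<t\Big\}>1-D$$ for every arc $I\subset\partial\mathbb D$. Moreover $t(D)$ can be chosen with $t(D)\to0$ as $D\to0$.
   Context: $D_h(f)(z)=\frac{(1-|z|^2)|f'(z)|}{1-|f(z)|^2}$. An inner function is a bounded analytic function on $\mathbb D$ with radial limits of modulus $1$ a.e. on $\partial\mathbb D$. $\dim$ denotes Hausdorff dimension. *)

theory Defs
  imports "HOL-Analysis.Analysis"
begin

definition hyp_deriv :: "(complex \<Rightarrow> complex) \<Rightarrow> complex \<Rightarrow> real" where
  "hyp_deriv f z = (1 - (norm z)^2) * norm (deriv f z) / (1 - (norm (f z))^2)"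

definition inner_function :: "(complex \<Rightarrow> complex) \<Rightarrow> bool" where
  "inner_function f \<longleftrightarrow>
     f holomorphic_on ball 0 1 \<and> bounded (f ` ball 0 1) \<and>
     (AE \<theta> in lebesgue_on {0..2*pi}.
        \<exists>L. ((\<lambda>r. f (complex_of_real r * cis \<theta>)) \<longlongrightarrow> L) (at_left 1) \<and> norm L = 1)"

definition hausdorff_pre :: "real \<Rightarrow> real \<Rightarrow> 'a::metric_space set \<Rightarrow> ennreal" where
  "hausdorff_pre s \<delta> A =
     (INF U \<in> {U :: nat \<Rightarrow> 'a set. A \<subseteq> (\<Union>i. U i) \<and> (\<forall>i. bounded (U i) \<and> diameter (U i) \<le> \<delta>)}.
        \<Sum>i. ennreal (diameter (U i) powr s))"

definition hausdorff_measure :: "real \<Rightarrow> 'a::metric_space set \<Rightarrow> ennreal" where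
  "hausdorff_measure s A = (SUP \<delta> \<in> {0<..}. hausdorff_pre s \<delta> A)"

definition hausdorff_dim :: "'a::metric_space set \<Rightarrow> ereal" where
  "hausdorff_dim A = (INF s \<in> {s. 0 \<le> s \<and> hausdorff_measure s A = 0}. ereal s)"

definition arc :: "real \<Rightarrow> real \<Rightarrow> complex set" where
  "arc a b = cis ` {a..b}"

end

theory Submission
  imports Defs "HOL-Complex_Analysis.Complex_Analysis" "HOL-Real_Asymp.Real_Asymp"
begin

text \<open>
  The covering \<open>z \<mapsto> exp (\<i> z)\<close> turns \<open>f\<close> into \<open>g\<close> on the upper half-plane with
  \<open>2 y \<bar>g'\<bar> \<le> d (1 - \<bar>g\<bar>\<^sup>2)\<close>, \<open>d < D\<close>, so \<open>1 - \<bar>g\<bar>\<^sup>2\<close> changes by a factor at most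
  \<open>2\<^sup>d\<close> per dyadic generation, up to constants. Write \<open>g\<^sub>J\<close> for the value of \<open>g\<close> above the dyadic
  interval \<open>J\<close> at height \<open>\<bar>J\<bar>\<close>, and call \<open>J\<close> good if \<open>\<bar>g\<^sub>J\<bar> \<le> \<delta>\<close>.

  From any \<open>K\<close>, Green's formula for the harmonic function \<open>- ln \<bar>g\<bar>\<close> on the sawtooth region above
  the first descendants that are good or have \<open>\<bar>g\<bar> \<ge> t\<close> shows that good descendants, reached with
  \<open>\<bar>g\<bar> < t\<close>, cover a proportion at least \<open>c (1 - \<bar>g\<^sub>K\<bar>\<^sup>2)\<close> of \<open>K\<close>; since \<open>\<bar>g\<bar> \<rightarrow> 1\<close> almost
  everywhere, almost every point is eventually stopped. These descendants are short: returning to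
  \<open>\<bar>g\<bar> \<le> \<delta>\<close> forces \<open>(\<bar>J\<bar> / \<bar>K\<bar>)\<^sup>d \<le> C (1 - \<bar>g\<^sub>K\<bar>\<^sup>2)\<close>. Weighted with exponent \<open>1 - d\<close>
  the return therefore loses only a constant, whereas passing from a good \<open>I\<close> to all its descendants
  \<open>n\<close> generations later gains \<open>2\<^sup>n\<^sup>d\<close>. Hence good intervals branch into good intervals without loss in the
  exponent \<open>1 - d\<close>, and the limit set has dimension at least \<open>1 - d > 1 - D\<close>.

  If \<open>t\<close> is prescribed and \<open>D\<close> is small, the free passage is controlled in \<open>L\<^sup>2\<close>: the averages of \<open>g\<close>
  form a martingale with increments \<open>O(d)\<close>, so after \<open>n \<approx> B / d\<close> generations half of the descendants
  still have small \<open>\<bar>g\<bar>\<close>, while the gain \<open>2\<^sup>B\<close> is as large as desired.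
\<close>

section \<open>Dyadic intervals\<close>

text \<open>The bound d < 1 enters twice. Write Q for 1 - |g|^2. First, Q grows by at most
  \<open>2 powr d\<close> per generation while lengths halve, so the fluxes through a column of
  walls decrease geometrically. Secondly, near the circle the flux through a top edge stays
  positive, since u >= Q / 2 whereas |y u_y| <= d Q / (2 |g|). Main term and wall terms are both of
  size Q times length, so a single interval gives nothing there: inner walls are charged to leaves,
  and the two outer walls are beaten only by a long range of neighbours whose ends carry a small
  share of the sum of Q. The threshold may depend on D alone although the bound d < D belongs to f.
  Hence d is kept in [D / 2, D), and the choices are made in the order good level, return
  proportion, number n of free generations, t. The constant C of the covering argument may depend on
  d, because it only affects how cheap a cover has to be for its refutation. That argument builds no
  measure on the limit set; a cheap cover is refuted by walking down uncovered intervals.\<close>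

definition dsub :: "nat \<times> int \<Rightarrow> nat \<times> int \<Rightarrow> bool" (infix "\<sqsubseteq>" 50) where
  "J \<sqsubseteq> I \<longleftrightarrow> fst I \<le> fst J \<and> snd J div 2 ^ (fst J - fst I) = snd I"

definition dlen :: "nat \<times> int \<Rightarrow> real" where "dlen J = 1 / 2 ^ fst J"

definition dint :: "nat \<times> int \<Rightarrow> real set" where
  "dint J = {of_int (snd J) / 2 ^ fst J ..< (of_int (snd J) + 1) / 2 ^ fst J}"

text \<open>The half-open intervals tile the line, which the measure arguments need; the closed ones
  are compact, which the nested intersection in \<open>cover_descent\<close> needs, at the price
  that an endpoint lies in two intervals of one generation.\<close>

definition dcl :: "nat \<times> int \<Rightarrow> real set" where
  "dcl J = {of_int (snd J) / 2 ^ fst J .. (of_int (snd J) + 1) / 2 ^ fst J}"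

definition dantichain :: "(nat \<times> int) set \<Rightarrow> bool" where
  "dantichain F \<longleftrightarrow> (\<forall>J\<in>F. \<forall>J'\<in>F. J \<sqsubseteq> J' \<longrightarrow> J = J')"

lemma dlen_pos [simp]: "dlen J > 0"
  by (simp add: dlen_def)

lemma dlen_le_1: "dlen J \<le> 1"
  by (simp add: dlen_def)

lemma dlen_powr_mult: "dlen J powr (- d) * dlen J = dlen J powr (1 - d)"
  using powr_mult_base[of "dlen J" "- d"] by (simp add: less_imp_le mult.commute)

lemma dsub_refl [simp]: "J \<sqsubseteq> J"
  by (simp add: dsub_def)

lemma dsub_trans: assumes "J \<sqsubseteq> I" "I \<sqsubseteq> K" shows "J \<sqsubseteq> K"
proof -
  obtain a i b j c k where eq: "J = (a, i)" "I = (b, j)" "K = (c, k)" by (metis surj_pair)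
  have *: "b \<le> a" "c \<le> b" "j = i div 2 ^ (a - b)" "k = j div 2 ^ (b - c)"
    using assms by (auto simp: dsub_def eq)
  obtain p q where "a = b + p" "b = c + q" using le_Suc_ex[OF *(1)] le_Suc_ex[OF *(2)] by auto
  then show ?thesis using * by (simp add: dsub_def eq power_add zdiv_zmult2_eq mult.commute)
qed

lemma dsub_same_level: "J \<sqsubseteq> I \<Longrightarrow> fst J = fst I \<Longrightarrow> J = I"
  by (simp add: dsub_def prod_eq_iff)

lemma dsub_antisym: "J \<sqsubseteq> I \<Longrightarrow> I \<sqsubseteq> J \<Longrightarrow> J = I"
  by (rule dsub_same_level) (auto simp only: dsub_def)

text \<open>The ancestors of J are determined by their generation, as quotients of
  \<open>snd J\<close> by powers of two, so they form a chain.\<close>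

lemma dsub_comparable_aux:
  assumes "J \<sqsubseteq> A" "J \<sqsubseteq> B" "fst A \<le> fst B" shows "B \<sqsubseteq> A"
proof -
  obtain a i b j c k where eq: "J = (a, i)" "B = (b, j)" "A = (c, k)" by (metis surj_pair)
  have *: "b \<le> a" "c \<le> b" "j = i div 2 ^ (a - b)" "k = i div 2 ^ (a - c)"
    using assms by (auto simp: dsub_def eq)
  obtain p q where "a = b + p" "b = c + q" using le_Suc_ex[OF *(1)] le_Suc_ex[OF *(2)] by auto
  then show ?thesis using * by (simp add: dsub_def eq power_add zdiv_zmult2_eq mult.commute)
qed

lemma dsub_comparable: "J \<sqsubseteq> A \<Longrightarrow> J \<sqsubseteq> B \<Longrightarrow> A \<sqsubseteq> B \<or> B \<sqsubseteq> A"
  using dsub_comparable_aux by (metis nat_le_linear)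

lemma dsub_child: "b = 0 \<or> b = 1 \<Longrightarrow> (Suc m, 2 * k + b) \<sqsubseteq> (m, k)"
  by (auto simp: dsub_def)

text \<open>Induction step for every property demanded along a whole path of ancestors: from a node
  to J the path is that node followed by a path inside the child above J.\<close>

lemma dsub_between_child:
  assumes "J \<sqsubseteq> (Suc m, j)" "J \<sqsubseteq> A" "A \<sqsubseteq> (m, k)" shows "A = (m, k) \<or> A \<sqsubseteq> (Suc m, j)"
proof (cases "fst A = m")
  case True
  then show ?thesis using dsub_same_level[OF assms(3)] by simp
next
  case False
  moreover have "m \<le> fst A" using assms(3) unfolding dsub_def by simp
  ultimately show ?thesis using dsub_comparable_aux[OF assms(2,1)] dsub_comparable_aux[OF assms(1,2)] by simp
qed

lemma dlen_mono: "J \<sqsubseteq> I \<Longrightarrow> dlen J \<le> dlen I"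
  unfolding dsub_def dlen_def by (intro divide_left_mono power_increasing) auto

lemma mem_dint_iff: "x \<in> dint J \<longleftrightarrow> \<lfloor>x * 2 ^ fst J\<rfloor> = snd J"
  by (auto simp: dint_def floor_eq_iff field_simps)

lemma floor_scale_div:
  fixes x :: real assumes "m \<le> n" shows "\<lfloor>x * 2 ^ n\<rfloor> div 2 ^ (n - m) = \<lfloor>x * 2 ^ m\<rfloor>"
proof -
  have "\<lfloor>x * 2 ^ n / real_of_int (2 ^ (n - m))\<rfloor> = \<lfloor>x * 2 ^ n\<rfloor> div 2 ^ (n - m)"
    by (rule floor_divide_real_eq_div) simp
  moreover have "(2::real) ^ n = 2 ^ (n - m) * 2 ^ m"
    using assms by (metis le_add_diff_inverse2 power_add)
  then have "x * 2 ^ n / real_of_int (2 ^ (n - m)) = x * 2 ^ m" by simp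
  ultimately show ?thesis by simp
qed

lemma dint_mono: assumes "J \<sqsubseteq> I" shows "dint J \<subseteq> dint I"
proof
  fix x assume "x \<in> dint J"
  then show "x \<in> dint I"
    using assms floor_scale_div[of "fst I" "fst J" x] by (simp add: mem_dint_iff dsub_def)
qed

lemma dsub_if_meet: assumes "x \<in> dint J" "x \<in> dint I" "fst I \<le> fst J" shows "J \<sqsubseteq> I"
  using assms floor_scale_div[of "fst I" "fst J" x] by (simp add: mem_dint_iff dsub_def)

lemma closure_dint: "closure (dint J) = dcl J"
  unfolding dint_def dcl_def by (rule closure_atLeastLessThan) (simp add: field_simps)

lemma dcl_mono: "J \<sqsubseteq> I \<Longrightarrow> dcl J \<subseteq> dcl I"
  using closure_mono[OF dint_mono] by (simp add: closure_dint)

lemma measure_dint: "measure lebesgue (dint J) = dlen J"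
  by (simp add: dint_def dlen_def field_simps diff_divide_distrib)

lemma dint_lmeasurable [simp]: "dint J \<in> lmeasurable"
proof -
  have "dint J = {of_int (snd J) / 2 ^ fst J .. (of_int (snd J) + 1) / 2 ^ fst J} - {(of_int (snd J) + 1) / 2 ^ fst J :: real}"
    by (auto simp: dint_def field_simps)
  then show ?thesis by (simp add: fmeasurable_Diff)
qed

lemma sum_dlen_antichain:
  assumes "finite F" "dantichain F" "\<And>J. J \<in> F \<Longrightarrow> J \<sqsubseteq> A"
  shows "(\<Sum>J\<in>F. dlen J) \<le> dlen A"
proof -
  have disj: "disjoint_family_on dint F"
    unfolding disjoint_family_on_def
  proof (intro ballI impI)
    fix J J' assume "J \<in> F" "J' \<in> F" "J \<noteq> J'"
    then have "\<not> J \<sqsubseteq> J'" "\<not> J' \<sqsubseteq> J" using assms(2) by (auto simp: dantichain_def)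
    then show "dint J \<inter> dint J' = {}"
      using dsub_if_meet[of _ J J'] dsub_if_meet[of _ J' J] nat_le_linear[of "fst J" "fst J'"] by auto
  qed
  have "(\<Sum>J\<in>F. dlen J) = (\<Sum>J\<in>F. measure lebesgue (dint J))" by (simp add: measure_dint)
  also have "\<dots> = measure lebesgue (\<Union>J\<in>F. dint J)"
  proof (rule measure_finite_Union[symmetric])
    show "dint ` F \<subseteq> sets lebesgue" using fmeasurableD[OF dint_lmeasurable] by auto
    show "emeasure lebesgue (dint J) \<noteq> \<infinity>" if "J \<in> F" for J
      using fmeasurableD2[OF dint_lmeasurable[of J]] by simp
  qed (use assms(1) disj in auto)
  also have "\<dots> \<le> measure lebesgue (dint A)"
  proof (rule measure_mono_fmeasurable)
    show "(\<Union>J\<in>F. dint J) \<subseteq> dint A" using dint_mono[OF assms(3)] by (rule UN_least)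
    show "(\<Union>J\<in>F. dint J) \<in> sets lebesgue"
      by (rule sets.finite_UN[OF assms(1)]) (rule fmeasurableD[OF dint_lmeasurable])
  qed simp
  finally show ?thesis by (simp add: measure_dint)
qed

lemma dantichain_UN:
  assumes "\<And>K. K \<in> S \<Longrightarrow> fst K = m" "\<And>K. K \<in> S \<Longrightarrow> dantichain (F K)"
    "\<And>K J. K \<in> S \<Longrightarrow> J \<in> F K \<Longrightarrow> J \<sqsubseteq> K"
  shows "dantichain (\<Union>K\<in>S. F K)"
  unfolding dantichain_def
proof (intro ballI impI)
  fix J J' assume J: "J \<in> (\<Union>K\<in>S. F K)" "J' \<in> (\<Union>K\<in>S. F K)" "J \<sqsubseteq> J'"
  then obtain K K' where K: "K \<in> S" "J \<in> F K" "K' \<in> S" "J' \<in> F K'" by auto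
  have "J \<sqsubseteq> K" "J \<sqsubseteq> K'" using assms(3)[OF K(1,2)] dsub_trans[OF J(3) assms(3)[OF K(3,4)]] by auto
  moreover have "fst K = fst K'" using assms(1) K by simp
  ultimately have "K = K'"
    using dsub_comparable[of J K K'] dsub_same_level[of K K'] dsub_same_level[of K' K] by auto
  then show "J = J'" using assms(2) K J(3) by (auto simp: dantichain_def)
qed

lemma sum_UN_families:
  assumes "finite S" "\<And>K. K \<in> S \<Longrightarrow> fst K = m" "\<And>K. K \<in> S \<Longrightarrow> finite (F K)"
    "\<And>K J. K \<in> S \<Longrightarrow> J \<in> F K \<Longrightarrow> J \<sqsubseteq> K"
  shows "(\<Sum>J\<in>(\<Union>K\<in>S. F K). w J) = (\<Sum>K\<in>S. \<Sum>J\<in>F K. w J :: real)"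
proof (rule sum.UNION_disjoint)
  show "\<forall>K\<in>S. \<forall>K'\<in>S. K \<noteq> K' \<longrightarrow> F K \<inter> F K' = {}"
  proof (intro ballI impI, rule ccontr)
    fix K K' assume K: "K \<in> S" "K' \<in> S" "K \<noteq> K'" "F K \<inter> F K' \<noteq> {}"
    then obtain J where "J \<in> F K" "J \<in> F K'" by auto
    then have "J \<sqsubseteq> K" "J \<sqsubseteq> K'" using assms(4)[OF K(1)] assms(4)[OF K(2)] by auto
    moreover have "fst K = fst K'" using assms(2)[OF K(1)] assms(2)[OF K(2)] by simp
    ultimately show False
      using dsub_comparable[of J K K'] dsub_same_level[of K K'] dsub_same_level[of K' K] K(3) by auto
  qed
  show "\<forall>K\<in>S. finite (F K)" using assms(3) by blast
qed (rule assms(1))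

section \<open>Descent through intervals that a cheap cover cannot exhaust\<close>

text \<open>Each covering set pays either for the members of \<open>F\<close> it contains or to the one containing it;
  if every member of \<open>F\<close> were covered at the full price, so would \<open>I\<close> be.\<close>

lemma cover_descent_step:
  fixes \<sigma> C :: real and U :: "nat \<Rightarrow> nat \<times> int" and w :: "nat \<times> int \<Rightarrow> real"
  assumes \<sigma>: "0 \<le> \<sigma>" "\<sigma> \<le> 1" and C: "1 \<le> C"
    and F: "finite F" "dantichain F"
    and FI: "\<And>J. J \<in> F \<Longrightarrow> J \<sqsubseteq> I"
    and w0: "\<And>J. J \<in> F \<Longrightarrow> 0 \<le> w J"
    and w1: "\<And>J. J \<in> F \<Longrightarrow> w J \<le> dlen J powr \<sigma>"
    and w2: "\<And>J. J \<in> F \<Longrightarrow> w J \<le> C * dlen J * dlen I powr (\<sigma> - 1)"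
    and sumw: "dlen I powr \<sigma> \<le> sum w F"
    and sm: "summable (\<lambda>i. dlen (U i) powr \<sigma>)"
    and noI: "\<And>i. \<not> I \<sqsubseteq> U i"
    and small: "(\<Sum>i. if U i \<sqsubseteq> I then dlen (U i) powr \<sigma> else 0) < dlen I powr \<sigma> / C"
  shows "\<exists>J\<in>F. (\<forall>i. \<not> J \<sqsubseteq> U i) \<and> (\<Sum>i. if U i \<sqsubseteq> J then dlen (U i) powr \<sigma> else 0) < dlen J powr \<sigma> / C"
proof (rule ccontr)
  assume "\<not> ?thesis"
  then have neg: "dlen J powr \<sigma> / C \<le> (\<Sum>i. if U i \<sqsubseteq> J then dlen (U i) powr \<sigma> else 0)"
    if "J \<in> F" "\<And>i. \<not> J \<sqsubseteq> U i" for J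
    using that by (meson not_le)
  define c where "c i = (if U i \<sqsubseteq> I then dlen (U i) powr \<sigma> else 0)" for i
  \<comment> \<open>Double counting over F and the cover: column i of this matrix sums to at most
    the price of \<open>U i\<close>, row J to at least \<open>w J / C\<close>. A member contained in
    some covering set is paid by such sets alone.\<close>
  define a where "a J i = (if J \<sqsubseteq> U i then w J / C
     else if U i \<sqsubseteq> J \<and> (\<forall>i'. \<not> J \<sqsubseteq> U i') then dlen (U i) powr \<sigma> else 0)" for J i
  have summ_if: "summable (\<lambda>i. if P i then dlen (U i) powr \<sigma> else 0)" for P
    by (rule summable_comparison_test'[OF sm, of 0]) auto
  have a0: "0 \<le> a J i" if "J \<in> F" for J i
    using w0[OF that] C by (simp add: a_def)
  have sub: "U i \<sqsubseteq> I" if "J \<in> F" "J \<sqsubseteq> U i" for J i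
    using dsub_comparable[OF FI[OF that(1)] that(2)] noI by auto
  have col: "(\<Sum>J\<in>F. a J i) \<le> c i" for i
  proof (cases "\<exists>J\<in>F. J \<sqsubseteq> U i")
    case True
    then obtain J0 where J0: "J0 \<in> F" "J0 \<sqsubseteq> U i" by auto
    have UI: "U i \<sqsubseteq> I" using sub J0 by auto
    have "a J i = (if J \<sqsubseteq> U i then w J / C else 0)" if J: "J \<in> F" for J
    proof -
      have "J0 = J" if "U i \<sqsubseteq> J"
        using dsub_trans[OF J0(2) that] F(2) J J0(1) by (auto simp: dantichain_def)
      then show ?thesis using J0 by (auto simp: a_def)
    qed
    then have "(\<Sum>J\<in>F. a J i) = (\<Sum>J\<in>F. if J \<sqsubseteq> U i then w J / C else 0)" by simp
    also have "\<dots> = (\<Sum>J\<in>{J\<in>F. J \<sqsubseteq> U i}. w J / C)" using F by (simp add: sum.inter_filter)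
    \<comment> \<open>The second bound on w serves the sets between F and I: the members of F inside
      one \<open>U i\<close> are priced by total length, and since \<open>U i\<close> lies in I and
      \<sigma> - 1 is not positive, that is at most \<open>dlen (U i) powr \<sigma>\<close>.\<close>
    also have "\<dots> \<le> (\<Sum>J\<in>{J\<in>F. J \<sqsubseteq> U i}. dlen J * dlen I powr (\<sigma> - 1))"
      using w2 C by (intro sum_mono) (auto simp: field_simps)
    also have "\<dots> = (\<Sum>J\<in>{J\<in>F. J \<sqsubseteq> U i}. dlen J) * dlen I powr (\<sigma> - 1)"
      by (simp add: sum_distrib_right)
    also have "\<dots> \<le> dlen (U i) * dlen I powr (\<sigma> - 1)"
      using F by (intro mult_right_mono sum_dlen_antichain) (auto simp: dantichain_def)
    also have "\<dots> \<le> dlen (U i) * dlen (U i) powr (\<sigma> - 1)"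
      using dlen_mono[OF UI] \<sigma> by (intro mult_left_mono powr_mono2') (auto intro: less_imp_le)
    also have "\<dots> = dlen (U i) powr \<sigma>"
      using powr_mult_base[of "dlen (U i)" "\<sigma> - 1"] by (simp add: less_imp_le)
    finally show ?thesis using UI by (simp add: c_def)
  next
    case False
    show ?thesis
    proof (cases "\<exists>J\<in>F. U i \<sqsubseteq> J")
      case True
      then obtain J0 where J0: "J0 \<in> F" "U i \<sqsubseteq> J0" by auto
      have "a J i \<le> (if J = J0 then dlen (U i) powr \<sigma> else 0)" if J: "J \<in> F" for J
      proof -
        have "J = J0" if "U i \<sqsubseteq> J"
          using dsub_comparable[OF that J0(2)] F(2) J J0(1) by (auto simp: dantichain_def)
        then show ?thesis using False J by (auto simp: a_def)
      qed
      then have "(\<Sum>J\<in>F. a J i) \<le> (\<Sum>J\<in>F. if J = J0 then dlen (U i) powr \<sigma> else 0)" by (rule sum_mono)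
      also have "\<dots> = dlen (U i) powr \<sigma>" using F(1) J0 by (simp add: sum.delta)
      finally show ?thesis using dsub_trans[OF J0(2) FI[OF J0(1)]] by (simp add: c_def)
    next
      case F2: False
      then have "(\<Sum>J\<in>F. a J i) = 0" using False by (intro sum.neutral) (auto simp: a_def)
      then show ?thesis by (simp add: c_def)
    qed
  qed
  have summc: "summable c" unfolding c_def by (rule summ_if)
  have suma: "summable (a J)" if "J \<in> F" for J
  proof (rule summable_comparison_test'[OF summc, of 0])
    fix i
    have "a J i \<le> (\<Sum>J\<in>F. a J i)" using that F a0 by (intro member_le_sum) auto
    then show "norm (a J i) \<le> c i" using a0[OF that] col[of i] by (simp add: order_trans)
  qed
  have row: "w J / C \<le> (\<Sum>i. a J i)" if J: "J \<in> F" for J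
  proof (cases "\<exists>i. J \<sqsubseteq> U i")
    case True
    then obtain i where i: "J \<sqsubseteq> U i" by auto
    have "w J / C = sum (a J) {i}" using i by (simp add: a_def)
    also have "\<dots> \<le> (\<Sum>i. a J i)" using suma[OF J] a0[OF J] by (intro sum_le_suminf) auto
    finally show ?thesis .
  next
    case False
    then have "(\<lambda>i. a J i) = (\<lambda>i. if U i \<sqsubseteq> J then dlen (U i) powr \<sigma> else 0)" by (auto simp: a_def fun_eq_iff)
    then show ?thesis using neg[OF J] False w1[OF J] C divide_right_mono[OF w1[OF J], of C] by force
  qed
  have "dlen I powr \<sigma> / C \<le> (\<Sum>J\<in>F. w J / C)"
    using sumw C by (simp add: divide_right_mono flip: sum_divide_distrib)
  also have "\<dots> \<le> (\<Sum>J\<in>F. \<Sum>i. a J i)" by (intro sum_mono row)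
  also have "\<dots> = (\<Sum>i. \<Sum>J\<in>F. a J i)" using suma by (rule suminf_sum[symmetric])
  also have "\<dots> \<le> (\<Sum>i. c i)" using suma by (intro suminf_le col summable_sum summc) auto
  finally show False using small by (simp add: c_def)
qed

text \<open>Stands in for the mass distribution principle: as long as the cover is cheap, some good
  interval further down is uncovered and again has a cheap cover inside, so the descent never ends.
  The limit point lies in arbitrarily small dyadic intervals contained in no
  \<open>U i\<close>.\<close>

lemma cover_descent:
  fixes \<sigma> C :: real and U :: "nat \<Rightarrow> nat \<times> int" and \<tau> good :: "nat \<times> int \<Rightarrow> bool"
  assumes \<sigma>: "0 \<le> \<sigma>" "\<sigma> \<le> 1" and C: "1 \<le> C"
    and step: "\<And>I. good I \<Longrightarrow> \<exists>F w. finite F \<and> dantichain F \<and>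
        (\<forall>J\<in>F. J \<sqsubseteq> I \<and> J \<noteq> I \<and> good J \<and> (\<forall>A. J \<sqsubseteq> A \<and> A \<sqsubseteq> I \<longrightarrow> \<tau> A) \<and> 0 \<le> w J \<and>
           w J \<le> dlen J powr \<sigma> \<and> w J \<le> C * dlen J * dlen I powr (\<sigma> - 1)) \<and>
        dlen I powr \<sigma> \<le> sum w F"
    and I0: "good I0"
    and sm: "summable (\<lambda>i. dlen (U i) powr \<sigma>)"
    and small: "(\<Sum>i. dlen (U i) powr \<sigma>) < dlen I0 powr \<sigma> / C"
  obtains \<xi> where "\<xi> \<in> dcl I0" "\<And>m. fst I0 \<le> m \<Longrightarrow> \<exists>k. \<xi> \<in> dcl (m, k) \<and> \<tau> (m, k)"
    "\<And>p. \<exists>J. p \<le> fst J \<and> \<xi> \<in> dcl J \<and> (\<forall>i. \<not> J \<sqsubseteq> U i)"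
proof -
  \<comment> \<open>Invariant of the descent: J is in no covering set, and the covering sets inside
    J cost less than its share.\<close>
  define P where "P J \<longleftrightarrow> good J \<and> (\<forall>i. \<not> J \<sqsubseteq> U i) \<and>
    (\<Sum>i. if U i \<sqsubseteq> J then dlen (U i) powr \<sigma> else 0) < dlen J powr \<sigma> / C" for J
  have summ_if: "summable (\<lambda>i. if Q i then dlen (U i) powr \<sigma> else 0)" for Q
    by (rule summable_comparison_test'[OF sm, of 0]) auto
  have P0: "P I0"
    unfolding P_def
  proof (intro conjI allI notI I0)
    fix i assume "I0 \<sqsubseteq> U i"
    then have "dlen I0 powr \<sigma> \<le> dlen (U i) powr \<sigma>"
      using \<sigma> dlen_mono by (intro powr_mono2) (auto intro: less_imp_le)
    also have "\<dots> = sum (\<lambda>i. dlen (U i) powr \<sigma>) {i}" by simp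
    also have "\<dots> \<le> (\<Sum>i. dlen (U i) powr \<sigma>)" using sm by (intro sum_le_suminf) auto
    also have "\<dots> < dlen I0 powr \<sigma> / 1" using small
      by (rule less_le_trans) (rule divide_left_mono[OF C], use C in auto)
    finally show False by simp
  next
    have "(\<Sum>i. if U i \<sqsubseteq> I0 then dlen (U i) powr \<sigma> else 0) \<le> (\<Sum>i. dlen (U i) powr \<sigma>)"
      by (intro suminf_le summ_if sm) auto
    then show "(\<Sum>i. if U i \<sqsubseteq> I0 then dlen (U i) powr \<sigma> else 0) < dlen I0 powr \<sigma> / C"
      using small by simp
  qed
  have nxt: "\<exists>J. P J \<and> J \<sqsubseteq> I \<and> J \<noteq> I \<and> (\<forall>A. J \<sqsubseteq> A \<and> A \<sqsubseteq> I \<longrightarrow> \<tau> A)" if I: "P I" for I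
  proof -
    have gI: "good I" using I by (simp add: P_def)
    obtain F w where F: "finite F" "dantichain F" and FJ: "\<And>J. J \<in> F \<Longrightarrow> J \<sqsubseteq> I \<and> J \<noteq> I \<and> good J \<and>
           (\<forall>A. J \<sqsubseteq> A \<and> A \<sqsubseteq> I \<longrightarrow> \<tau> A) \<and> 0 \<le> w J \<and>
           w J \<le> dlen J powr \<sigma> \<and> w J \<le> C * dlen J * dlen I powr (\<sigma> - 1)"
        and sw: "dlen I powr \<sigma> \<le> sum w F"
      using step[OF gI] by blast
    have "\<exists>J\<in>F. (\<forall>i. \<not> J \<sqsubseteq> U i) \<and> (\<Sum>i. if U i \<sqsubseteq> J then dlen (U i) powr \<sigma> else 0) < dlen J powr \<sigma> / C"
      by (rule cover_descent_step[OF \<sigma> C F _ _ _ _ sw sm]) (use FJ I in \<open>auto simp: P_def\<close>)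
    then show ?thesis unfolding P_def using FJ by meson
  qed
  define S where "S I = (SOME J. P J \<and> J \<sqsubseteq> I \<and> J \<noteq> I \<and> (\<forall>A. J \<sqsubseteq> A \<and> A \<sqsubseteq> I \<longrightarrow> \<tau> A))" for I
  have S: "P (S I) \<and> S I \<sqsubseteq> I \<and> S I \<noteq> I \<and> (\<forall>A. S I \<sqsubseteq> A \<and> A \<sqsubseteq> I \<longrightarrow> \<tau> A)" if "P I" for I
    unfolding S_def by (rule someI_ex[OF nxt[OF that]])
  define X where "X n = (S ^^ n) I0" for n
  have X0: "X 0 = I0" and XS: "X (Suc n) = S (X n)" for n by (simp_all add: X_def)
  have X1: "P (X n)" for n
    by (induction n) (use P0 S in \<open>auto simp: X0 XS\<close>)
  have X2: "X (Suc n) \<sqsubseteq> X n \<and> X (Suc n) \<noteq> X n \<and> (\<forall>A. X (Suc n) \<sqsubseteq> A \<and> A \<sqsubseteq> X n \<longrightarrow> \<tau> A)" for n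
    using S[OF X1[of n]] by (simp only: XS) blast
  have lt: "fst (X n) < fst (X (Suc n))" for n
    using X2[of n] dsub_same_level[of "X (Suc n)" "X n"] unfolding dsub_def by (metis le_neq_implies_less)
  have lev: "n \<le> fst (X n)" for n
  proof (induction n)
    case (Suc n) then show ?case using lt[of n] by simp
  qed simp
  have "(\<Inter>n. dcl (X n)) \<noteq> {}"
  proof (rule compact_nest)
    show "compact (dcl (X n))" "dcl (X n) \<noteq> {}" for n by (auto simp: dcl_def field_simps)
    show "dcl (X n) \<subseteq> dcl (X m)" if "m \<le> n" for m n
      using that by (rule lift_Suc_antimono_le[of "\<lambda>n. dcl (X n)", rotated]) (use X2 dcl_mono in blast)
  qed
  then obtain \<xi> where \<xi>: "\<And>n. \<xi> \<in> dcl (X n)" by auto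
  show thesis
  proof (rule that[of \<xi>])
    show "\<xi> \<in> dcl I0" using \<xi>[of 0] X0 by simp
    show "\<exists>J. p \<le> fst J \<and> \<xi> \<in> dcl J \<and> (\<forall>i. \<not> J \<sqsubseteq> U i)" for p
      using lev[of p] \<xi>[of p] X1[of p] unfolding P_def by blast
    fix m assume m: "fst I0 \<le> m"
    \<comment> \<open>The chain skips generations. For the first member that reaches generation m,
      its ancestor of that generation lies between two consecutive members, where the path condition
      holds.\<close>
    define n where "n = (LEAST n. m \<le> fst (X n))"
    have n: "m \<le> fst (X n)" unfolding n_def by (rule LeastI[of _ m]) (rule lev)
    show "\<exists>k. \<xi> \<in> dcl (m, k) \<and> \<tau> (m, k)"
    proof (cases n)
      case 0
      then have "(m, snd I0) = X 0" using n m X0 by (simp add: prod_eq_iff)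
      moreover have "\<tau> (X 0)" using X2[of 0] dsub_refl by blast
      ultimately show ?thesis using \<xi>[of 0] by metis
    next
      case (Suc j)
      then have j: "fst (X j) < m" using not_less_Least[of j "\<lambda>n. m \<le> fst (X n)"] by (simp add: n_def)
      define A where "A = (m, snd (X n) div 2 ^ (fst (X n) - m))"
      have A: "X (Suc j) \<sqsubseteq> A" using n Suc by (simp add: A_def dsub_def)
      have "A \<sqsubseteq> X j" using dsub_comparable_aux[of "X (Suc j)" "X j" A] A X2[of j] j by (simp add: A_def)
      then have "\<tau> A" using X2[of j] A by blast
      moreover have "\<xi> \<in> dcl A" using \<xi>[of "Suc j"] dcl_mono[OF A] by blast
      ultimately show ?thesis unfolding A_def by blast
    qed
  qed
qed

section \<open>Hyperbolic Lipschitz functions on the upper half-plane\<close>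

text \<open>The top left corner of the square over J. Taking the left corner puts
  \<open>dpt (Suc m, 2 * k)\<close> straight below \<open>dpt (m, k)\<close>, so Q changes along a
  left spine by vertical moves only.\<close>

definition dpt :: "nat \<times> int \<Rightarrow> complex" where
  "dpt J = Complex (of_int (snd J) / 2 ^ fst J) (dlen J)"

lemma Re_dpt [simp]: "Re (dpt J) = of_int (snd J) / 2 ^ fst J"
  and Im_dpt [simp]: "Im (dpt J) = dlen J"
  by (simp_all add: dpt_def)

text \<open>\<open>lip\<close> bounds the hyperbolic derivative by d; in the half-plane
  \<open>2 * Im z\<close> has the role of 1 - |z|^2 in the disc.\<close>

locale hyp_lipschitz =
  fixes g :: "complex \<Rightarrow> complex" and d :: real
  assumes holo: "g holomorphic_on {z. 0 < Im z}"
    and lt1: "\<And>z. 0 < Im z \<Longrightarrow> norm (g z) < 1"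
    and d: "0 < d" "d < 1"
    and lip: "\<And>z. 0 < Im z \<Longrightarrow> 2 * Im z * norm (deriv g z) \<le> d * (1 - (norm (g z))\<^sup>2)"
begin

definition Q :: "complex \<Rightarrow> real" where "Q z = 1 - (norm (g z))\<^sup>2"

lemma Q_pos: "0 < Im z \<Longrightarrow> 0 < Q z"
  using lt1[of z] by (simp add: Q_def power_less_one_iff abs_square_less_1)

lemma Q_le_1: "Q z \<le> 1"
  by (simp add: Q_def)

lemma norm_deriv_le: "0 < Im z \<Longrightarrow> norm (deriv g z) \<le> d * Q z / (2 * Im z)"
  using lip[of z] by (simp add: Q_def field_simps)

lemma field_deriv: "0 < Im z \<Longrightarrow> (g has_field_derivative deriv g z) (at z)"
  using holomorphic_derivI[OF holo open_halfspace_Im_gt[of 0]] by simp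

lemma line_deriv:
  assumes "0 < Im (z0 + of_real s * v)"
  shows "((\<lambda>s. g (z0 + of_real s * v)) has_vector_derivative deriv g (z0 + of_real s * v) * v) (at s)"
proof -
  have "((\<lambda>s. z0 + of_real s * v) has_vector_derivative v) (at s)"
    by (auto intro!: derivative_eq_intros)
  from field_vector_diff_chain_at[OF this field_deriv[OF assms]] show ?thesis
    by (simp add: o_def mult.commute)
qed

text \<open>The gradient of ln Q has norm at most 2 |g| |g'| / Q, and |g| < 1, so \<open>lip\<close>
  bounds it by d / Im z.\<close>

lemma lnQ_line_deriv:
  assumes "0 < Im (z0 + of_real s * v)"
  shows "\<exists>D. ((\<lambda>s. ln (Q (z0 + of_real s * v))) has_real_derivative D) (at s) \<and>
    \<bar>D\<bar> \<le> d * norm v / Im (z0 + of_real s * v)"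
proof -
  define z where "z = z0 + of_real s * v"
  have zpos: "0 < Im z" using assms by (simp add: z_def)
  define w where "w = deriv g z * v"
  have g': "((\<lambda>s. g (z0 + of_real s * v)) has_vector_derivative w) (at s)"
    using line_deriv[OF assms] by (simp add: w_def z_def)
  have re: "((\<lambda>s. Re (g (z0 + of_real s * v))) has_real_derivative Re w) (at s)"
    using bounded_linear.has_vector_derivative[OF bounded_linear_Re g']
    by (simp add: has_real_derivative_iff_has_vector_derivative)
  have im: "((\<lambda>s. Im (g (z0 + of_real s * v))) has_real_derivative Im w) (at s)"
    using bounded_linear.has_vector_derivative[OF bounded_linear_Im g']
    by (simp add: has_real_derivative_iff_has_vector_derivative)
  have Qd: "((\<lambda>s. Q (z0 + of_real s * v)) has_real_derivative - 2 * Re (cnj (g z) * w)) (at s)"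
    unfolding Q_def cmod_power2
    by (rule derivative_eq_intros re im refl)+ (simp add: z_def algebra_simps)
  have Qpos: "0 < Q z" using Q_pos[OF zpos] .
  have lnd: "((\<lambda>s. ln (Q (z0 + of_real s * v))) has_real_derivative - 2 * Re (cnj (g z) * w) / Q z) (at s)"
    by (rule derivative_eq_intros Qd refl | use Qpos in \<open>simp add: z_def\<close>)+
  have "\<bar>Re (cnj (g z) * w)\<bar> \<le> norm (g z) * norm w"
    using abs_Re_le_cmod[of "cnj (g z) * w"] by (simp add: norm_mult)
  also have "\<dots> \<le> 1 * norm w" using lt1[OF zpos] by (intro mult_right_mono) auto
  also have "\<dots> \<le> d * Q z / (2 * Im z) * norm v"
    unfolding w_def norm_mult mult_1 by (rule mult_right_mono[OF norm_deriv_le[OF zpos]]) simp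
  finally have *: "\<bar>Re (cnj (g z) * w)\<bar> \<le> d * Q z / (2 * Im z) * norm v" .
  have "\<bar>- 2 * Re (cnj (g z) * w) / Q z\<bar> = 2 * \<bar>Re (cnj (g z) * w)\<bar> / Q z"
    unfolding abs_divide abs_mult using Qpos by simp
  also have "\<dots> \<le> 2 * (d * Q z / (2 * Im z) * norm v) / Q z"
    using * Qpos by (intro divide_right_mono mult_left_mono) auto
  finally have "\<bar>- 2 * Re (cnj (g z) * w) / Q z\<bar> \<le> d * norm v / Im z"
    using Qpos by simp
  then show ?thesis using lnd unfolding z_def by blast
qed

text \<open>\<open>\<psi>\<close> majorises arc length for |dz| / Im z. Along it ln Q moves at rate
  at most d, but g itself at rate d / 2 because Q <= 1.\<close>

lemma line_bounds:
  assumes ab: "a \<le> b" and pos: "\<And>s. a \<le> s \<Longrightarrow> s \<le> b \<Longrightarrow> 0 < Im (z0 + of_real s * v)"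
    and \<psi>: "\<And>s. a \<le> s \<Longrightarrow> s \<le> b \<Longrightarrow> (\<psi> has_real_derivative \<psi>' s) (at s)"
    and bd: "\<And>s. a \<le> s \<Longrightarrow> s \<le> b \<Longrightarrow> norm v / Im (z0 + of_real s * v) \<le> \<psi>' s"
  shows "\<bar>ln (Q (z0 + of_real b * v)) - ln (Q (z0 + of_real a * v))\<bar> \<le> d * (\<psi> b - \<psi> a)"
    and "norm (g (z0 + of_real b * v) - g (z0 + of_real a * v)) \<le> d / 2 * (\<psi> b - \<psi> a)"
proof -
  define D where "D s = (SOME D. ((\<lambda>s. ln (Q (z0 + of_real s * v))) has_real_derivative D) (at s) \<and>
    \<bar>D\<bar> \<le> d * norm v / Im (z0 + of_real s * v))" for s
  have D: "((\<lambda>s. ln (Q (z0 + of_real s * v))) has_real_derivative D s) (at s) \<and>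
      \<bar>D s\<bar> \<le> d * norm v / Im (z0 + of_real s * v)" if "a \<le> s" "s \<le> b" for s
    unfolding D_def by (rule someI_ex[OF lnQ_line_deriv[OF pos[OF that]]])
  have Db: "\<bar>D s\<bar> \<le> d * \<psi>' s" if "a \<le> s" "s \<le> b" for s
  proof -
    have "d * norm v / Im (z0 + of_real s * v) \<le> d * \<psi>' s"
      using bd[OF that] d by (metis mult_left_mono less_imp_le times_divide_eq_right)
    then show ?thesis using D[OF that] by linarith
  qed
  show "\<bar>ln (Q (z0 + of_real b * v)) - ln (Q (z0 + of_real a * v))\<bar> \<le> d * (\<psi> b - \<psi> a)"
  proof (cases "a = b")
    case False
    then have "a < b" using ab by simp
    have "norm (ln (Q (z0 + of_real b * v)) - ln (Q (z0 + of_real a * v))) \<le> d * \<psi> b - d * \<psi> a"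
    proof (rule differentiable_bound_general[OF \<open>a < b\<close>, of "\<lambda>s. ln (Q (z0 + of_real s * v))" "\<lambda>s. d * \<psi> s" D "\<lambda>s. d * \<psi>' s"])
      show "continuous_on {a..b} (\<lambda>s. ln (Q (z0 + of_real s * v)))"
        by (intro continuous_at_imp_continuous_on ballI DERIV_isCont) (use D in auto)
      show "continuous_on {a..b} (\<lambda>s. d * \<psi> s)"
        by (intro continuous_at_imp_continuous_on ballI continuous_intros DERIV_isCont[OF \<psi>]) auto
    qed (use D \<psi> Db in \<open>auto simp flip: has_real_derivative_iff_has_vector_derivative intro!: derivative_eq_intros\<close>)
    then show ?thesis by (simp add: algebra_simps)
  qed simp
  show "norm (g (z0 + of_real b * v) - g (z0 + of_real a * v)) \<le> d / 2 * (\<psi> b - \<psi> a)"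
  proof (cases "a = b")
    case False
    then have "a < b" using ab by simp
    have "norm (g (z0 + of_real b * v) - g (z0 + of_real a * v)) \<le> d / 2 * \<psi> b - d / 2 * \<psi> a"
    proof (rule differentiable_bound_general[OF \<open>a < b\<close>, of "\<lambda>s. g (z0 + of_real s * v)" "\<lambda>s. d / 2 * \<psi> s"
          "\<lambda>s. deriv g (z0 + of_real s * v) * v" "\<lambda>s. d / 2 * \<psi>' s"])
      show "continuous_on {a..b} (\<lambda>s. g (z0 + of_real s * v))"
        by (intro continuous_at_imp_continuous_on ballI has_vector_derivative_continuous[OF line_deriv] pos) auto
      show "continuous_on {a..b} (\<lambda>s. d / 2 * \<psi> s)"
        by (intro continuous_at_imp_continuous_on ballI continuous_intros DERIV_isCont[OF \<psi>]) auto
      fix s assume s: "a < s" "s < b"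
      show "((\<lambda>s. g (z0 + of_real s * v)) has_vector_derivative deriv g (z0 + of_real s * v) * v) (at s)"
        using line_deriv pos s by simp
      show "((\<lambda>s. d / 2 * \<psi> s) has_vector_derivative d / 2 * \<psi>' s) (at s)"
        using \<psi>[of s] s by (auto simp flip: has_real_derivative_iff_has_vector_derivative intro!: derivative_eq_intros)
      have p: "0 < Im (z0 + of_real s * v)" using pos s by simp
      have "norm (deriv g (z0 + of_real s * v)) \<le> d * 1 / (2 * Im (z0 + of_real s * v))"
        using norm_deriv_le[OF p]
        by (rule order_trans) (use p d Q_le_1 in \<open>intro divide_right_mono mult_left_mono; auto\<close>)
      then have "norm (deriv g (z0 + of_real s * v) * v) \<le> d * 1 / (2 * Im (z0 + of_real s * v)) * norm v"
        unfolding norm_mult by (rule mult_right_mono) simp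
      also have "\<dots> = d / 2 * (norm v / Im (z0 + of_real s * v))" by simp
      also have "\<dots> \<le> d / 2 * \<psi>' s" using bd[of s] s d by (intro mult_left_mono) auto
      finally show "norm (deriv g (z0 + of_real s * v) * v) \<le> d / 2 * \<psi>' s" .
    qed
    then show ?thesis by (simp add: algebra_simps)
  qed simp
qed

lemma vertical_bounds:
  assumes "0 < y1" "y1 \<le> y2"
  shows "\<bar>ln (Q (Complex x y2)) - ln (Q (Complex x y1))\<bar> \<le> d * ln (y2 / y1)"
    and "norm (g (Complex x y2) - g (Complex x y1)) \<le> d / 2 * ln (y2 / y1)"
proof -
  have c: "of_real x + of_real s * \<i> = Complex x s" for s
    by (simp add: complex_eq_iff)
  have b: "\<And>s. y1 \<le> s \<Longrightarrow> s \<le> y2 \<Longrightarrow> (ln has_real_derivative 1 / s) (at s)"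
    using assms by (auto intro!: derivative_eq_intros)
  show "\<bar>ln (Q (Complex x y2)) - ln (Q (Complex x y1))\<bar> \<le> d * ln (y2 / y1)"
    "norm (g (Complex x y2) - g (Complex x y1)) \<le> d / 2 * ln (y2 / y1)"
    using line_bounds[of y1 y2 "of_real x" \<i> ln "\<lambda>s. 1 / s"] b assms by (simp_all add: c ln_div)
qed

lemma horizontal_bounds:
  assumes "0 < y"
  shows "\<bar>ln (Q (Complex x2 y)) - ln (Q (Complex x1 y))\<bar> \<le> d * (\<bar>x2 - x1\<bar> / y)"
    and "norm (g (Complex x2 y) - g (Complex x1 y)) \<le> d / 2 * (\<bar>x2 - x1\<bar> / y)"
proof -
  have c: "\<i> * of_real y + of_real s * 1 = Complex s y" for s
    by (simp add: complex_eq_iff)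
  have *: "\<bar>ln (Q (Complex x2 y)) - ln (Q (Complex x1 y))\<bar> \<le> d * ((x2 - x1) / y) \<and>
     norm (g (Complex x2 y) - g (Complex x1 y)) \<le> d / 2 * ((x2 - x1) / y)" if "x1 \<le> x2" for x1 x2
  proof -
    have "((\<lambda>s. s / y) has_real_derivative 1 / y) (at s)" for s
      using assms by (auto intro!: derivative_eq_intros)
    then show ?thesis
      using line_bounds[of x1 x2 "\<i> * of_real y" 1 "\<lambda>s. s / y" "\<lambda>s. 1 / y"] assms that
      unfolding c by (simp add: diff_divide_distrib)
  qed
  show "\<bar>ln (Q (Complex x2 y)) - ln (Q (Complex x1 y))\<bar> \<le> d * (\<bar>x2 - x1\<bar> / y)"
    "norm (g (Complex x2 y) - g (Complex x1 y)) \<le> d / 2 * (\<bar>x2 - x1\<bar> / y)"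
    using *[of x1 x2] *[of x2 x1] by (cases "x1 \<le> x2"; simp add: abs_minus_commute norm_minus_commute)+
qed

lemma Q_le_exp:
  assumes "0 < Im z" "0 < Im z'" "\<bar>ln (Q z) - ln (Q z')\<bar> \<le> r"
  shows "Q z \<le> exp r * Q z'"
proof -
  have "ln (Q z) \<le> r + ln (Q z')" using assms by linarith
  then have "exp (ln (Q z)) \<le> exp (r + ln (Q z'))" by simp
  then show ?thesis using Q_pos assms by (simp add: exp_add)
qed

lemma Q_vertical:
  assumes "0 < y1" "y1 \<le> y2"
  shows "Q (Complex x y1) \<le> (y2 / y1) powr d * Q (Complex x y2)"
    and "Q (Complex x y2) \<le> (y2 / y1) powr d * Q (Complex x y1)"
  using Q_le_exp[of "Complex x y1" "Complex x y2" "d * ln (y2 / y1)"]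
    Q_le_exp[of "Complex x y2" "Complex x y1" "d * ln (y2 / y1)"] vertical_bounds[OF assms, of x] assms
  by (auto simp: powr_def abs_minus_commute)

lemma Q_horizontal:
  assumes "0 < y" "\<bar>x2 - x1\<bar> \<le> y"
  shows "Q (Complex x2 y) \<le> 3 * Q (Complex x1 y)"
proof -
  have "d * (\<bar>x2 - x1\<bar> / y) \<le> 1 * 1" using assms d by (intro mult_mono) auto
  then have "\<bar>ln (Q (Complex x2 y)) - ln (Q (Complex x1 y))\<bar> \<le> 1"
    using horizontal_bounds(1)[OF assms(1), of x2 x1] by linarith
  then have "Q (Complex x2 y) \<le> exp 1 * Q (Complex x1 y)" using assms by (intro Q_le_exp) auto
  also have "\<dots> \<le> 3 * Q (Complex x1 y)"
    using exp_le Q_pos[of "Complex x1 y"] assms by (intro mult_right_mono) auto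
  finally show ?thesis .
qed

text \<open>From c to z go horizontally by at most 2 and then vertically by at most ln 4 in the
  metric |dz| / Im z. Then exp (2 + ln 4) <= 3 * 3 * 4 = 36 and d + (d / 2) ln 4 <= 2 d. For
  \<open>c = dpt J\<close> the region contains the top edge of J, the walls below its two ends and
  the top edges of its children.\<close>

lemma near:
  assumes h: "0 < Im c" and z: "\<bar>Re z - Re c\<bar> \<le> 2 * Im c" "Im c / 4 \<le> Im z" "Im z \<le> 2 * Im c"
  shows "Q z \<le> 36 * Q c" "Q c \<le> 36 * Q z" "norm (g z - g c) \<le> 2 * d"
proof -
  define p where "p = Complex (Re z) (Im c)"
  have zpos: "0 < Im z" using h z by linarith
  have ln4: "ln 4 \<le> (2::real)" using ln_add_one_self_le_self[of 1] ln_mult[of 2 "2::real"] by simp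
  have H1: "\<bar>ln (Q p) - ln (Q c)\<bar> \<le> 2 * d" and H2: "norm (g p - g c) \<le> d"
  proof -
    have q: "\<bar>Re z - Re c\<bar> / Im c \<le> 2" using h z by (simp add: field_simps)
    have "d * (\<bar>Re z - Re c\<bar> / Im c) \<le> d * 2" using q d by (intro mult_left_mono) auto
    then show "\<bar>ln (Q p) - ln (Q c)\<bar> \<le> 2 * d"
      using horizontal_bounds(1)[OF h, of "Re z" "Re c"] by (simp add: p_def)
    have "d / 2 * (\<bar>Re z - Re c\<bar> / Im c) \<le> d / 2 * 2" using q d by (intro mult_left_mono) auto
    then show "norm (g p - g c) \<le> d"
      using horizontal_bounds(2)[OF h, of "Re z" "Re c"] by (simp add: p_def)
  qed
  have V: "\<bar>ln (Q z) - ln (Q p)\<bar> \<le> d * ln 4 \<and> norm (g z - g p) \<le> d / 2 * ln 4"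
  proof (cases "Im c \<le> Im z")
    case True
    have "ln (Im z / Im c) \<le> ln 4" using h z True by (subst ln_le_cancel_iff) (auto simp: field_simps)
    then have "d * ln (Im z / Im c) \<le> d * ln 4 \<and> d / 2 * ln (Im z / Im c) \<le> d / 2 * ln 4"
      using d by (auto intro!: mult_left_mono)
    then show ?thesis using vertical_bounds[OF h True, of "Re z"] by (simp add: p_def)
  next
    case False
    have "ln (Im c / Im z) \<le> ln 4" using h z zpos False by (subst ln_le_cancel_iff) (auto simp: field_simps)
    then have "d * ln (Im c / Im z) \<le> d * ln 4 \<and> d / 2 * ln (Im c / Im z) \<le> d / 2 * ln 4"
      using d by (auto intro!: mult_left_mono)
    then show ?thesis using vertical_bounds[of "Im z" "Im c" "Re z"] False zpos
      by (simp add: p_def abs_minus_commute norm_minus_commute)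
  qed
  have "norm (g z - g c) \<le> norm (g z - g p) + norm (g p - g c)" by (metis dist_norm dist_triangle)
  also have "\<dots> \<le> d / 2 * ln 4 + d" using V H2 by simp
  also have "\<dots> \<le> d / 2 * 2 + d" using ln4 d by (intro add_right_mono mult_left_mono) auto
  finally show "norm (g z - g c) \<le> 2 * d" by simp
  have L: "\<bar>ln (Q z) - ln (Q c)\<bar> \<le> 2 + ln 4"
  proof -
    have "d * ln 4 \<le> 1 * ln 4" "2 * d \<le> 2" using d by (auto intro!: mult_right_mono)
    then show ?thesis using V H1 by linarith
  qed
  have "exp (2 + ln 4) = exp 1 * exp 1 * (4::real)"
    using exp_add[of 1 "1::real"] by (simp add: exp_add)
  also have "\<dots> \<le> 3 * 3 * 4" using exp_le by (intro mult_mono) auto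
  finally have e: "exp (2 + ln 4) \<le> 3 * 3 * (4::real)" .
  have e': "exp (2 + ln 4) \<le> (36::real)" using e by simp
  show "Q z \<le> 36 * Q c"
    by (rule order_trans[OF Q_le_exp[OF zpos h L] mult_right_mono[OF e']]) (use Q_pos[OF h] in simp)
  show "Q c \<le> 36 * Q z"
    by (rule order_trans[OF Q_le_exp[OF h zpos, of "2 + ln 4"] mult_right_mono[OF e']])
       (use Q_pos[OF zpos] L in \<open>simp_all add: abs_minus_commute\<close>)
qed

text \<open>The first bound makes returns short: from small Q above I, a large Q above J needs a
  large ratio |I| / |J|. The second limits the loss of Q over finitely many generations.\<close>

lemma Q_dsub:
  assumes "J \<sqsubseteq> I"
  shows "Q (dpt J) \<le> 3 * (dlen I / dlen J) powr d * Q (dpt I)"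
    and "Q (dpt I) \<le> 3 * (dlen I / dlen J) powr d * Q (dpt J)"
proof -
  define p where "p = Complex (Re (dpt J)) (dlen I)"
  have "Re (dpt J) \<in> dint J" by (simp add: dint_def divide_strict_right_mono)
  then have "Re (dpt J) \<in> dint I" using dint_mono[OF assms] by blast
  then have "\<bar>Re (dpt J) - Re (dpt I)\<bar> \<le> dlen I"
    by (simp add: dint_def dlen_def add_divide_distrib)
  then have h: "Q p \<le> 3 * Q (dpt I)" "Q (dpt I) \<le> 3 * Q p"
    using Q_horizontal[of "dlen I" "Re (dpt J)" "Re (dpt I)"] Q_horizontal[of "dlen I" "Re (dpt I)" "Re (dpt J)"]
    by (auto simp: p_def dpt_def abs_minus_commute)
  have v: "Q (dpt J) \<le> (dlen I / dlen J) powr d * Q p" "Q p \<le> (dlen I / dlen J) powr d * Q (dpt J)"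
    using Q_vertical[of "dlen J" "dlen I" "Re (dpt J)"] dlen_mono[OF assms] by (auto simp: p_def dpt_def)
  show "Q (dpt J) \<le> 3 * (dlen I / dlen J) powr d * Q (dpt I)"
    using v(1) mult_left_mono[OF h(1), of "(dlen I / dlen J) powr d"] by (simp add: mult_ac)
  show "Q (dpt I) \<le> 3 * (dlen I / dlen J) powr d * Q (dpt J)"
    using h(2) v(2) by (simp add: mult_ac)
qed

end

section \<open>Green's formula on sawtooth regions\<close>

text \<open>The two partial derivatives, \<open>l - \<i> y l'\<close> here and \<open>y l'\<close>
  in the vertical case, give the coefficients of the flux form for l = ln g after taking minus the
  real part. Since l cancels from the vertical one, vertical moves cost only y |l'|;
  \<open>boundary_martingale\<close> uses this with l = g.\<close>

lemma primitive_deriv_horizontal: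
  assumes B: "(B has_field_derivative l (Complex x y)) (at (Complex x y))"
    and l: "(l has_field_derivative l') (at (Complex x y))"
  shows "((\<lambda>x. B (Complex x y) - \<i> * of_real y * l (Complex x y)) has_vector_derivative
    l (Complex x y) - \<i> * of_real y * l') (at x)"
proof -
  have c: "Complex x y = of_real x + \<i> * of_real y" for x by (simp add: complex_eq_iff)
  have cv: "((\<lambda>x. Complex x y) has_vector_derivative 1) (at x)"
    unfolding c by (auto intro!: derivative_eq_intros)
  have d1: "((\<lambda>x. B (Complex x y)) has_vector_derivative l (Complex x y)) (at x)"
    using field_vector_diff_chain_at[OF cv B] by (simp add: o_def)
  have d2: "((\<lambda>x. l (Complex x y)) has_vector_derivative l') (at x)"
    using field_vector_diff_chain_at[OF cv l] by (simp add: o_def)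
  show ?thesis by (intro has_vector_derivative_diff d1 has_vector_derivative_mult_right d2)
qed

lemma primitive_deriv_vertical:
  assumes B: "(B has_field_derivative l (Complex x y)) (at (Complex x y))"
    and l: "(l has_field_derivative l') (at (Complex x y))"
  shows "((\<lambda>y. B (Complex x y) - \<i> * of_real y * l (Complex x y)) has_vector_derivative of_real y * l') (at y)"
proof -
  have c: "Complex x y = of_real x + of_real y * \<i>" for y by (simp add: complex_eq_iff)
  have cv: "((\<lambda>y. Complex x y) has_vector_derivative \<i>) (at y)"
    unfolding c by (auto intro!: derivative_eq_intros)
  have d1: "((\<lambda>y. B (Complex x y)) has_vector_derivative \<i> * l (Complex x y)) (at y)"
    using field_vector_diff_chain_at[OF cv B] by (simp add: o_def)
  have d2: "((\<lambda>y. l (Complex x y)) has_vector_derivative \<i> * l') (at y)"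
    using field_vector_diff_chain_at[OF cv l] by (simp add: o_def)
  have d3: "((\<lambda>y. \<i> * complex_of_real y) has_vector_derivative \<i>) (at y)"
    by (auto intro!: derivative_eq_intros)
  have "((\<lambda>y. B (Complex x y) - \<i> * of_real y * l (Complex x y)) has_vector_derivative
     (\<i> * l (Complex x y) - (\<i> * of_real y * (\<i> * l') + \<i> * l (Complex x y)))) (at y)"
    by (intro has_vector_derivative_diff d1 has_vector_derivative_mult d2 d3)
  moreover have "\<i> * l (Complex x y) - (\<i> * of_real y * (\<i> * l') + \<i> * l (Complex x y)) = of_real y * l'"
    by (simp add: algebra_simps)
  ultimately show ?thesis by simp
qed

lemma integral_horizontal:
  assumes l: "\<And>z. z \<in> N \<Longrightarrow> (l has_field_derivative l' z) (at z)"
    and B: "\<And>z. z \<in> N \<Longrightarrow> (B has_field_derivative l z) (at z)"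
    and ab: "a \<le> b" and seg: "\<And>x. a \<le> x \<Longrightarrow> x \<le> b \<Longrightarrow> Complex x y \<in> N"
  shows "((\<lambda>x. - Re (l (Complex x y)) - y * Im (l' (Complex x y))) has_integral
    (Re (B (Complex a y) - \<i> * of_real y * l (Complex a y)) - Re (B (Complex b y) - \<i> * of_real y * l (Complex b y)))) {a..b}"
proof -
  have "((\<lambda>x. - Re (l (Complex x y)) - y * Im (l' (Complex x y))) has_integral
    (- Re (B (Complex b y) - \<i> * of_real y * l (Complex b y)) - (- Re (B (Complex a y) - \<i> * of_real y * l (Complex a y))))) {a..b}"
  proof (rule fundamental_theorem_of_calculus[OF ab])
    fix x assume "x \<in> {a..b}"
    then have zN: "Complex x y \<in> N" using seg by simp
    show "((\<lambda>x. - Re (B (Complex x y) - \<i> * of_real y * l (Complex x y))) has_vector_derivative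
       - Re (l (Complex x y)) - y * Im (l' (Complex x y))) (at x within {a..b})"
      using has_vector_derivative_minus[OF bounded_linear.has_vector_derivative[OF bounded_linear_Re
            primitive_deriv_horizontal[OF B[OF zN] l[OF zN]]]]
      by (auto intro: has_vector_derivative_at_within)
  qed
  then show ?thesis by (simp add: algebra_simps)
qed

lemma integral_vertical:
  assumes l: "\<And>z. z \<in> N \<Longrightarrow> (l has_field_derivative l' z) (at z)"
    and B: "\<And>z. z \<in> N \<Longrightarrow> (B has_field_derivative l z) (at z)"
    and ab: "a \<le> b" and seg: "\<And>y. a \<le> y \<Longrightarrow> y \<le> b \<Longrightarrow> Complex x y \<in> N"
  shows "((\<lambda>y. - (y * Re (l' (Complex x y)))) has_integral
    (Re (B (Complex x a) - \<i> * of_real a * l (Complex x a)) - Re (B (Complex x b) - \<i> * of_real b * l (Complex x b)))) {a..b}"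
proof -
  have "((\<lambda>y. - (y * Re (l' (Complex x y)))) has_integral
    (- Re (B (Complex x b) - \<i> * of_real b * l (Complex x b)) - (- Re (B (Complex x a) - \<i> * of_real a * l (Complex x a))))) {a..b}"
  proof (rule fundamental_theorem_of_calculus[OF ab])
    fix y assume "y \<in> {a..b}"
    then have zN: "Complex x y \<in> N" using seg by simp
    show "((\<lambda>y. - Re (B (Complex x y) - \<i> * of_real y * l (Complex x y))) has_vector_derivative
       - (y * Re (l' (Complex x y)))) (at y within {a..b})"
      using has_vector_derivative_minus[OF bounded_linear.has_vector_derivative[OF bounded_linear_Re
            primitive_deriv_vertical[OF B[OF zN] l[OF zN]]]]
      by (auto intro: has_vector_derivative_at_within)
  qed
  then show ?thesis by (simp add: algebra_simps)
qed

text \<open>\<open>\<gamma>\<close> keeps zeros away from the boxes around unstopped intervals. G is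
  a supersolution of the recursion down a column of walls: one wall costs d / (2 \<gamma>) times Q
  and length, and the next generation multiplies Q by at most \<open>2 powr d\<close> and length by
  1 / 2.\<close>

locale sawtooth = hyp_lipschitz +
  fixes \<delta> t \<gamma> G :: real
  assumes \<gamma>: "0 < \<gamma>"
    and nonstop_box: "\<And>J z. \<delta> < norm (g (dpt J)) \<Longrightarrow> norm (g (dpt J)) < t \<Longrightarrow>
      \<bar>Re z - Re (dpt J)\<bar> \<le> 2 * dlen J \<Longrightarrow> dlen J / 4 \<le> Im z \<Longrightarrow> Im z \<le> 2 * dlen J \<Longrightarrow> \<gamma> \<le> norm (g z)"
    and G: "0 \<le> G" "d / (2 * \<gamma>) + G * (2 powr d / 2) \<le> G"
begin

definition stop :: "nat \<times> int \<Rightarrow> bool" where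
  "stop J \<longleftrightarrow> norm (g (dpt J)) \<le> \<delta> \<or> t \<le> norm (g (dpt J))"

text \<open>With \<open>u = - ln \<bar>g\<bar>\<close>, the flux of the closed form \<open>(u - y u\<^sub>y) dx + y u\<^sub>x dy\<close> through the
  top edge over a dyadic interval, and through the wall below its left corner.\<close>

definition V :: "nat \<Rightarrow> int \<Rightarrow> real" where
  "V m k = integral {of_int k / 2 ^ m .. of_int (k + 1) / 2 ^ m}
     (\<lambda>x. - ln (norm (g (Complex x (1 / 2 ^ m)))) -
        1 / 2 ^ m * Im (deriv g (Complex x (1 / 2 ^ m)) / g (Complex x (1 / 2 ^ m))))"

definition W :: "nat \<Rightarrow> int \<Rightarrow> real" where
  "W m k = integral {1 / 2 ^ Suc m .. 1 / 2 ^ m}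
     (\<lambda>y. - (y * Re (deriv g (Complex (of_int k / 2 ^ m) y) / g (Complex (of_int k / 2 ^ m) y))))"

text \<open>If \<open>l\<close> is a logarithm of \<open>g\<close> and \<open>B' = l\<close>, then \<open>- Re (B - \<i> y l)\<close> is a primitive of the
  flux form.\<close>

lemma box_identity:
  assumes ns: "\<not> stop (m, k)"
  shows "V m k = V (Suc m) (2 * k) + V (Suc m) (2 * k + 1) + W m (k + 1) - W m k"
proof -
  define L where "L = 1 / (2::real) ^ m"
  define a where "a = of_int k / (2::real) ^ m"
  have L: "0 < L" by (simp add: L_def)
  \<comment> \<open>Open, convex, and containing the closed rectangle with base from a to a + L and
    heights from L / 2 to L; \<open>nonstop_box\<close> excludes zeros there, so g has a logarithm
    and that has a primitive.\<close>
  define N where "N = {z. a - L < Re z} \<inter> {z. Re z < a + 2 * L} \<inter> {z. L / 4 < Im z} \<inter> {z. Im z < 2 * L}"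
  have Nopen: "open N" unfolding N_def
    by (intro open_Int open_halfspace_Re_gt open_halfspace_Re_lt open_halfspace_Im_gt open_halfspace_Im_lt)
  have Nconv: "convex N" unfolding N_def
    by (intro convex_Int convex_halfspace_Re_gt convex_halfspace_Re_lt convex_halfspace_Im_gt convex_halfspace_Im_lt)
  have Npos: "0 < Im z" if "z \<in> N" for z using that L by (auto simp: N_def)
  have dp: "Re (dpt (m, k)) = a" "dlen (m, k) = L" by (simp_all add: a_def L_def dlen_def)
  have gnz: "g z \<noteq> 0" if "z \<in> N" for z
    using nonstop_box[of "(m, k)" z] ns that \<gamma> L by (auto simp: N_def dp stop_def abs_le_iff simp del: Re_dpt)
  have gN: "g holomorphic_on N" using holo Npos by (auto intro: holomorphic_on_subset)
  obtain l where l: "l holomorphic_on N" "\<And>z. z \<in> N \<Longrightarrow> g z = exp (l z)"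
    using contractible_imp_holomorphic_log[OF gN convex_imp_contractible[OF Nconv] gnz] by blast
  obtain B where B: "\<And>z. z \<in> N \<Longrightarrow> (B has_field_derivative l z) (at z)"
    using holomorphic_convex_primitive'[OF Nconv Nopen l(1)] Nopen by (metis at_within_open)
  have l': "(l has_field_derivative deriv g z / g z) (at z)" if z: "z \<in> N" for z
  proof -
    have 1: "(l has_field_derivative deriv l z) (at z)" using holomorphic_derivI[OF l(1) Nopen z] .
    have "((\<lambda>z. exp (l z)) has_field_derivative exp (l z) * deriv l z) (at z)"
      using 1 by (auto intro!: derivative_eq_intros)
    then have "(g has_field_derivative exp (l z) * deriv l z) (at z)"
      by (rule has_field_derivative_transform_within_open[OF _ Nopen z]) (simp add: l(2))
    then have "deriv g z = g z * deriv l z" using l(2)[OF z] by (simp add: DERIV_imp_deriv)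
    then show ?thesis using 1 gnz[OF z] by simp
  qed
  have Rel: "Re (l z) = ln (norm (g z))" if "z \<in> N" for z
    using l(2)[OF that] by simp
  define P where "P z = Re (B z - \<i> * of_real (Im z) * l z)" for z
  have hor: "integral {x1..x2} (\<lambda>x. - ln (norm (g (Complex x y))) - y * Im (deriv g (Complex x y) / g (Complex x y)))
      = P (Complex x1 y) - P (Complex x2 y)"
    if "a \<le> x1" "x1 \<le> x2" "x2 \<le> a + L" "L / 2 \<le> y" "y \<le> L" for x1 x2 y
  proof -
    have inN: "Complex x y \<in> N" if "x1 \<le> x" "x \<le> x2" for x
      using that \<open>a \<le> x1\<close> \<open>x2 \<le> a + L\<close> \<open>L / 2 \<le> y\<close> \<open>y \<le> L\<close> L by (auto simp: N_def)
    have "((\<lambda>x. - Re (l (Complex x y)) - y * Im (deriv g (Complex x y) / g (Complex x y))) has_integral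
      (P (Complex x1 y) - P (Complex x2 y))) {x1..x2}"
      using integral_horizontal[OF l' B \<open>x1 \<le> x2\<close> inN] by (simp add: P_def)
    then have "((\<lambda>x. - ln (norm (g (Complex x y))) - y * Im (deriv g (Complex x y) / g (Complex x y))) has_integral
      (P (Complex x1 y) - P (Complex x2 y))) {x1..x2}"
      by (rule has_integral_eq[rotated]) (use inN Rel in auto)
    then show ?thesis by (rule integral_unique)
  qed
  have ver: "integral {L / 2..L} (\<lambda>y. - (y * Re (deriv g (Complex x y) / g (Complex x y))))
      = P (Complex x (L / 2)) - P (Complex x L)" if "a \<le> x" "x \<le> a + L" for x
    using integral_unique[OF integral_vertical[of N l "\<lambda>z. deriv g z / g z" B "L / 2" L x, OF l' B]] that L
    by (auto simp: P_def N_def)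
  have e: "a + L = of_int (k + 1) / 2 ^ m" "L / 2 = 1 / 2 ^ Suc m"
    "a = of_int (2 * k) / 2 ^ Suc m" "a + L / 2 = of_int (2 * k + 1) / 2 ^ Suc m"
    "a + L = of_int (2 * k + 1 + 1) / 2 ^ Suc m"
    by (simp_all add: a_def L_def field_simps)
  \<comment> \<open>All five fluxes are differences of P between points of the rectangle's boundary,
    so the integral of the closed form around it telescopes to zero.\<close>
  have "V m k = P (Complex a L) - P (Complex (a + L) L)"
    using hor[of a "a + L" L] L unfolding V_def e(1)[symmetric] L_def[symmetric] a_def[symmetric] by simp
  moreover have "V (Suc m) (2 * k) = P (Complex a (L / 2)) - P (Complex (a + L / 2) (L / 2))"
    using hor[of a "a + L / 2" "L / 2"] L unfolding V_def e(2,3,4)[symmetric] by simp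
  moreover have "V (Suc m) (2 * k + 1) = P (Complex (a + L / 2) (L / 2)) - P (Complex (a + L) (L / 2))"
    using hor[of "a + L / 2" "a + L" "L / 2"] L unfolding V_def e(2,4,5)[symmetric] by simp
  moreover have "W m k = P (Complex a (L / 2)) - P (Complex a L)"
    using ver[of a] L unfolding W_def e(2)[symmetric] a_def[symmetric] L_def[symmetric] by simp
  moreover have "W m (k + 1) = P (Complex (a + L) (L / 2)) - P (Complex (a + L) L)"
    using ver[of "a + L"] L unfolding W_def e(1,2)[symmetric] L_def[symmetric] by simp
  ultimately show ?thesis by simp
qed

lemma log_deriv_bound:
  assumes "0 < Im z" "g z \<noteq> 0"
  shows "Im z * norm (deriv g z / g z) \<le> d * Q z / (2 * norm (g z))"
  using norm_deriv_le[OF assms(1)] assms by (simp add: norm_divide field_simps)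

lemma deriv_continuous: "continuous_on {z. 0 < Im z} (deriv g)"
  using holomorphic_deriv[OF holo open_halfspace_Im_gt[of 0]] by (rule holomorphic_on_imp_continuous_on)

text \<open>The density is u - y u_y with |y u_y| <= d Q / (2 |g|), so pointwise bounds integrate
  over an edge of length \<open>1 / 2 ^ m\<close>.\<close>

lemma V_bounds:
  assumes nz: "\<And>x. of_int k / 2 ^ m \<le> x \<Longrightarrow> x \<le> of_int (k + 1) / 2 ^ m \<Longrightarrow> g (Complex x (1 / 2 ^ m)) \<noteq> 0"
  shows "(\<And>x. of_int k / 2 ^ m \<le> x \<Longrightarrow> x \<le> of_int (k + 1) / 2 ^ m \<Longrightarrow>
       - ln (norm (g (Complex x (1 / 2 ^ m)))) + d * Q (Complex x (1 / 2 ^ m)) / (2 * norm (g (Complex x (1 / 2 ^ m)))) \<le> M)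
     \<Longrightarrow> V m k \<le> M / 2 ^ m" (is "(\<And>x. _ \<Longrightarrow> _ \<Longrightarrow> ?u x \<le> M) \<Longrightarrow> _")
    and "(\<And>x. of_int k / 2 ^ m \<le> x \<Longrightarrow> x \<le> of_int (k + 1) / 2 ^ m \<Longrightarrow>
       M \<le> - ln (norm (g (Complex x (1 / 2 ^ m)))) - d * Q (Complex x (1 / 2 ^ m)) / (2 * norm (g (Complex x (1 / 2 ^ m)))))
     \<Longrightarrow> M / 2 ^ m \<le> V m k" (is "(\<And>x. _ \<Longrightarrow> _ \<Longrightarrow> M \<le> ?l x) \<Longrightarrow> _")
proof -
  define y where "y = 1 / (2::real) ^ m"
  define a b where "a = of_int k / (2::real) ^ m" and "b = of_int (k + 1) / (2::real) ^ m"
  define f where "f x = - ln (norm (g (Complex x y))) - y * Im (deriv g (Complex x y) / g (Complex x y))" for x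
  have y: "0 < y" by (simp add: y_def)
  have ab: "a \<le> b" "b - a = y" by (simp_all add: a_def b_def y_def divide_right_mono add_divide_distrib)
  have c: "continuous_on {a..b} (\<lambda>x. Complex x y)"
    by (intro continuous_intros)
  have cg: "continuous_on {a..b} (\<lambda>x. g (Complex x y))"
    by (rule continuous_on_compose2[OF holomorphic_on_imp_continuous_on[OF holo] c]) (use y in auto)
  have cd: "continuous_on {a..b} (\<lambda>x. deriv g (Complex x y))"
    by (rule continuous_on_compose2[OF deriv_continuous c]) (use y in auto)
  have nz': "g (Complex x y) \<noteq> 0" if "x \<in> {a..b}" for x using nz[of x] that by (simp add: a_def b_def y_def)
  have "continuous_on {a..b} f" unfolding f_def
    by (intro continuous_intros cg cd) (use nz' in auto)
  then have int: "(f has_integral V m k) {a..b}"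
    unfolding V_def f_def a_def b_def y_def by (intro integrable_integral integrable_continuous_interval)
  have *: "\<bar>y * Im (deriv g (Complex x y) / g (Complex x y))\<bar> \<le> d * Q (Complex x y) / (2 * norm (g (Complex x y)))"
    if "x \<in> {a..b}" for x
  proof -
    have "\<bar>y * Im (deriv g (Complex x y) / g (Complex x y))\<bar> \<le> y * norm (deriv g (Complex x y) / g (Complex x y))"
      unfolding abs_mult using y abs_Im_le_cmod by (auto intro!: mult_mono)
    then show ?thesis using log_deriv_bound[of "Complex x y"] nz'[OF that] y by simp
  qed
  have const: "((\<lambda>x. M) has_integral M / 2 ^ m) {a..b}"
    using has_integral_const_real[of M a b] ab by (simp add: y_def)
  show "V m k \<le> M / 2 ^ m" if u: "\<And>x. of_int k / 2 ^ m \<le> x \<Longrightarrow> x \<le> of_int (k + 1) / 2 ^ m \<Longrightarrow> ?u x \<le> M"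
  proof (rule has_integral_le[OF int const])
    fix x assume x: "x \<in> {a..b}"
    then have "?u x \<le> M" using u[of x] by (simp add: a_def b_def)
    then show "f x \<le> M" using *[OF x] unfolding f_def y_def[symmetric] by linarith
  qed
  show "M / 2 ^ m \<le> V m k" if u: "\<And>x. of_int k / 2 ^ m \<le> x \<Longrightarrow> x \<le> of_int (k + 1) / 2 ^ m \<Longrightarrow> M \<le> ?l x"
  proof (rule has_integral_le[OF const int])
    fix x assume x: "x \<in> {a..b}"
    then have "M \<le> ?l x" using u[of x] by (simp add: a_def b_def)
    then show "M \<le> f x" using *[OF x] unfolding f_def y_def[symmetric] by linarith
  qed
qed

text \<open>The density is at most d Q / (2 \<gamma>). Down the wall Q at most doubles, and the wall
  has length \<open>1 / 2 ^ Suc m\<close>; these two factors cancel.\<close>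

lemma W_bound_aux:
  assumes "\<And>y. 1 / 2 ^ Suc m \<le> y \<Longrightarrow> y \<le> 1 / 2 ^ m \<Longrightarrow> \<gamma> \<le> norm (g (Complex (of_int k / 2 ^ m) y))"
  shows "\<bar>W m k\<bar> \<le> d / (2 * \<gamma>) * Q (dpt (m, k)) / 2 ^ m"
proof -
  define L where "L = 1 / (2::real) ^ m"
  define x where "x = of_int k / (2::real) ^ m"
  have L: "0 < L" "1 / 2 ^ Suc m = L / 2" by (simp_all add: L_def)
  have dp: "dpt (m, k) = Complex x L" by (simp add: dpt_def x_def L_def dlen_def)
  have g\<gamma>: "\<gamma> \<le> norm (g (Complex x y))" if "y \<in> {L / 2..L}" for y
    using assms[of y] that by (simp add: x_def L_def)
  define f where "f y = - (y * Re (deriv g (Complex x y) / g (Complex x y)))" for y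
  have c: "continuous_on {L / 2..L} (\<lambda>y. Complex x y)"
    by (intro continuous_intros)
  have cg: "continuous_on {L / 2..L} (\<lambda>y. g (Complex x y))"
    by (rule continuous_on_compose2[OF holomorphic_on_imp_continuous_on[OF holo] c]) (use L(1) in auto)
  have cd: "continuous_on {L / 2..L} (\<lambda>y. deriv g (Complex x y))"
    by (rule continuous_on_compose2[OF deriv_continuous c]) (use L(1) in auto)
  have "norm (integral {L / 2..L} f) \<le> d / \<gamma> * Q (dpt (m, k)) * (L - L / 2)"
  proof (rule integral_bound)
    show "continuous_on {L / 2..L} f" unfolding f_def
      by (intro continuous_intros cg cd) (use g\<gamma> \<gamma> in force)
    fix y assume y: "y \<in> {L / 2..L}"
    have ypos: "0 < y" using y L(1) by auto
    have nz: "g (Complex x y) \<noteq> 0" using g\<gamma>[OF y] \<gamma> by auto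
    have "norm (f y) \<le> y * norm (deriv g (Complex x y) / g (Complex x y))"
      unfolding f_def real_norm_def abs_minus_cancel abs_mult
      using ypos abs_Re_le_cmod by (auto intro!: mult_mono)
    also have "\<dots> \<le> d * Q (Complex x y) / (2 * norm (g (Complex x y)))"
      using log_deriv_bound[of "Complex x y"] nz ypos by simp
    also have "\<dots> \<le> d * Q (Complex x y) / (2 * \<gamma>)"
      using g\<gamma>[OF y] \<gamma> d Q_pos[of "Complex x y"] ypos nz by (intro divide_left_mono) auto
    also have "\<dots> \<le> d * (2 * Q (dpt (m, k))) / (2 * \<gamma>)"
    proof (intro divide_right_mono mult_left_mono)
      have "(L / y) powr d \<le> (L / y) powr 1" using y L(1) ypos d by (intro powr_mono) (auto simp: field_simps)
      also have "\<dots> \<le> 2" using y L(1) ypos by (auto simp: field_simps)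
      finally have "(L / y) powr d * Q (dpt (m, k)) \<le> 2 * Q (dpt (m, k))"
        using Q_pos[of "dpt (m, k)"] by (intro mult_right_mono) auto
      then show "Q (Complex x y) \<le> 2 * Q (dpt (m, k))"
        using Q_vertical(1)[of y L x] y ypos by (simp add: dp)
    qed (use d \<gamma> in auto)
    finally show "norm (f y) \<le> d / \<gamma> * Q (dpt (m, k))" by simp
  qed (use L(1) in auto)
  then show ?thesis unfolding W_def f_def L(2) x_def L_def[symmetric]
    by (simp add: L_def)
qed

lemma W_bounds:
  assumes "\<not> stop (m, k)"
  shows "\<bar>W m k\<bar> \<le> d / (2 * \<gamma>) * Q (dpt (m, k)) / 2 ^ m"
    and "\<bar>W m (k + 1)\<bar> \<le> d / (2 * \<gamma>) * Q (dpt (m, k + 1)) / 2 ^ m"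
proof -
  have *: "\<gamma> \<le> norm (g (Complex x y))" if "\<bar>x - of_int k / 2 ^ m\<bar> \<le> 1 / 2 ^ m"
    "1 / 2 ^ Suc m \<le> y" "y \<le> 1 / 2 ^ m" for x y
    using nonstop_box[of "(m, k)" "Complex x y"] assms that by (auto simp: stop_def dlen_def)
  show "\<bar>W m k\<bar> \<le> d / (2 * \<gamma>) * Q (dpt (m, k)) / 2 ^ m"
    by (rule W_bound_aux, rule *) auto
  show "\<bar>W m (k + 1)\<bar> \<le> d / (2 * \<gamma>) * Q (dpt (m, k + 1)) / 2 ^ m"
    by (rule W_bound_aux, rule *) (auto simp: add_divide_distrib)
qed

section \<open>Cancellation of wall fluxes between adjacent trees\<close>

text \<open>The recursions below descend at most \<open>n\<close> generations from \<open>(m, k)\<close> and halt at stopped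
  intervals. \<open>left_flux\<close> and \<open>right_flux\<close> are the fluxes through the outer walls of the sawtooth region
  above the resulting leaves, \<open>left_chg\<close> and \<open>right_chg\<close> the charges of its outermost leaves: a wall
  between two adjacent leaves is charged to the longer one.\<close>

primrec left_flux :: "nat \<Rightarrow> nat \<Rightarrow> int \<Rightarrow> real" where
  "left_flux 0 m k = 0"
| "left_flux (Suc n) m k = (if stop (m, k) then 0 else W m k + left_flux n (Suc m) (2 * k))"

primrec right_flux :: "nat \<Rightarrow> nat \<Rightarrow> int \<Rightarrow> real" where
  "right_flux 0 m k = 0"
| "right_flux (Suc n) m k = (if stop (m, k) then 0 else W m (k + 1) + right_flux n (Suc m) (2 * k + 1))"

text \<open>G Q |J| bounds a whole column of walls. The factor 3 comes from
  \<open>Q_adjacent\<close>: the column at the right end of J is measured at the corner of its right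
  neighbour.\<close>

definition chg :: "nat \<Rightarrow> int \<Rightarrow> real" where
  "chg m k = 3 * G * Q (dpt (m, k)) / 2 ^ m"

primrec left_chg :: "nat \<Rightarrow> nat \<Rightarrow> int \<Rightarrow> real" where
  "left_chg 0 m k = chg m k"
| "left_chg (Suc n) m k = (if stop (m, k) then chg m k else left_chg n (Suc m) (2 * k))"

primrec right_chg :: "nat \<Rightarrow> nat \<Rightarrow> int \<Rightarrow> real" where
  "right_chg 0 m k = chg m k"
| "right_chg (Suc n) m k = (if stop (m, k) then chg m k else right_chg n (Suc m) (2 * k + 1))"

text \<open>Twice the charge, because a leaf may have to pay for a column on either side.\<close>

primrec leafsum :: "nat \<Rightarrow> nat \<Rightarrow> int \<Rightarrow> real" where
  "leafsum 0 m k = V m k + 2 * chg m k"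
| "leafsum (Suc n) m k = (if stop (m, k) then V m k + 2 * chg m k
     else leafsum n (Suc m) (2 * k) + leafsum n (Suc m) (2 * k + 1))"

lemma chg_nonneg: "0 \<le> chg m k"
  using G Q_pos[of "dpt (m, k)"] by (simp add: chg_def)

lemma left_chg_nonneg: "0 \<le> left_chg n m k" and right_chg_nonneg: "0 \<le> right_chg n m k"
  by (induction n arbitrary: m k) (auto simp: chg_nonneg)

lemma Q_child: "Q (dpt (Suc m, 2 * k)) \<le> 2 powr d * Q (dpt (m, k))"
  using Q_vertical(1)[of "1 / 2 ^ Suc m" "1 / 2 ^ m" "of_int k / 2 ^ m"]
  by (simp add: dpt_def dlen_def field_simps)

lemma spine_step:
  assumes "\<bar>w\<bar> \<le> d / (2 * \<gamma>) * q / 2 ^ m" "\<bar>r\<bar> \<le> G * q' / 2 ^ Suc m" "q' \<le> 2 powr d * q" "0 < q"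
  shows "\<bar>w + r\<bar> \<le> G * q / 2 ^ m"
proof -
  have "\<bar>r\<bar> \<le> G * (2 powr d * q) / 2 ^ Suc m"
    by (rule order_trans[OF assms(2)]) (use assms(3) G in \<open>intro divide_right_mono mult_left_mono; simp\<close>)
  then have "\<bar>w + r\<bar> \<le> d / (2 * \<gamma>) * q / 2 ^ m + G * (2 powr d * q) / 2 ^ Suc m"
    using assms(1) by linarith
  also have "\<dots> = (d / (2 * \<gamma>) + G * (2 powr d / 2)) * q / 2 ^ m"
    by (simp add: algebra_simps add_divide_distrib)
  also have "\<dots> \<le> G * q / 2 ^ m"
    using G(2) assms(4) by (intro divide_right_mono mult_right_mono) auto
  finally show ?thesis .
qed

text \<open>The left walls all stand over the same point, so their sizes form a geometric series
  summed by G. On the right spine, treated next, the common point is the left end of the neighbour,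
  since 2 k + 1 + 1 = 2 (k + 1).\<close>

lemma left_flux_bound: "\<bar>left_flux n m k\<bar> \<le> G * Q (dpt (m, k)) / 2 ^ m"
proof (induction n arbitrary: m k)
  case 0
  then show ?case using G Q_pos[of "dpt (m, k)"] by simp
next
  case (Suc n)
  show ?case
  proof (cases "stop (m, k)")
    case True
    then show ?thesis using G Q_pos[of "dpt (m, k)"] by simp
  next
    case False
    then show ?thesis
      using spine_step[OF W_bounds(1)[OF False] Suc.IH Q_child] Q_pos[of "dpt (m, k)"] by simp
  qed
qed

lemma right_flux_bound: "\<bar>right_flux n m k\<bar> \<le> G * Q (dpt (m, k + 1)) / 2 ^ m"
proof (induction n arbitrary: m k)
  case 0
  then show ?case using G Q_pos[of "dpt (m, k + 1)"] by simp
next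
  case (Suc n)
  show ?case
  proof (cases "stop (m, k)")
    case True
    then show ?thesis using G Q_pos[of "dpt (m, k + 1)"] by simp
  next
    case False
    have "2 * k + 1 + 1 = 2 * (k + 1)" by simp
    then have "\<bar>right_flux n (Suc m) (2 * k + 1)\<bar> \<le> G * Q (dpt (Suc m, 2 * (k + 1))) / 2 ^ Suc m"
      using Suc.IH[of "Suc m" "2 * k + 1"] by metis
    then show ?thesis
      using spine_step[OF W_bounds(2)[OF False] _ Q_child] Q_pos[of "dpt (m, k + 1)"] False by simp
  qed
qed

lemma Q_adjacent: "Q (dpt (m, k + 1)) \<le> 3 * Q (dpt (m, k))"
  using Q_horizontal[of "1 / 2 ^ m" "of_int (k + 1) / 2 ^ m" "of_int k / 2 ^ m"]
  by (simp add: dpt_def dlen_def diff_divide_distrib[symmetric])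

text \<open>While both trees continue, they share the wall and its two fluxes cancel. At the first
  generation where one halts, only the column inside the other tree is left, which is bounded by Q
  at the common point and charged to the halted leaf.\<close>

lemma wall_bound: "\<bar>right_flux n m k - left_flux n m (k + 1)\<bar> \<le> right_chg n m k + left_chg n m (k + 1)"
proof (induction n arbitrary: m k)
  case 0
  then show ?case by (simp add: chg_nonneg)
next
  case (Suc n)
  have "G * Q (dpt (m, k + 1)) / 2 ^ m \<le> G * (3 * Q (dpt (m, k))) / 2 ^ m"
    using Q_adjacent G by (intro divide_right_mono mult_left_mono) auto
  then have c1: "G * Q (dpt (m, k + 1)) / 2 ^ m \<le> chg m k" by (simp only: chg_def mult_ac)
  have c2: "G * Q (dpt (m, k + 1)) / 2 ^ m \<le> chg m (k + 1)"
    unfolding chg_def using G Q_pos[of "dpt (m, k + 1)"] by (intro divide_right_mono) auto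
  have eq: "2 * (k + 1) = 2 * k + 1 + 1" by simp
  consider "stop (m, k)" | "\<not> stop (m, k)" "stop (m, k + 1)" | "\<not> stop (m, k)" "\<not> stop (m, k + 1)" by auto
  then show ?case
  proof cases
    case 1
    have "\<bar>right_flux (Suc n) m k - left_flux (Suc n) m (k + 1)\<bar> \<le> chg m k"
      using left_flux_bound[of "Suc n" m "k + 1"] c1 1 by simp
    then show ?thesis using 1 left_chg_nonneg[of "Suc n" m "k + 1"] by simp
  next
    case 2
    have "\<bar>right_flux (Suc n) m k - left_flux (Suc n) m (k + 1)\<bar> \<le> chg m (k + 1)"
      using right_flux_bound[of "Suc n" m "k"] c2 2 by simp
    then show ?thesis using 2 right_chg_nonneg[of "Suc n" m k] by simp
  next
    case 3
    then show ?thesis using Suc.IH[of "Suc m" "2 * k + 1"] unfolding eq[symmetric] by simp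
  qed
qed

text \<open>The charges of the two outermost leaves are subtracted because they are not spent yet;
  \<open>wall_bound\<close> consumes them when two trees are joined.\<close>

lemma tree_estimate: "V m k \<le> leafsum n m k + right_flux n m k - left_flux n m k - right_chg n m k - left_chg n m k"
proof (induction n arbitrary: m k)
  case 0
  then show ?case by simp
next
  case (Suc n)
  show ?case
  proof (cases "stop (m, k)")
    case True
    then show ?thesis by simp
  next
    case False
    then show ?thesis
      using box_identity[OF False] Suc.IH[of "Suc m" "2 * k"] Suc.IH[of "Suc m" "2 * k + 1"]
        wall_bound[of n "Suc m" "2 * k"] by (simp add: abs_le_iff)
  qed
qed

text \<open>Joining adjacent trees spends the charges at the inner walls, so however many roots
  there are, only the two outer columns remain.\<close>

lemma forest_estimate_aux:
  "(\<Sum>j<Suc N. V m (k + int j)) \<le> (\<Sum>j<Suc N. leafsum n m (k + int j)) +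
     right_flux n m (k + int N) - left_flux n m k - right_chg n m (k + int N) - left_chg n m k"
proof (induction N)
  case 0
  then show ?case using tree_estimate[of m k n] by simp
next
  case (Suc N)
  have "\<bar>right_flux n m (k + int N) - left_flux n m (k + int (Suc N))\<bar> \<le> right_chg n m (k + int N) + left_chg n m (k + int (Suc N))"
    using wall_bound[of n m "k + int N"] by (simp add: add_ac)
  then show ?case using Suc tree_estimate[of m "k + int (Suc N)" n]
    unfolding sum.lessThan_Suc[of _ "Suc N"] by (simp add: abs_le_iff)
qed

lemma forest_estimate:
  "(\<Sum>j<Suc N. V m (k + int j)) \<le> (\<Sum>j<Suc N. leafsum n m (k + int j)) +
     G * (3 * Q (dpt (m, k + int N)) + Q (dpt (m, k))) / 2 ^ m"
proof -
  have "right_flux n m (k + int N) \<le> G * (3 * Q (dpt (m, k + int N))) / 2 ^ m"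
    using right_flux_bound[of n m "k + int N"] Q_adjacent[of m "k + int N"] G
    by (intro order_trans[OF abs_le_D1[OF right_flux_bound[of n m "k + int N"]]] divide_right_mono mult_left_mono) auto
  moreover have "- left_flux n m k \<le> G * Q (dpt (m, k)) / 2 ^ m" using left_flux_bound[of n m k] by linarith
  ultimately show ?thesis
    using forest_estimate_aux[where n = n and m = m and k = k and N = N] left_chg_nonneg[of n m k] right_chg_nonneg[of n m "k + int N"]
    by (simp add: distrib_left add_divide_distrib del: sum.lessThan_Suc)
qed

section \<open>Lengths of returned and of unstopped leaves\<close>

primrec ret_mass :: "nat \<Rightarrow> nat \<Rightarrow> int \<Rightarrow> real" where
  "ret_mass 0 m k = (if norm (g (dpt (m, k))) \<le> \<delta> then 1 / 2 ^ m else 0)"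
| "ret_mass (Suc n) m k = (if norm (g (dpt (m, k))) \<le> \<delta> then 1 / 2 ^ m else if t \<le> norm (g (dpt (m, k))) then 0
     else ret_mass n (Suc m) (2 * k) + ret_mass n (Suc m) (2 * k + 1))"

primrec out_mass :: "nat \<Rightarrow> nat \<Rightarrow> int \<Rightarrow> real" where
  "out_mass 0 m k = (if stop (m, k) then 0 else 1 / 2 ^ m)"
| "out_mass (Suc n) m k = (if stop (m, k) then 0 else out_mass n (Suc m) (2 * k) + out_mass n (Suc m) (2 * k + 1))"

text \<open>At a stopped leaf \<open>nonstop_box\<close> says nothing; its top edge is safe because
  it lies in the box of the unstopped parent. For the roots it has to be checked separately.\<close>

definition edge_ok :: "nat \<Rightarrow> int \<Rightarrow> bool" where
  "edge_ok m k \<longleftrightarrow> (\<forall>x. of_int k / 2 ^ m \<le> x \<longrightarrow> x \<le> of_int (k + 1) / 2 ^ m \<longrightarrow> \<gamma> \<le> norm (g (Complex x (1 / 2 ^ m))))"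

lemma edge_ok_children:
  assumes "\<not> stop (m, k)" shows "edge_ok (Suc m) (2 * k)" "edge_ok (Suc m) (2 * k + 1)"
  using nonstop_box[of "(m, k)"] assms
  by (auto simp: edge_ok_def stop_def dlen_def field_simps abs_le_iff)

text \<open>Every leaf pays A per unit of length, which adds up to the length of the root; only the
  leaves that are returned or unstopped pay the extra B.\<close>

lemma leafsum_le:
  assumes AB: "\<And>m k. edge_ok m k \<Longrightarrow> V m k + 2 * chg m k \<le> (A + B) / 2 ^ m"
    and A: "\<And>m k. edge_ok m k \<Longrightarrow> t \<le> norm (g (dpt (m, k))) \<Longrightarrow> V m k + 2 * chg m k \<le> A / 2 ^ m"
    and ok: "edge_ok m k"
  shows "leafsum n m k \<le> A / 2 ^ m + B * (ret_mass n m k + out_mass n m k)"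
  using ok
proof (induction n arbitrary: m k)
  case 0
  then show ?case using AB[OF 0] A[OF 0] by (auto simp: stop_def add_divide_distrib)
next
  case (Suc n)
  show ?case
  proof (cases "stop (m, k)")
    case True
    then show ?thesis using AB[OF Suc.prems] A[OF Suc.prems] by (auto simp: stop_def add_divide_distrib)
  next
    case False
    have "A / 2 ^ m = A / 2 ^ Suc m + A / 2 ^ Suc m" by simp
    then show ?thesis
      using Suc.IH[OF edge_ok_children(1)[OF False]] Suc.IH[OF edge_ok_children(2)[OF False]] False
      by (auto simp: stop_def distrib_left)
  qed
qed

end

section \<open>Mass of the stopped intervals\<close>

definition unimodular_boundary :: "(complex \<Rightarrow> complex) \<Rightarrow> real set \<Rightarrow> bool" where
  "unimodular_boundary g S \<longleftrightarrow>
     (AE x in lebesgue. x \<in> S \<longrightarrow> ((\<lambda>y. norm (g (Complex x y))) \<longlongrightarrow> 1) (at_right 0))"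

lemma unimodular_boundary_subset:
  "unimodular_boundary g S \<Longrightarrow> R \<subseteq> S \<Longrightarrow> unimodular_boundary g R"
  unfolding unimodular_boundary_def by (rule eventually_mono, assumption) auto

lemma dint_split: "dint (m, k) = dint (Suc m, 2 * k) \<union> dint (Suc m, 2 * k + 1)"
  "dint (Suc m, 2 * k) \<inter> dint (Suc m, 2 * k + 1) = {}"
  by (auto simp: dint_def field_simps)

context sawtooth
begin

primrec unstopped :: "nat \<Rightarrow> nat \<Rightarrow> int \<Rightarrow> real set" where
  "unstopped 0 m k = (if stop (m, k) then {} else dint (m, k))"
| "unstopped (Suc n) m k = (if stop (m, k) then {} else unstopped n (Suc m) (2 * k) \<union> unstopped n (Suc m) (2 * k + 1))"

lemma unstopped_subset: "unstopped n m k \<subseteq> dint (m, k)"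
proof (induction n arbitrary: m k)
  case (Suc n)
  show ?case using Suc[of "Suc m" "2 * k"] Suc[of "Suc m" "2 * k + 1"] dint_split(1)[of m k] by auto
qed simp

lemma unstopped_lmeasurable: "unstopped n m k \<in> lmeasurable"
  by (induction n arbitrary: m k) (auto intro: fmeasurable.Un)

lemma measure_unstopped: "measure lebesgue (unstopped n m k) = out_mass n m k"
proof (induction n arbitrary: m k)
  case 0
  then show ?case by (simp add: measure_dint dlen_def)
next
  case (Suc n)
  have "unstopped n (Suc m) (2 * k) \<inter> unstopped n (Suc m) (2 * k + 1) = {}"
    using unstopped_subset[of n "Suc m" "2 * k"] unstopped_subset[of n "Suc m" "2 * k + 1"] dint_split(2)[of m k]
    by blast
  then show ?case by (simp add: measure_Un3 unstopped_lmeasurable Suc)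
qed

lemma unstopped_nonstop:
  "x \<in> unstopped n m k \<Longrightarrow> i \<le> n \<Longrightarrow> \<not> stop (m + i, \<lfloor>x * 2 ^ (m + i)\<rfloor>)"
proof (induction n arbitrary: m k i)
  case 0
  then show ?case by (auto simp: mem_dint_iff split: if_splits)
next
  case (Suc n)
  show ?case
  proof (cases i)
    case 0
    have "x \<in> dint (m, k)" using Suc.prems unstopped_subset by blast
    then show ?thesis using Suc.prems 0 by (auto simp: mem_dint_iff split: if_splits)
  next
    case (Suc i')
    then show ?thesis using Suc.IH[of "Suc m" _ i'] Suc.prems by (auto split: if_splits)
  qed
qed

lemma unstopped_decseq: "unstopped (Suc n) m k \<subseteq> unstopped n m k"
proof (induction n arbitrary: m k)
  case 0
  show ?case using dint_split(1)[of m k] by auto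
next
  case (Suc n)
  show ?case using Suc[of "Suc m" "2 * k"] Suc[of "Suc m" "2 * k + 1"] by auto
qed

lemma out_mass_tendsto_0:
  assumes bd: "unimodular_boundary g (dcl (m, k))" and t: "0 < t" "t < 1"
  shows "(\<lambda>n. out_mass n m k) \<longlonglongrightarrow> 0"
proof -
  have "AE x in lebesgue. x \<notin> (\<Inter>n. unstopped n m k)"
    using bd unfolding unimodular_boundary_def
  proof (rule eventually_mono, intro notI)
    fix x assume *: "x \<in> dcl (m, k) \<longrightarrow> ((\<lambda>y. norm (g (Complex x y))) \<longlongrightarrow> 1) (at_right 0)"
      and x: "x \<in> (\<Inter>n. unstopped n m k)"
    have "x \<in> dint (m, k)" using subsetD[OF unstopped_subset[of 0 m k]] x by blast
    then have "x \<in> dcl (m, k)" by (simp add: dint_def dcl_def)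
    then have lim: "((\<lambda>y. norm (g (Complex x y))) \<longlongrightarrow> 1) (at_right 0)" using * by simp
    have "((\<lambda>y. Q (Complex x y)) \<longlongrightarrow> 1 - 1\<^sup>2) (at_right 0)"
      unfolding Q_def by (intro tendsto_intros lim)
    then have "((\<lambda>y. Q (Complex x y)) \<longlongrightarrow> 0) (at_right 0)" by simp
    \<comment> \<open>The limit is along the vertical over x, while the stopping rule looks at the
      corner of the interval containing x; \<open>near\<close> compares them at the cost of the
      factor 36.\<close>
    moreover have "0 < (1 - t\<^sup>2) / 36" using t by (simp add: power_less_one_iff abs_square_less_1)
    ultimately have "\<forall>\<^sub>F y in at_right 0. Q (Complex x y) < (1 - t\<^sup>2) / 36"
      by (rule order_tendstoD(2))
    moreover have "filterlim (\<lambda>i. 1 / 2 ^ (m + i) :: real) (at_right 0) sequentially"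
      by real_asymp
    ultimately have "\<forall>\<^sub>F i in sequentially. Q (Complex x (1 / 2 ^ (m + i))) < (1 - t\<^sup>2) / 36"
      unfolding filterlim_iff by blast
    then obtain i where i: "Q (Complex x (1 / 2 ^ (m + i))) < (1 - t\<^sup>2) / 36"
      using eventually_happens'[OF sequentially_bot] by blast
    define J where "J = (m + i, \<lfloor>x * 2 ^ (m + i)\<rfloor>)"
    have "x \<in> dint J" by (simp add: mem_dint_iff J_def)
    then have "\<bar>x - Re (dpt J)\<bar> \<le> dlen J" by (simp add: dint_def dlen_def add_divide_distrib)
    moreover have "dlen J = 1 / 2 ^ (m + i)" by (simp add: J_def dlen_def)
    ultimately have "Q (dpt J) \<le> 36 * Q (Complex x (1 / 2 ^ (m + i)))"
      using near(2)[of "dpt J" "Complex x (1 / 2 ^ (m + i))"] dlen_pos[of J] by simp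
    then have "t\<^sup>2 \<le> (norm (g (dpt J)))\<^sup>2" using i by (simp add: Q_def)
    then have "t \<le> norm (g (dpt J))" using t by (simp add: power2_le_iff_abs_le)
    then have "stop J" by (simp add: stop_def)
    then show False using unstopped_nonstop[of x i m k i] x by (auto simp: J_def)
  qed
  moreover have "(\<Inter>n. unstopped n m k) \<in> sets lebesgue"
    using unstopped_lmeasurable by (intro sets.countable_INT) auto
  ultimately have e0: "emeasure lebesgue (\<Inter>n. unstopped n m k) = 0"
    using AE_iff_measurable[of "\<Inter>n. unstopped n m k" lebesgue "\<lambda>x. x \<notin> (\<Inter>n. unstopped n m k)"] by auto
  have 0: "measure lebesgue (\<Inter>n. unstopped n m k) = 0"
    unfolding measure_def e0 by simp
  have "(\<lambda>n. measure lebesgue (unstopped n m k)) \<longlonglongrightarrow> measure lebesgue (\<Inter>n. unstopped n m k)"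
  proof (rule Lim_measure_decseq)
    show "decseq (\<lambda>n. unstopped n m k)" using unstopped_decseq by (simp add: decseq_Suc_iff)
    show "emeasure lebesgue (unstopped i m k) \<noteq> \<infinity>" for i
      using fmeasurableD2[OF unstopped_lmeasurable[of i m k]] by simp
  qed (use unstopped_lmeasurable in auto)
  then show ?thesis using 0 by (simp add: measure_unstopped)
qed

section \<open>The returned leaves as an antichain\<close>

primrec ret_set :: "nat \<Rightarrow> nat \<Rightarrow> int \<Rightarrow> (nat \<times> int) set" where
  "ret_set 0 m k = (if norm (g (dpt (m, k))) \<le> \<delta> then {(m, k)} else {})"
| "ret_set (Suc n) m k = (if norm (g (dpt (m, k))) \<le> \<delta> then {(m, k)} else if t \<le> norm (g (dpt (m, k))) then {}
     else (\<Union>K\<in>{(Suc m, 2 * k), (Suc m, 2 * k + 1)}. ret_set n (fst K) (snd K)))"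

lemma ret_set_finite: "finite (ret_set n m k)"
  by (induction n arbitrary: m k) auto

lemma ret_set_dsub: "J \<in> ret_set n m k \<Longrightarrow> J \<sqsubseteq> (m, k)"
proof (induction n arbitrary: m k)
  case (Suc n)
  then show ?case
    using dsub_trans[OF Suc.IH dsub_child[of 0 m k]] dsub_trans[OF Suc.IH dsub_child[of 1 m k]]
    by (auto split: if_splits)
qed (auto split: if_splits)

lemma ret_set_antichain: "dantichain (ret_set n m k)"
proof (induction n arbitrary: m k)
  case (Suc n)
  have "dantichain (\<Union>K\<in>{(Suc m, 2 * k), (Suc m, 2 * k + 1)}. ret_set n (fst K) (snd K))"
    by (rule dantichain_UN[of _ "Suc m"]) (use Suc.IH ret_set_dsub in auto)
  then show ?case by (auto simp: dantichain_def)
qed (simp add: dantichain_def)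

lemma ret_set_sum: "(\<Sum>J\<in>ret_set n m k. dlen J) = ret_mass n m k"
proof (induction n arbitrary: m k)
  case (Suc n)
  have "(\<Sum>J\<in>(\<Union>K\<in>{(Suc m, 2 * k), (Suc m, 2 * k + 1)}. ret_set n (fst K) (snd K)). dlen J) =
     (\<Sum>K\<in>{(Suc m, 2 * k), (Suc m, 2 * k + 1)}. \<Sum>J\<in>ret_set n (fst K) (snd K). dlen J)"
    by (rule sum_UN_families[of _ "Suc m"]) (use ret_set_dsub ret_set_finite in auto)
  then show ?case using Suc.IH by (simp add: dlen_def)
qed (simp add: dlen_def)

lemma ret_set_good: "J \<in> ret_set n m k \<Longrightarrow> norm (g (dpt J)) \<le> \<delta>"
  by (induction n arbitrary: m k) (auto split: if_splits)

lemma ret_set_path: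
  "J \<in> ret_set n m k \<Longrightarrow> \<delta> \<le> t \<Longrightarrow> J \<sqsubseteq> A \<Longrightarrow> A \<sqsubseteq> (m, k) \<Longrightarrow> norm (g (dpt A)) \<le> t"
proof (induction n arbitrary: m k)
  case 0
  then have "A = (m, k)" by (auto intro: dsub_antisym split: if_splits)
  then show ?case using 0 by (auto split: if_splits)
next
  case (Suc n)
  show ?case
  proof (cases "norm (g (dpt (m, k))) \<le> \<delta>")
    case True
    then have "A = (m, k)" using Suc.prems by (auto intro: dsub_antisym)
    then show ?thesis using True Suc.prems by simp
  next
    case False
    then have t: "norm (g (dpt (m, k))) < t" using Suc.prems by (auto split: if_splits)
    then obtain j where j: "J \<in> ret_set n (Suc m) j" using Suc.prems False by auto
    have "A = (m, k) \<or> A \<sqsubseteq> (Suc m, j)"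
      using dsub_between_child[OF ret_set_dsub[OF j] Suc.prems(3,4)] .
    then show ?thesis using t Suc.IH[OF j Suc.prems(2,3)] by auto
  qed
qed

end

section \<open>Choosing where the outer walls stand\<close>

text \<open>Otherwise the sums over symmetric ranges around \<open>c\<close> would grow geometrically. This provides a
  range of intervals whose two outer walls carry a negligible part of the flux.\<close>

lemma symmetric_range_selection:
  fixes q :: "int \<Rightarrow> real" and \<Lambda> lo hi :: real
  assumes \<Lambda>: "1 < \<Lambda>" and lo: "lo \<le> q c" and hi: "\<And>i. c - int N \<le> i \<Longrightarrow> i \<le> c + int N \<Longrightarrow> q i \<le> hi"
    and big: "(1 - 1 / \<Lambda>) ^ N * (2 * real N + 1) * hi < lo"
  shows "\<exists>j\<le>N. \<Lambda> * (q (c - int j) + q (c + int j)) \<le> (\<Sum>i<Suc (2 * j). q (c - int j + int i))"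
proof (rule ccontr)
  assume "\<not> ?thesis"
  then have neg: "(\<Sum>i<Suc (2 * j). q (c - int j + int i)) < \<Lambda> * (q (c - int j) + q (c + int j))" if "j \<le> N" for j
    using that by (meson not_le)
  define S where "S j = (\<Sum>i<Suc (2 * j). q (c - int j + int i))" for j
  have S_Suc: "S (Suc j) = S j + q (c - int (Suc j)) + q (c + int (Suc j))" for j
  proof -
    have "S (Suc j) = (\<Sum>i<Suc (Suc (2 * j)). q (c - int (Suc j) + int i)) + q (c + int (Suc j))"
      unfolding S_def by (simp add: algebra_simps)
    also have "(\<Sum>i<Suc (Suc (2 * j)). q (c - int (Suc j) + int i)) =
      q (c - int (Suc j)) + (\<Sum>i<Suc (2 * j). q (c - int (Suc j) + int (Suc i)))"
      by (subst sum.lessThan_Suc_shift) simp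
    also have "(\<Sum>i<Suc (2 * j). q (c - int (Suc j) + int (Suc i))) = S j"
      unfolding S_def by (simp add: algebra_simps)
    finally show ?thesis by simp
  qed
  define r where "r = 1 - 1 / \<Lambda>"
  have r: "0 < r" using \<Lambda> by (simp add: r_def)
  have "S 0 \<le> r ^ j * S j" if "j \<le> N" for j
    using that
  proof (induction j)
    case (Suc j)
    have "S (Suc j) < \<Lambda> * (S (Suc j) - S j)"
      using neg[of "Suc j"] Suc.prems S_Suc[of j] unfolding S_def[symmetric] by simp
    then have "S j \<le> r * S (Suc j)" using \<Lambda> by (simp add: r_def field_simps)
    then have "r ^ j * S j \<le> r ^ j * (r * S (Suc j))" using r by (intro mult_left_mono) auto
    then show ?case using Suc by (simp add: mult_ac)
  qed simp
  then have "lo \<le> r ^ N * S N" using lo by (force simp: S_def)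
  also have "S N \<le> (\<Sum>i<Suc (2 * N). hi)" unfolding S_def by (intro sum_mono hi) auto
  then have "r ^ N * S N \<le> r ^ N * ((2 * real N + 1) * hi)" using r by (intro mult_left_mono) (auto simp: add.commute)
  finally show False using big by (simp add: r_def mult_ac)
qed

text \<open>Used with C = 144: over the l + 2 generations inside K the values of Q vary by a factor
  of at most 9 p^2 with p = 4 * \<open>2 ^ l\<close>. This is polynomial in the number
  \<open>2 ^ l\<close> of steps, so the geometric decay wins.\<close>

lemma exists_power_small:
  fixes r C :: real assumes "0 < r" "r < 1"
  shows "\<exists>l. r ^ (2 ^ l) * (2 * real (2 ^ l) + 1) * (C * (2 ^ l)\<^sup>2) < 1"
proof -
  have "(\<lambda>n. r ^ n * (2 * real n + 1) * (C * (real n)\<^sup>2)) \<longlonglongrightarrow> 0"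
    using assms by real_asymp
  moreover have "filterlim (\<lambda>l. 2 ^ l :: nat) at_top sequentially"
    by (rule filterlim_subseq) (simp add: strict_mono_def)
  ultimately have "(\<lambda>l. r ^ (2 ^ l) * (2 * real (2 ^ l) + 1) * (C * (real (2 ^ l))\<^sup>2)) \<longlonglongrightarrow> 0"
    by (rule filterlim_compose)
  then have "\<forall>\<^sub>F l in sequentially. r ^ (2 ^ l) * (2 * real (2 ^ l) + 1) * (C * (real (2 ^ l))\<^sup>2) < 1"
    by (rule order_tendstoD) simp
  then obtain l where "r ^ (2 ^ l) * (2 * real (2 ^ l) + 1) * (C * (real (2 ^ l))\<^sup>2) < 1"
    using eventually_happens'[OF sequentially_bot] by blast
  then show ?thesis by (intro exI[of _ l]) simp
qed

section \<open>Returning from near the unit circle\<close>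

lemma le_sqrt_iff: "0 \<le> x \<Longrightarrow> x \<le> sqrt (1 - \<tau>) \<longleftrightarrow> \<tau> \<le> 1 - x\<^sup>2" for x \<tau> :: real
proof -
  assume x: "0 \<le> x"
  have "x \<le> sqrt (1 - \<tau>) \<longleftrightarrow> sqrt (x\<^sup>2) \<le> sqrt (1 - \<tau>)" using x by simp
  also have "\<dots> \<longleftrightarrow> x\<^sup>2 \<le> 1 - \<tau>" by (rule real_sqrt_le_iff)
  finally show ?thesis by linarith
qed

lemma neg_ln_bounds:
  fixes a :: real assumes "0 < a"
  shows "(1 - a\<^sup>2) / 2 \<le> - ln a" "- ln a \<le> (1 - a\<^sup>2) / (2 * a\<^sup>2)"
proof -
  have e: "ln (a\<^sup>2) = 2 * ln a" using assms by (simp add: ln_realpow)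
  show "(1 - a\<^sup>2) / 2 \<le> - ln a" using ln_le_minus_one[of "a\<^sup>2"] assms e by simp
  have "ln (1 / a\<^sup>2) \<le> 1 / a\<^sup>2 - 1" using assms by (intro ln_le_minus_one) simp
  moreover have "ln (1 / a\<^sup>2) = - (2 * ln a)" using assms e by (simp add: ln_div)
  moreover have "L \<le> b - 1 \<Longrightarrow> L = - (2 * x) \<Longrightarrow> - x \<le> (b - 1) / 2" for L b x :: real by simp
  ultimately have "- ln a \<le> (1 / a\<^sup>2 - 1) / 2" by blast
  also have "\<dots> = (1 - a\<^sup>2) / (2 * a\<^sup>2)" using assms by (simp add: field_simps)
  finally show "- ln a \<le> (1 - a\<^sup>2) / (2 * a\<^sup>2)" .
qed

context sawtooth
begin

lemma Q_edge:
  assumes "of_int k / 2 ^ m \<le> x" "x \<le> of_int (k + 1) / 2 ^ m"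
  shows "Q (Complex x (1 / 2 ^ m)) \<le> 3 * Q (dpt (m, k))" "Q (dpt (m, k)) \<le> 3 * Q (Complex x (1 / 2 ^ m))"
proof -
  have "\<bar>x - of_int k / 2 ^ m\<bar> \<le> 1 / 2 ^ m" using assms by (simp add: add_divide_distrib)
  then show "Q (Complex x (1 / 2 ^ m)) \<le> 3 * Q (dpt (m, k))" "Q (dpt (m, k)) \<le> 3 * Q (Complex x (1 / 2 ^ m))"
    using Q_horizontal[of "1 / 2 ^ m" x "of_int k / 2 ^ m"] Q_horizontal[of "1 / 2 ^ m" "of_int k / 2 ^ m" x]
    by (simp_all add: dpt_def dlen_def abs_minus_commute)
qed

text \<open>On the edge |g| >= 1 / 2 gives u <= 2 Q and y |u_y| <= Q; passing to the corner costs 3,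
  hence 9. The summand 6 G is the two charges.\<close>

lemma leaf_upper:
  assumes "\<gamma> = 1 / 2" "edge_ok m k"
  shows "V m k + 2 * chg m k \<le> (9 + 6 * G) * Q (dpt (m, k)) / 2 ^ m"
proof -
  have "V m k \<le> (9 * Q (dpt (m, k))) / 2 ^ m"
  proof (rule V_bounds(1))
    fix x :: real assume x: "of_int k / 2 ^ m \<le> x" "x \<le> of_int (k + 1) / 2 ^ m"
    define z where "z = Complex x (1 / 2 ^ m)"
    have half: "1 / 2 \<le> norm (g z)" using assms(2)[unfolded edge_ok_def, rule_format, OF x] unfolding z_def assms(1) .
    then show "g (Complex x (1 / 2 ^ m)) \<noteq> 0" by (auto simp: z_def)
    have Qz: "0 < Q z" by (rule Q_pos) (simp add: z_def)
    have "- ln (norm (g z)) \<le> Q z / (2 * (norm (g z))\<^sup>2)"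
      using neg_ln_bounds(2)[of "norm (g z)"] half unfolding Q_def by linarith
    also have "\<dots> \<le> Q z / (2 * (1 / 2)\<^sup>2)"
      using half Qz by (intro divide_left_mono mult_left_mono power_mono mult_pos_pos) auto
    finally have 1: "- ln (norm (g z)) \<le> 2 * Q z" by (simp add: power2_eq_square)
    have "d * Q z / (2 * norm (g z)) \<le> 1 * Q z / (2 * (1 / 2))"
      using half Qz d by (intro frac_le mult_right_mono) auto
    then have "- ln (norm (g z)) + d * Q z / (2 * norm (g z)) \<le> 3 * Q z" using 1 by simp
    also have "\<dots> \<le> 9 * Q (dpt (m, k))" using Q_edge(1)[OF x] by (simp add: z_def)
    finally show "- ln (norm (g (Complex x (1 / 2 ^ m)))) + d * Q (Complex x (1 / 2 ^ m)) /
      (2 * norm (g (Complex x (1 / 2 ^ m)))) \<le> 9 * Q (dpt (m, k))" by (simp add: z_def)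
  qed
  then show ?thesis by (simp add: chg_def algebra_simps add_divide_distrib)
qed

text \<open>Subtracting |y u_y| <= d Q / (2 |g|) from u >= Q / 2 leaves (1 - d / |g|) Q / 2, and |g|
  >= (1 + D) / 2 makes the bracket at least (1 - D) / 2 because 4 D <= (1 + D)^2. A factor 3 passes
  to the corner.\<close>

lemma V_lower:
  assumes D: "d \<le> D" "D < 1"
    and e: "\<And>x. of_int k / 2 ^ m \<le> x \<Longrightarrow> x \<le> of_int (k + 1) / 2 ^ m \<Longrightarrow> (1 + D) / 2 \<le> norm (g (Complex x (1 / 2 ^ m)))"
  shows "(1 - D) / 12 * Q (dpt (m, k)) / 2 ^ m \<le> V m k"
proof (rule V_bounds(2))
  fix x :: real assume x: "of_int k / 2 ^ m \<le> x" "x \<le> of_int (k + 1) / 2 ^ m"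
  define z where "z = Complex x (1 / 2 ^ m)"
  have n: "(1 + D) / 2 \<le> norm (g z)" using e[OF x] by (simp add: z_def)
  have "0 < (1 + D) / 2" using D d by simp
  then have pos: "0 < norm (g z)" using n by (rule less_le_trans)
  then show "g (Complex x (1 / 2 ^ m)) \<noteq> 0" by (auto simp: z_def)
  have Qz: "0 < Q z" by (rule Q_pos) (simp add: z_def)
  have "Q (dpt (m, k)) \<le> 3 * Q z" using Q_edge(2)[OF x] by (simp add: z_def)
  then have "(1 - D) / 12 * Q (dpt (m, k)) \<le> (1 - D) / 12 * (3 * Q z)" using D by (intro mult_left_mono) auto
  also have "\<dots> = (1 - D) / 2 * (Q z / 2)" by simp
  also have "\<dots> \<le> (1 - d / norm (g z)) * (Q z / 2)"
  proof (rule mult_right_mono)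
    have "d / norm (g z) \<le> D / ((1 + D) / 2)" using n D d by (intro frac_le) auto
    also have "\<dots> \<le> 1 - (1 - D) / 2"
    proof -
      have "D * (2 * 2) \<le> (1 + D) * (1 + D)" using zero_le_square[of "1 - D"] by (simp add: algebra_simps)
      then show ?thesis using D d by (simp add: field_simps)
    qed
    finally have "d / norm (g z) \<le> 1 - (1 - D) / 2" .
    moreover have "x \<le> 1 - a \<Longrightarrow> a \<le> 1 - x" for x a :: real by simp
    ultimately show "(1 - D) / 2 \<le> 1 - d / norm (g z)" by blast
  qed (use Qz in simp)
  also have "\<dots> = Q z / 2 - d * Q z / (2 * norm (g z))"
    by (simp add: left_diff_distrib)
  also have "\<dots> \<le> - ln (norm (g z)) - d * Q z / (2 * norm (g z))"
    using neg_ln_bounds(1)[OF pos] unfolding Q_def by linarith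
  finally show "(1 - D) / 12 * Q (dpt (m, k)) \<le> - ln (norm (g (Complex x (1 / 2 ^ m)))) -
     d * Q (Complex x (1 / 2 ^ m)) / (2 * norm (g (Complex x (1 / 2 ^ m))))"
    by (simp add: z_def)
qed

end

definition returns :: "(complex \<Rightarrow> complex) \<Rightarrow> real \<Rightarrow> real \<Rightarrow> nat \<times> int \<Rightarrow> real \<Rightarrow> (nat \<times> int) set \<Rightarrow> bool" where
  "returns g \<delta> t K c F \<longleftrightarrow> finite F \<and> dantichain F \<and>
     (\<forall>J\<in>F. J \<sqsubseteq> K \<and> norm (g (dpt J)) \<le> \<delta> \<and> (\<forall>A. J \<sqsubseteq> A \<and> A \<sqsubseteq> K \<longrightarrow> norm (g (dpt A)) \<le> t)) \<and>
     c * dlen K \<le> (\<Sum>J\<in>F. dlen J)"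

text \<open>\<open>\<kappa>\<close> and \<open>\<tau>\<close> are the values of Q at which |g| is
  \<delta> and t. The bound 1 / 48 gives Q <= 3 / 4, so |g| >= 1 / 2, near unstopped intervals; the
  other bound on \<open>\<kappa>\<close> gives |g| >= (1 + D) / 2 on the top edges used inside a K
  that is not good. The bounds on \<open>\<tau>\<close> keep the path from K to the roots below t
  and let the leaves at t cost at most half of the main term.\<close>

lemma return_large_core:
  fixes D G v0 p C2 c1 \<kappa> \<tau> q :: real and l :: nat
  assumes D: "0 < D" "D < 1"
    and G_def: "G = 1 / (1 - 2 powr D / 2)" and v0_def: "v0 = (1 - D) / 12"
    and p_def: "p = 2 ^ (l + 2)" and C2_def: "C2 = 9 + 6 * G" and c1_def: "c1 = v0 / (6 * p\<^sup>2)"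
    and sel: "(1 - 1 / (6 * G / v0)) ^ (2 ^ l) * (2 * real (2 ^ l) + 1) * (144 * (2 ^ l)\<^sup>2) < 1"
    and \<kappa>: "0 < \<kappa>" "\<kappa> \<le> 1 / 48" "\<kappa> \<le> (1 - ((1 + D) / 2)\<^sup>2) / (9 * p)"
    and \<tau>: "0 < \<tau>" "\<tau> < \<kappa>" "\<tau> \<le> q / (3 * p)" "\<tau> \<le> c1 * q / (2 * C2)"
    and hl: "hyp_lipschitz g d" and dD: "d \<le> D" and bd: "unimodular_boundary g (dcl K)"
    and qK: "q \<le> 1 - (norm (g (dpt K)))\<^sup>2"
  shows "\<exists>F. returns g (sqrt (1 - \<kappa>)) (sqrt (1 - \<tau>)) K (c1 / (4 * C2) * (1 - (norm (g (dpt K)))\<^sup>2)) F"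
proof -
  interpret hyp_lipschitz g d by (rule hl)
  define \<delta> t where "\<delta> = sqrt (1 - \<kappa>)" and "t = sqrt (1 - \<tau>)"
  have \<delta>t: "\<delta> < t" "0 < t" "t < 1" using \<kappa> \<tau> by (auto simp: \<delta>_def t_def)
  have good_iff: "norm (g z) \<le> \<delta> \<longleftrightarrow> \<kappa> \<le> Q z" for z unfolding \<delta>_def Q_def by (rule le_sqrt_iff) simp
  have t_iff: "norm (g z) \<le> t \<longleftrightarrow> \<tau> \<le> Q z" for z unfolding t_def Q_def by (rule le_sqrt_iff) simp
  have powD: "2 powr D < 2" using D powr_less_mono[of D 1 2] by simp
  have G1: "1 \<le> G" using powD by (simp add: G_def field_simps)
  have v0: "0 < v0" "v0 \<le> 1 / 12" using D by (auto simp: v0_def)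
  have p1: "1 \<le> p" unfolding p_def by (rule one_le_power) simp
  have C2: "15 \<le> C2" using G1 by (simp add: C2_def)
  have p2: "1 \<le> p\<^sup>2" using p1 by (simp add: one_le_power)
  have c1: "0 < c1" using v0 p1 by (simp add: c1_def)
  have "v0 \<le> 6 * p\<^sup>2" using v0 p2 by linarith
  then have c1': "c1 \<le> 1" using p1 by (simp add: c1_def)
  obtain m k where K: "K = (m, k)" by (cases K)
  have QK: "0 < Q (dpt K)" "Q (dpt K) \<le> 1" using Q_pos[of "dpt K"] Q_le_1 by auto
  have q: "q \<le> Q (dpt K)" using qK by (simp add: Q_def)
  show ?thesis
  proof (cases "norm (g (dpt K)) \<le> \<delta>")
    case True
    have "c1 / (4 * C2) * Q (dpt K) * dlen K \<le> 1 * 1 * dlen K"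
      using c1 c1' C2 QK by (intro mult_right_mono mult_mono) (auto simp: less_imp_le field_simps)
    then have "returns g \<delta> t K (c1 / (4 * C2) * Q (dpt K)) {K}"
      unfolding returns_def using True \<delta>t dsub_antisym by (fastforce simp: dantichain_def)
    then show ?thesis unfolding \<delta>_def t_def Q_def by blast
  next
    case False
    then have QK\<kappa>: "Q (dpt K) < \<kappa>" using good_iff by (meson not_le)
    interpret sawtooth g d \<delta> t "1 / 2" G
    proof
      show "0 < (1 / 2 :: real)" by simp
      show "0 \<le> G" using G1 by simp
      have "2 powr d \<le> 2 powr D" using dD by (intro powr_mono) auto
      then have "d + G * (2 powr d / 2) \<le> 1 + G * (2 powr D / 2)"
        using G1 d by (intro add_mono mult_left_mono) auto
      also have "\<dots> = G"
      proof -
        have "G * (1 - 2 powr D / 2) = 1" using powD by (simp add: G_def)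
        then show ?thesis by (simp add: algebra_simps)
      qed
      finally show "d / (2 * (1 / 2)) + G * (2 powr d / 2) \<le> G" by simp
      fix J z assume J: "\<delta> < norm (g (dpt J))" and z: "\<bar>Re z - Re (dpt J)\<bar> \<le> 2 * dlen J"
        "dlen J / 4 \<le> Im z" "Im z \<le> 2 * dlen J"
      have "Q z \<le> 36 * Q (dpt J)" using near(1)[of "dpt J" z] z by simp
      also have "\<dots> \<le> 3 / 4" using J good_iff[of "dpt J"] \<kappa> by linarith
      finally have "(1 / 2)\<^sup>2 \<le> (norm (g z))\<^sup>2" by (simp add: Q_def power2_eq_square)
      then show "1 / 2 \<le> norm (g z)" by (rule power2_le_imp_le) simp
    qed
    \<comment> \<open>The roots are taken l + 2 generations below K, among the P = 4 *
      \<open>2 ^ l\<close> descendants there; c is a middle one, so every symmetric range of radius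
      at most \<open>2 ^ l\<close> stays inside K.\<close>
    define M where "M = m + (l + 2)"
    define P where "P = (2::int) ^ (l + 2)"
    define c where "c = k * P + 2 * 2 ^ l"
    have pP: "p = of_int P" by (simp add: p_def P_def)
    have subK: "(M, i) \<sqsubseteq> K" if "k * P \<le> i" "i < (k + 1) * P" for i
    proof -
      have "i div P = k" using that
        by (intro int_div_pos_eq[of _ _ _ "i - k * P"]) (auto simp: algebra_simps)
      then show ?thesis by (simp add: dsub_def K M_def P_def)
    qed
    have ratio: "dlen K / dlen (M, i) = p" for i by (simp add: dlen_def K M_def p_def power_add)
    have pd: "p powr d \<le> p" using p1 d powr_mono[of d 1 p] by simp
    have Qroot: "Q (dpt (M, i)) \<le> 3 * p * Q (dpt K)" "Q (dpt K) \<le> 3 * p * Q (dpt (M, i))"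
      if "k * P \<le> i" "i < (k + 1) * P" for i
    proof -
      have "3 * p powr d * Q (dpt K) \<le> 3 * p * Q (dpt K)" using pd QK by (intro mult_right_mono) auto
      then show "Q (dpt (M, i)) \<le> 3 * p * Q (dpt K)"
        using Q_dsub(1)[OF subK[OF that]] by (simp add: ratio)
      have "3 * p powr d * Q (dpt (M, i)) \<le> 3 * p * Q (dpt (M, i))"
        using pd Q_pos[of "dpt (M, i)"] by (intro mult_right_mono) auto
      then show "Q (dpt K) \<le> 3 * p * Q (dpt (M, i))"
        using Q_dsub(2)[OF subK[OF that]] by (simp add: ratio)
    qed
    have P4: "P = 4 * 2 ^ l" by (simp add: P_def)
    have in_range: "k * P \<le> i" "i < (k + 1) * P" if "c - 2 ^ l \<le> i" "i \<le> c + 2 ^ l" for i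
    proof -
      have "(0::int) < 2 ^ l" by simp
      moreover have "(k + 1) * P = k * P + 4 * 2 ^ l" by (simp add: P4 algebra_simps)
      ultimately show "k * P \<le> i" "i < (k + 1) * P" using that unfolding c_def by linarith+
    qed
    \<comment> \<open>With this \<Lambda> the outer walls, which cost at most 3 G times the two
      extreme values of Q, use up only half of the lower bound v0 times the sum of Q.\<close>
    define \<Lambda> where "\<Lambda> = 6 * G / v0"
    have \<Lambda>: "1 < \<Lambda>" using G1 v0 by (simp add: \<Lambda>_def field_simps)
    have "\<exists>j\<le>2 ^ l. \<Lambda> * (Q (dpt (M, c - int j)) + Q (dpt (M, c + int j))) \<le>
       (\<Sum>i<Suc (2 * j). Q (dpt (M, c - int j + int i)))"
    proof (rule symmetric_range_selection[OF \<Lambda>, where lo = "Q (dpt K) / (3 * p)" and hi = "3 * p * Q (dpt K)"])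
      show "Q (dpt K) / (3 * p) \<le> Q (dpt (M, c))"
        using Qroot(2)[OF in_range, of c] p1 by (simp add: field_simps)
      show "Q (dpt (M, i)) \<le> 3 * p * Q (dpt K)" if "c - int (2 ^ l) \<le> i" "i \<le> c + int (2 ^ l)" for i
        using Qroot(1)[OF in_range, of i] that by simp
      have "p\<^sup>2 = 16 * (2 ^ l)\<^sup>2" by (simp add: p_def power_mult_distrib power_add)
      then have "(1 - 1 / \<Lambda>) ^ 2 ^ l * (2 * real (2 ^ l) + 1) * (9 * p\<^sup>2) < 1"
        using sel by (simp add: \<Lambda>_def)
      then have "(1 - 1 / \<Lambda>) ^ 2 ^ l * (2 * real (2 ^ l) + 1) * (9 * p\<^sup>2) * (Q (dpt K) / (3 * p)) < 1 * (Q (dpt K) / (3 * p))"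
        using QK p1 by (intro mult_strict_right_mono) auto
      moreover have "(9 * p\<^sup>2) * (Q (dpt K) / (3 * p)) = 3 * p * Q (dpt K)"
        using p1 by (simp add: power2_eq_square)
      ultimately show "(1 - 1 / \<Lambda>) ^ 2 ^ l * (2 * real (2 ^ l) + 1) * (3 * p * Q (dpt K)) < Q (dpt K) / (3 * p)"
        by (metis mult.assoc mult_1)
    qed
    then obtain j where j: "j \<le> 2 ^ l" "\<Lambda> * (Q (dpt (M, c - int j)) + Q (dpt (M, c + int j))) \<le>
       (\<Sum>i<Suc (2 * j). Q (dpt (M, c - int j + int i)))" by blast
    define a where "a = c - int j"
    define SQ where "SQ = (\<Sum>i<Suc (2 * j). Q (dpt (M, a + int i)))"
    have jl: "int j \<le> 2 ^ l" using j(1) by (metis of_nat_le_iff of_nat_numeral of_nat_power)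
    have rng: "k * P \<le> a + int i" "a + int i < (k + 1) * P" if "i < Suc (2 * j)" for i
      using in_range[of "a + int i"] that jl by (auto simp: a_def)
    have edge: "(1 + D) / 2 \<le> norm (g (Complex x (1 / 2 ^ M)))"
      if "i < Suc (2 * j)" "of_int (a + int i) / 2 ^ M \<le> x" "x \<le> of_int (a + int i + 1) / 2 ^ M" for i x
    proof -
      have "Q (Complex x (1 / 2 ^ M)) \<le> 3 * Q (dpt (M, a + int i))" by (rule Q_edge(1)[OF that(2,3)])
      also have "\<dots> \<le> 3 * (3 * p * Q (dpt K))" using Qroot(1)[OF rng[OF that(1)]] by simp
      also have "\<dots> \<le> 9 * p * \<kappa>" using QK\<kappa> p1 by simp
      also have "\<dots> \<le> 1 - ((1 + D) / 2)\<^sup>2" using \<kappa>(3) p1 by (simp add: field_simps)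
      finally have "((1 + D) / 2)\<^sup>2 \<le> (norm (g (Complex x (1 / 2 ^ M))))\<^sup>2" by (simp add: Q_def)
      then show ?thesis by (rule power2_le_imp_le) simp
    qed
    have eok: "edge_ok M (a + int i)" if "i < Suc (2 * j)" for i
      unfolding edge_ok_def using edge[OF that] D by force
    have leaf: "leafsum n M (a + int i) \<le> C2 * \<tau> / 2 ^ M + C2 * (ret_mass n M (a + int i) + out_mass n M (a + int i))"
      if "i < Suc (2 * j)" for n i
    proof (rule leafsum_le[OF _ _ eok[OF that]])
      fix m k assume e: "edge_ok m k"
      have up: "V m k + 2 * chg m k \<le> C2 * Q (dpt (m, k)) / 2 ^ m"
        using leaf_upper[OF refl e] by (simp add: C2_def)
      have "C2 * Q (dpt (m, k)) \<le> C2 * \<tau> + C2"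
        using C2 \<tau> Q_le_1[of "dpt (m, k)"] mult_left_mono[of "Q (dpt (m, k))" "\<tau> + 1" C2] by (simp add: distrib_left)
      then show "V m k + 2 * chg m k \<le> (C2 * \<tau> + C2) / 2 ^ m"
        by (intro order_trans[OF up] divide_right_mono) auto
      assume "t \<le> norm (g (dpt (m, k)))"
      then have "t\<^sup>2 \<le> (norm (g (dpt (m, k))))\<^sup>2" using \<delta>t by (intro power_mono) auto
      then have "Q (dpt (m, k)) \<le> \<tau>" using \<tau> \<kappa> by (simp add: Q_def t_def)
      then show "V m k + 2 * chg m k \<le> C2 * \<tau> / 2 ^ m"
        using C2 by (intro order_trans[OF up] divide_right_mono mult_left_mono) auto
    qed
    have "(\<lambda>n. \<Sum>i<Suc (2 * j). out_mass n M (a + int i)) \<longlonglongrightarrow> (\<Sum>i<Suc (2 * j). 0)"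
    proof (rule tendsto_sum)
      fix i assume "i \<in> {..<Suc (2 * j)}"
      then have "dcl (M, a + int i) \<subseteq> dcl K" using dcl_mono[OF subK[OF rng]] by simp
      then show "(\<lambda>n. out_mass n M (a + int i)) \<longlonglongrightarrow> 0"
        using \<delta>t by (intro out_mass_tendsto_0 unimodular_boundary_subset[OF bd]) auto
    qed
    then have "(\<lambda>n. \<Sum>i<Suc (2 * j). out_mass n M (a + int i)) \<longlonglongrightarrow> 0" by simp
    moreover have "0 < c1 / (4 * C2) * Q (dpt K) * dlen K" using c1 C2 QK by (simp add: divide_pos_pos)
    ultimately have "\<forall>\<^sub>F n in sequentially. (\<Sum>i<Suc (2 * j). out_mass n M (a + int i)) < c1 / (4 * C2) * Q (dpt K) * dlen K"
      by (rule order_tendstoD(2))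
    then obtain n where n: "(\<Sum>i<Suc (2 * j). out_mass n M (a + int i)) < c1 / (4 * C2) * Q (dpt K) * dlen K"
      using eventually_happens'[OF sequentially_bot] by blast
    define R where "R = (\<Sum>i<Suc (2 * j). ret_mass n M (a + int i))"
    define O' where "O' = (\<Sum>i<Suc (2 * j). out_mass n M (a + int i))"
    have lower: "v0 * SQ / 2 ^ M \<le> (\<Sum>i<Suc (2 * j). V M (a + int i))"
    proof -
      have "v0 * SQ / 2 ^ M = (\<Sum>i<Suc (2 * j). (1 - D) / 12 * Q (dpt (M, a + int i)) / 2 ^ M)"
        unfolding SQ_def v0_def sum_distrib_left sum_divide_distrib ..
      also have "\<dots> \<le> (\<Sum>i<Suc (2 * j). V M (a + int i))"
        by (intro sum_mono V_lower dD D edge) auto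
      finally show ?thesis .
    qed
    have upper: "(\<Sum>i<Suc (2 * j). leafsum n M (a + int i)) \<le> C2 * \<tau> * dlen K + C2 * (R + O')"
    proof -
      have "(\<Sum>i<Suc (2 * j). leafsum n M (a + int i)) \<le>
         (\<Sum>i<Suc (2 * j). C2 * \<tau> / 2 ^ M + C2 * (ret_mass n M (a + int i) + out_mass n M (a + int i)))"
        by (intro sum_mono leaf) simp
      also have "\<dots> = real (Suc (2 * j)) * (C2 * \<tau> / 2 ^ M) + C2 * (R + O')"
        unfolding R_def O'_def by (simp only: sum.distrib sum_distrib_left sum_constant card_lessThan distrib_left)
      also have "real (Suc (2 * j)) * (C2 * \<tau> / 2 ^ M) \<le> p * (C2 * \<tau> / 2 ^ M)"
      proof (rule mult_right_mono)
        have "real_of_int (int (Suc (2 * j))) \<le> real_of_int (4 * 2 ^ l)"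
        proof (rule of_int_le_iff[THEN iffD2])
          have "(1::int) \<le> 2 ^ l" by simp
          then show "int (Suc (2 * j)) \<le> 4 * 2 ^ l" using jl by linarith
        qed
        then show "real (Suc (2 * j)) \<le> p" by (simp add: p_def)
      qed (use C2 \<tau> in simp)
      also have "p * (C2 * \<tau> / 2 ^ M) = C2 * \<tau> * dlen K"
        by (simp add: p_def M_def K dlen_def power_add)
      finally show ?thesis by simp
    qed
    have sides: "G * (3 * Q (dpt (M, a + int (2 * j))) + Q (dpt (M, a))) \<le> v0 / 2 * SQ"
    proof -
      have e: "a + int (2 * j) = c + int j" by (simp add: a_def)
      have "G * (3 * Q (dpt (M, c + int j)) + Q (dpt (M, a))) \<le> G * (3 * (Q (dpt (M, a)) + Q (dpt (M, c + int j))))"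
        using G1 Q_pos[of "dpt (M, a)"] by (intro mult_left_mono) auto
      also have "\<dots> = v0 / 2 * (\<Lambda> * (Q (dpt (M, a)) + Q (dpt (M, c + int j))))"
        using v0 by (simp add: \<Lambda>_def)
      also have "\<dots> \<le> v0 / 2 * SQ"
        using j(2) v0 unfolding SQ_def a_def by (intro mult_left_mono) auto
      finally show ?thesis unfolding e .
    qed
    have main: "v0 / 2 * SQ / 2 ^ M \<le> C2 * \<tau> * dlen K + C2 * (R + O')"
    proof -
      have "v0 * SQ / 2 ^ M \<le> C2 * \<tau> * dlen K + C2 * (R + O') + v0 / 2 * SQ / 2 ^ M"
        by (rule order_trans[OF lower order_trans[OF forest_estimate add_mono[OF upper divide_right_mono[OF sides]]]]) simp
      moreover have "v0 * SQ / 2 ^ M = v0 / 2 * SQ / 2 ^ M + v0 / 2 * SQ / 2 ^ M" by simp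
      moreover have "x \<le> y + z \<Longrightarrow> x = z + z \<Longrightarrow> z \<le> y" for x y z :: real by simp
      ultimately show ?thesis by blast
    qed
    have SQ: "Q (dpt K) / (3 * p) \<le> SQ"
    proof -
      have "Q (dpt K) / (3 * p) \<le> Q (dpt (M, a + int j))"
        using Qroot(2)[OF rng, of j] p1 by (simp add: field_simps)
      also have "\<dots> \<le> SQ" unfolding SQ_def
        by (rule member_le_sum) (auto intro!: less_imp_le[OF Q_pos])
      finally show ?thesis .
    qed
    \<comment> \<open>Half of this main term pays for the leaves at t and a quarter for what is
      still unstopped; the last quarter must come from returned leaves.\<close>
    have "c1 * Q (dpt K) * dlen K = v0 / 2 * (Q (dpt K) / (3 * p)) / 2 ^ M"
      using p1 by (simp add: c1_def K dlen_def M_def p_def power_add power2_eq_square)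
    also have "\<dots> \<le> v0 / 2 * SQ / 2 ^ M" using SQ v0 by (intro divide_right_mono mult_left_mono) auto
    finally have "c1 * Q (dpt K) * dlen K \<le> C2 * \<tau> * dlen K + C2 * (R + O')" using main by (rule order_trans)
    moreover have "C2 * \<tau> * dlen K \<le> c1 * Q (dpt K) / 2 * dlen K"
    proof (rule mult_right_mono)
      have "C2 * \<tau> \<le> c1 * q / 2" using \<tau>(4) C2 by (simp add: field_simps)
      also have "\<dots> \<le> c1 * Q (dpt K) / 2" using q c1 by simp
      finally show "C2 * \<tau> \<le> c1 * Q (dpt K) / 2" .
    qed (simp add: less_imp_le)
    moreover have "C2 * O' \<le> c1 / 4 * Q (dpt K) * dlen K"
    proof -
      have "C2 * O' \<le> C2 * (c1 / (4 * C2) * Q (dpt K) * dlen K)"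
        using n C2 unfolding O'_def by (intro mult_left_mono) auto
      also have "\<dots> = c1 / 4 * Q (dpt K) * dlen K" using C2 by simp
      finally show ?thesis .
    qed
    moreover have "x * y * z \<le> w + C2 * (R + O') \<Longrightarrow> w \<le> x * y / 2 * z \<Longrightarrow> C2 * O' \<le> x / 4 * y * z
        \<Longrightarrow> x / 4 * y * z \<le> C2 * R" for x y z w :: real
      by (simp add: distrib_left)
    ultimately have "c1 / 4 * Q (dpt K) * dlen K \<le> C2 * R" by blast
    then have mass: "c1 / (4 * C2) * Q (dpt K) * dlen K \<le> R" using C2 by (simp add: field_simps)
    define S where "S = (\<lambda>i. (M, a + int i)) ` {..<Suc (2 * j)}"
    define F where "F = (\<Union>L\<in>S. ret_set n (fst L) (snd L))"
    have S: "finite S" "\<And>L. L \<in> S \<Longrightarrow> fst L = M" "\<And>L. L \<in> S \<Longrightarrow> L \<sqsubseteq> K"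
      using subK[OF rng] by (auto simp: S_def)
    have rsub: "J \<sqsubseteq> L" if "J \<in> ret_set n (fst L) (snd L)" for J L using ret_set_dsub[OF that] by simp
    have "returns g \<delta> t K (c1 / (4 * C2) * Q (dpt K)) F"
      unfolding returns_def
    proof (intro conjI ballI allI impI)
      show "finite F" unfolding F_def using S(1) ret_set_finite by auto
      show "dantichain F" unfolding F_def
        by (rule dantichain_UN[OF S(2) ret_set_antichain rsub])
      have "(\<Sum>J\<in>F. dlen J) = (\<Sum>L\<in>S. \<Sum>J\<in>ret_set n (fst L) (snd L). dlen J)"
        unfolding F_def by (rule sum_UN_families[OF S(1) S(2) ret_set_finite rsub])
      also have "\<dots> = (\<Sum>L\<in>S. ret_mass n (fst L) (snd L))" by (simp add: ret_set_sum)
      also have "\<dots> = R" unfolding S_def R_def by (subst sum.reindex) (auto simp: inj_on_def)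
      finally show "c1 / (4 * C2) * Q (dpt K) * dlen K \<le> (\<Sum>J\<in>F. dlen J)" using mass by simp
      fix J assume "J \<in> F"
      then obtain L where L: "L \<in> S" "J \<in> ret_set n (fst L) (snd L)" by (auto simp: F_def)
      show "J \<sqsubseteq> K" using dsub_trans[OF rsub[OF L(2)] S(3)[OF L(1)]] .
      show "norm (g (dpt J)) \<le> \<delta>" using ret_set_good[OF L(2)] .
      fix A assume A: "J \<sqsubseteq> A \<and> A \<sqsubseteq> K"
      show "norm (g (dpt A)) \<le> t"
      proof (cases "fst A \<le> M")
        case False
        then have "A \<sqsubseteq> L" using dsub_comparable_aux[OF rsub[OF L(2)], of A] A S(2)[OF L(1)] by simp
        then show ?thesis using ret_set_path[OF L(2), of A] A \<delta>t by simp
      next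
        \<comment> \<open>The stopping rule does not see the intervals between K and the roots; over
          these l + 2 generations Q falls by a factor of at most 3 p, and \<tau> <= q / (3
          p).\<close>
        case True
        have "L \<sqsubseteq> A" using dsub_comparable_aux[of J A L] rsub[OF L(2)] A S(2)[OF L(1)] True by simp
        then have "dlen K / dlen A \<le> dlen K / dlen L" using dlen_mono by (intro divide_left_mono) (auto simp: less_imp_le)
        also have "\<dots> = p" using ratio S(2)[OF L(1)] by (metis prod.collapse)
        finally have "(dlen K / dlen A) powr d \<le> p powr d" using d by (intro powr_mono2) (auto simp: less_imp_le)
        then have "(dlen K / dlen A) powr d \<le> p" using pd by linarith
        then have "3 * (dlen K / dlen A) powr d * Q (dpt A) \<le> 3 * p * Q (dpt A)"
          using Q_pos[of "dpt A"] by (intro mult_right_mono) auto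
        moreover have "Q (dpt K) \<le> 3 * (dlen K / dlen A) powr d * Q (dpt A)" using Q_dsub(2) A by blast
        ultimately have "q \<le> 3 * p * Q (dpt A)" using q by linarith
        then have "q / (3 * p) \<le> Q (dpt A)" using p1 by (simp add: field_simps)
        then show ?thesis using \<tau>(3) t_iff by auto
      qed
    qed
    then show ?thesis unfolding \<delta>_def t_def Q_def by blast
  qed
qed

text \<open>Only t depends on q: the good level and the return proportion are fixed by D.
  \<open>branching_large\<close> relies on this order when it chooses the number of generations
  before it knows how close to the circle the descendants come.\<close>

lemma return_large:
  fixes D :: real assumes D: "0 < D" "D < 1"
  shows "\<exists>\<delta> c0. 0 < \<delta> \<and> \<delta> < 1 \<and> 0 < c0 \<and> (\<forall>q>0. \<exists>t. \<delta> < t \<and> t < 1 \<and>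
    (\<forall>g d K. hyp_lipschitz g d \<longrightarrow> d \<le> D \<longrightarrow> unimodular_boundary g (dcl K) \<longrightarrow>
      q \<le> 1 - (norm (g (dpt K)))\<^sup>2 \<longrightarrow> (\<exists>F. returns g \<delta> t K (c0 * (1 - (norm (g (dpt K)))\<^sup>2)) F)))"
proof -
  define G where "G = 1 / (1 - 2 powr D / 2)"
  define v0 where "v0 = (1 - D) / 12"
  have powD: "2 powr D < 2" using D powr_less_mono[of D 1 2] by simp
  have G1: "1 \<le> G" using powD by (simp add: G_def field_simps)
  have v0: "0 < v0" "v0 \<le> 1 / 12" using D by (auto simp: v0_def)
  have "1 < 6 * G / v0" using G1 v0 by (simp add: field_simps)
  then have r: "0 < 1 - 1 / (6 * G / v0)" "1 - 1 / (6 * G / v0) < 1" using G1 v0 by (simp_all add: field_simps)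
  obtain l where l: "(1 - 1 / (6 * G / v0)) ^ (2 ^ l) * (2 * real (2 ^ l) + 1) * (144 * (2 ^ l)\<^sup>2) < 1"
    using exists_power_small[OF r] by blast
  define p where "p = (2::real) ^ (l + 2)"
  define C2 where "C2 = 9 + 6 * G"
  define c1 where "c1 = v0 / (6 * p\<^sup>2)"
  have pos: "0 < p" "0 < C2" "0 < c1" using G1 v0 by (auto simp: p_def C2_def c1_def)
  define \<kappa> where "\<kappa> = min (1 / 48) ((1 - ((1 + D) / 2)\<^sup>2) / (9 * p))"
  have "((1 + D) / 2)\<^sup>2 < 1" using D by (simp add: power_less_one_iff abs_square_less_1)
  then have \<kappa>: "0 < \<kappa>" "\<kappa> \<le> 1 / 48" "\<kappa> \<le> (1 - ((1 + D) / 2)\<^sup>2) / (9 * p)" using pos by (auto simp: \<kappa>_def)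
  have "\<exists>t>sqrt (1 - \<kappa>). t < 1 \<and> (\<forall>g d K. hyp_lipschitz g d \<longrightarrow> d \<le> D \<longrightarrow>
      unimodular_boundary g (dcl K) \<longrightarrow> q \<le> 1 - (norm (g (dpt K)))\<^sup>2 \<longrightarrow>
      (\<exists>F. returns g (sqrt (1 - \<kappa>)) t K (c1 / (4 * C2) * (1 - (norm (g (dpt K)))\<^sup>2)) F))"
    if q: "0 < q" for q
  proof -
    define \<tau> where "\<tau> = min (\<kappa> / 2) (min (q / (3 * p)) (c1 * q / (2 * C2)))"
    have \<tau>: "0 < \<tau>" "\<tau> < \<kappa>" "\<tau> \<le> q / (3 * p)" "\<tau> \<le> c1 * q / (2 * C2)"
      using \<kappa> q pos by (auto simp: \<tau>_def)
    have "sqrt (1 - \<kappa>) < sqrt (1 - \<tau>)" "sqrt (1 - \<tau>) < 1" using \<tau> by auto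
    then show ?thesis
      using return_large_core[OF D G_def v0_def p_def C2_def c1_def l \<kappa> \<tau>] by blast
  qed
  moreover have "0 < sqrt (1 - \<kappa>)" "sqrt (1 - \<kappa>) < 1" "0 < c1 / (4 * C2)" using \<kappa> pos by auto
  ultimately show ?thesis by blast
qed

section \<open>Returning before leaving a small disc\<close>

lemma returns_mono: "returns g \<delta> t K c F \<Longrightarrow> t \<le> t' \<Longrightarrow> returns g \<delta> t' K c F"
  unfolding returns_def by (meson order_trans)

lemma (in sawtooth) ret_mass_nonneg: "0 \<le> ret_mass n m k"
  by (induction n arbitrary: m k) auto

lemma (in sawtooth) out_mass_nonneg: "0 \<le> out_mass n m k"
  by (induction n arbitrary: m k) auto

text \<open>For small d the wall and derivative terms are O(d / \<delta>), so the mean of u is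
  almost preserved. On top of K it is at least -ln s', on leaves at t at most about -ln t'; the gap
  lam must be made up by returned leaves, where u is at most B0.\<close>

lemma return_small:
  fixes \<delta> s t :: real assumes \<delta>: "0 < \<delta>" "\<delta> \<le> s" and st: "s < t" "t < 1"
  shows "\<exists>D0>0. \<exists>p>0. \<forall>g d K. hyp_lipschitz g d \<longrightarrow> d \<le> D0 \<longrightarrow> unimodular_boundary g (dcl K) \<longrightarrow>
    norm (g (dpt K)) \<le> s \<longrightarrow> (\<exists>F. returns g \<delta> t K p F)"
proof -
  \<comment> \<open>Margins of a third of t - s absorb the error 2 d between a corner and its top
    edge.\<close>
  define s' t' where "s' = (2 * s + t) / 3" and "t' = (s + 2 * t) / 3"
  have s't': "0 < s'" "s' < t'" using \<delta> st by (auto simp: s'_def t'_def)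
  define lam where "lam = ln (t' / s')"
  have lam: "0 < lam" using s't' by (simp add: lam_def)
  define B0 where "B0 = ln (2 / \<delta>)"
  have B0: "0 < B0" using \<delta> st by (simp add: B0_def)
  define p where "p = min 1 (lam / (4 * B0))"
  have p: "0 < p" "p \<le> 1" "p \<le> lam / (4 * B0)" using lam B0 by (auto simp: p_def)
  \<comment> \<open>\<delta> / 4 keeps |g| >= \<delta> / 2 in the boxes, 1 / 2 gives
    \<open>2 powr d\<close> <= 3 / 2 so that G = 4 d / \<delta> works, and (t - s) / 6 serves the
    margins. The errors add up to 42 d / \<delta>, namely 1 from the top, 25 from the leaves and 16
    from the outer walls, and 84 makes them at most lam / 2.\<close>
  define D0 where "D0 = min (\<delta> / 4) (min (1 / 2) (min ((t - s) / 6) (\<delta> * lam / 84)))"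
  have D0: "0 < D0" using \<delta> st lam by (auto simp: D0_def)
  have "\<exists>F. returns g \<delta> t K p F"
    if hl: "hyp_lipschitz g d" and dD: "d \<le> D0" and bd: "unimodular_boundary g (dcl K)"
      and Ks: "norm (g (dpt K)) \<le> s" for g d K
  proof (cases "norm (g (dpt K)) \<le> \<delta>")
    case True
    have "p * dlen K \<le> 1 * dlen K" using p by (intro mult_right_mono) (auto simp: less_imp_le)
    then have "returns g \<delta> t K p {K}"
      unfolding returns_def using True \<delta> st dsub_antisym by (fastforce simp: dantichain_def)
    then show ?thesis by blast
  next
    case False
    interpret hyp_lipschitz g d by (rule hl)
    have dd: "d \<le> \<delta> / 4" "d \<le> 1 / 2" "d \<le> (t - s) / 6" "d \<le> \<delta> * lam / 84"
      using dD by (auto simp: D0_def)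
    interpret sawtooth g d \<delta> t "\<delta> / 2" "4 * d / \<delta>"
    proof
      show "0 < \<delta> / 2" using \<delta> by simp
      show "0 \<le> 4 * d / \<delta>" using \<delta> d by simp
      have "(2::real) powr d \<le> 2 powr (1 / 2)" using dd by (intro powr_mono) auto
      also have "\<dots> = sqrt 2" by (simp add: powr_half_sqrt)
      also have "\<dots> \<le> 3 / 2" by (rule real_le_lsqrt) (auto simp: power2_eq_square)
      finally have "4 * d / \<delta> * (2 powr d / 2) \<le> 4 * d / \<delta> * (3 / 2 / 2)"
        using d \<delta> by (intro mult_left_mono) auto
      then show "d / (2 * (\<delta> / 2)) + 4 * d / \<delta> * (2 powr d / 2) \<le> 4 * d / \<delta>" by simp
      fix J z assume J: "\<delta> < norm (g (dpt J))" and z: "\<bar>Re z - Re (dpt J)\<bar> \<le> 2 * dlen J"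
        "dlen J / 4 \<le> Im z" "Im z \<le> 2 * dlen J"
      have "norm (g z - g (dpt J)) \<le> 2 * d" using near(3)[of "dpt J" z] z by simp
      then have "norm (g (dpt J)) - norm (g z) \<le> 2 * d"
        using norm_triangle_ineq2[of "g (dpt J)" "g z"] by (simp add: norm_minus_commute)
      then show "\<delta> / 2 \<le> norm (g z)" using J dd by simp
    qed
    obtain m k where K: "K = (m, k)" by (cases K)
    have nearedge: "\<bar>norm (g (Complex x (1 / 2 ^ m))) - norm (g (dpt (m, k)))\<bar> \<le> 2 * d"
      if "of_int k / 2 ^ m \<le> x" "x \<le> of_int (k + 1) / 2 ^ m" for x m k
    proof -
      have "norm (g (Complex x (1 / 2 ^ m)) - g (dpt (m, k))) \<le> 2 * d"
        using near(3)[of "dpt (m, k)" "Complex x (1 / 2 ^ m)"] that by (simp add: dlen_def add_divide_distrib)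
      then show ?thesis using norm_triangle_ineq3[of "g (Complex x (1 / 2 ^ m))" "g (dpt (m, k))"] by linarith
    qed
    have Qd: "d * Q z / (2 * norm (g z)) \<le> d / \<delta>" if "\<delta> / 2 \<le> norm (g z)" for z
    proof -
      have "d * Q z / (2 * norm (g z)) \<le> d * 1 / (2 * (\<delta> / 2))"
        using that \<delta> d Q_le_1[of z] by (intro frac_le mult_left_mono) auto
      then show ?thesis by simp
    qed
    have chg: "2 * chg m k \<le> (24 * d / \<delta>) / 2 ^ m" for m k
    proof -
      have "24 * d / \<delta> * Q (dpt (m, k)) \<le> 24 * d / \<delta> * 1"
        using \<delta> d Q_le_1 by (intro mult_left_mono) auto
      then have "24 * d / \<delta> * Q (dpt (m, k)) / 2 ^ m \<le> 24 * d / \<delta> / 2 ^ m" by (intro divide_right_mono) auto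
      then show ?thesis by (simp add: chg_def)
    qed
    define A where "A = - ln (t - 2 * d) + 25 * d / \<delta>"
    define B where "B = ln (2 / \<delta>) + ln (t - 2 * d)"
    have td: "t' \<le> t - 2 * d" "s + 2 * d \<le> s'" using dd by (auto simp: t'_def s'_def field_simps)
    have eokK: "edge_ok m k"
      unfolding edge_ok_def
    proof (intro allI impI)
      fix x :: real assume x: "of_int k / 2 ^ m \<le> x" "x \<le> of_int (k + 1) / 2 ^ m"
      have "norm (g (dpt (m, k))) - 2 * d \<le> norm (g (Complex x (1 / 2 ^ m)))" using nearedge[OF x] by linarith
      then show "\<delta> / 2 \<le> norm (g (Complex x (1 / 2 ^ m)))" using False dd by (simp add: K)
    qed
    have leafV: "V m k + 2 * chg m k \<le> (- ln c + 25 * d / \<delta>) / 2 ^ m"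
      if e: "edge_ok m k" and c: "0 < c" "\<And>x. of_int k / 2 ^ m \<le> x \<Longrightarrow> x \<le> of_int (k + 1) / 2 ^ m \<Longrightarrow> c \<le> norm (g (Complex x (1 / 2 ^ m)))" for m k c
    proof -
      have "V m k \<le> (- ln c + d / \<delta>) / 2 ^ m"
      proof (rule V_bounds(1))
        fix x :: real assume x: "of_int k / 2 ^ m \<le> x" "x \<le> of_int (k + 1) / 2 ^ m"
        have cx: "c \<le> norm (g (Complex x (1 / 2 ^ m)))" by (rule c(2)[OF x])
        then show "g (Complex x (1 / 2 ^ m)) \<noteq> 0" using c(1) by auto
        have "- ln (norm (g (Complex x (1 / 2 ^ m)))) \<le> - ln c" using cx c(1) by (intro le_imp_neg_le ln_mono) auto
        moreover have "\<delta> / 2 \<le> norm (g (Complex x (1 / 2 ^ m)))" using e x by (simp add: edge_ok_def)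
        ultimately show "- ln (norm (g (Complex x (1 / 2 ^ m)))) + d * Q (Complex x (1 / 2 ^ m)) /
          (2 * norm (g (Complex x (1 / 2 ^ m)))) \<le> - ln c + d / \<delta>" using Qd by (intro add_mono) auto
      qed
      then have "V m k + 2 * chg m k \<le> (- ln c + d / \<delta>) / 2 ^ m + (24 * d / \<delta>) / 2 ^ m" using chg by (intro add_mono)
      also have "\<dots> = (- ln c + 25 * d / \<delta>) / 2 ^ m"
      proof -
        have "- ln c + d / \<delta> + 24 * d / \<delta> = - ln c + 25 * d / \<delta>" by simp
        then show ?thesis unfolding add_divide_distrib[of _ _ "2 ^ m", symmetric] by (rule arg_cong)
      qed
      finally show ?thesis .
    qed
    have leaf: "leafsum n m k \<le> A / 2 ^ m + B * (ret_mass n m k + out_mass n m k)" for n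
    proof (rule leafsum_le[OF _ _ eokK])
      fix m k assume e: "edge_ok m k"
      have "- ln (\<delta> / 2) + 25 * d / \<delta> = A + B" using \<delta> by (simp add: A_def B_def ln_div)
      then show "V m k + 2 * chg m k \<le> (A + B) / 2 ^ m"
        using leafV[OF e, of "\<delta> / 2"] e \<delta> by (simp add: edge_ok_def)
      assume tt: "t \<le> norm (g (dpt (m, k)))"
      show "V m k + 2 * chg m k \<le> A / 2 ^ m"
        unfolding A_def
      proof (rule leafV[OF e])
        show "0 < t - 2 * d" using td s't' by linarith
        fix x :: real assume x: "of_int k / 2 ^ m \<le> x" "x \<le> of_int (k + 1) / 2 ^ m"
        show "t - 2 * d \<le> norm (g (Complex x (1 / 2 ^ m)))" using nearedge[OF x] tt by linarith
      qed
    qed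
    have low: "(- ln s' - d / \<delta>) / 2 ^ m \<le> V m k"
    proof (rule V_bounds(2))
      fix x :: real assume x: "of_int k / 2 ^ m \<le> x" "x \<le> of_int (k + 1) / 2 ^ m"
      have h: "\<delta> / 2 \<le> norm (g (Complex x (1 / 2 ^ m)))" using eokK x by (simp add: edge_ok_def)
      then show nz: "g (Complex x (1 / 2 ^ m)) \<noteq> 0" using \<delta> by auto
      have "norm (g (Complex x (1 / 2 ^ m))) \<le> s'" using nearedge[OF x] Ks td by (simp add: K)
      then have "ln (norm (g (Complex x (1 / 2 ^ m)))) \<le> ln s'" using nz s't' by simp
      then show "- ln s' - d / \<delta> \<le> - ln (norm (g (Complex x (1 / 2 ^ m)))) - d * Q (Complex x (1 / 2 ^ m)) /
          (2 * norm (g (Complex x (1 / 2 ^ m))))" using Qd[OF h] by simp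
    qed
    have "0 < p * dlen K" using p by simp
    then have "\<forall>\<^sub>F n in sequentially. out_mass n m k < p * dlen K"
      using order_tendstoD(2)[OF out_mass_tendsto_0] bd \<delta> st by (simp add: K)
    then obtain n where n: "out_mass n m k < p * dlen K"
      using eventually_happens'[OF sequentially_bot] by blast
    have sides: "4 * d / \<delta> * (3 * Q (dpt (m, k)) + Q (dpt (m, k))) \<le> 16 * d / \<delta>"
    proof -
      have "4 * d / \<delta> * (3 * Q (dpt (m, k)) + Q (dpt (m, k))) \<le> 4 * d / \<delta> * 4"
        using d \<delta> Q_le_1[of "dpt (m, k)"] by (intro mult_left_mono) auto
      then show ?thesis by simp
    qed
    have "V m k \<le> leafsum n m k + 4 * d / \<delta> * (3 * Q (dpt (m, k)) + Q (dpt (m, k))) / 2 ^ m"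
      using forest_estimate[where N = 0 and m = m and k = k and n = n] by simp
    also have "\<dots> \<le> (A / 2 ^ m + B * (ret_mass n m k + out_mass n m k)) + 16 * d / \<delta> / 2 ^ m"
      by (intro add_mono leaf divide_right_mono sides) simp
    finally have "(- ln s' - d / \<delta>) / 2 ^ m \<le> A / 2 ^ m + B * (ret_mass n m k + out_mass n m k) + 16 * d / \<delta> / 2 ^ m"
      using low by linarith
    then have "(- ln s' - d / \<delta>) * dlen K \<le> A * dlen K + B * (ret_mass n m k + out_mass n m k) + 16 * d / \<delta> * dlen K"
      by (simp add: K dlen_def)
    then have "(- ln s' - d / \<delta> - A - 16 * d / \<delta>) * dlen K \<le> B * (ret_mass n m k + out_mass n m k)"
      by (simp add: algebra_simps)
    also have "\<dots> \<le> B0 * (ret_mass n m k + out_mass n m k)"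
    proof (rule mult_right_mono)
      have "ln (t - 2 * d) \<le> 0" using td s't' st d by (intro ln_le_zero_iff[THEN iffD2]) linarith+
      then show "B \<le> B0" by (simp add: B_def B0_def)
    qed (use ret_mass_nonneg out_mass_nonneg in auto)
    finally have 1: "(- ln s' - d / \<delta> - A - 16 * d / \<delta>) * dlen K \<le> B0 * (ret_mass n m k + out_mass n m k)" .
    have "lam / 2 \<le> - ln s' - d / \<delta> - A - 16 * d / \<delta>"
    proof -
      have "ln t' \<le> ln (t - 2 * d)" using td s't' by (subst ln_le_cancel_iff) linarith+
      moreover have "lam = ln t' - ln s'" unfolding lam_def using s't' by (subst ln_div) auto
      moreover have "42 * (d / \<delta>) \<le> lam / 2" using dd(4) \<delta> by (simp add: field_simps)
      moreover have "25 * d / \<delta> = 25 * (d / \<delta>)" "16 * d / \<delta> = 16 * (d / \<delta>)" by simp_all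
      ultimately show ?thesis unfolding A_def by linarith
    qed
    then have "lam / 2 * dlen K \<le> B0 * (ret_mass n m k + out_mass n m k)"
      using 1 mult_right_mono[of "lam / 2" _ "dlen K"] by (meson dlen_pos less_imp_le order_trans)
    moreover have "2 * p * B0 \<le> lam / 2" using p(3) B0 by (simp add: field_simps)
    then have "2 * p * B0 * dlen K \<le> lam / 2 * dlen K" by (intro mult_right_mono) (auto simp: less_imp_le)
    ultimately have "2 * p * B0 * dlen K \<le> B0 * (ret_mass n m k + out_mass n m k)" by (rule order_trans[rotated])
    then have "B0 * (2 * p * dlen K) \<le> B0 * (ret_mass n m k + out_mass n m k)" by (simp only: mult_ac)
    then have "2 * p * dlen K \<le> ret_mass n m k + out_mass n m k" using B0 by simp
    then have mass: "p * dlen K \<le> ret_mass n m k" using n by linarith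
    have "returns g \<delta> t K p (ret_set n m k)"
      unfolding returns_def K using ret_set_finite ret_set_antichain ret_set_dsub ret_set_good ret_set_path[of _ n m k] \<delta> st mass
      by (auto simp: ret_set_sum K)
    then show ?thesis by blast
  qed
  then show ?thesis using D0 p(1) by blast
qed

text \<open>Kolmogorov's maximal inequality for the martingale stopped at distance s0 from w. By the
  parallelogram law the two children add |b|^2 <= e^2 to the mean square, and a stopped interval
  already has square at least s0^2. The centre w is free so that the induction can pass to the
  children.\<close>

lemma martingale_survivors:
  fixes F :: "nat \<Rightarrow> int \<Rightarrow> complex" and w :: complex and e s0 :: real
  assumes mart: "\<And>m k. F m k = (F (Suc m) (2 * k) + F (Suc m) (2 * k + 1)) / 2"
    and inc: "\<And>m k. m < N \<Longrightarrow> norm (F (Suc m) (2 * k) - F m k) \<le> e"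
    and s0: "0 < s0" and mn: "m + n \<le> N"
  shows "\<exists>S. finite S \<and> (\<forall>K\<in>S. fst K = m + n \<and> K \<sqsubseteq> (m, k) \<and>
       (\<forall>A. K \<sqsubseteq> A \<and> A \<sqsubseteq> (m, k) \<longrightarrow> norm (F (fst A) (snd A) - w) < s0)) \<and>
     s0\<^sup>2 * (dlen (m, k) - (\<Sum>K\<in>S. dlen K)) \<le> dlen (m, k) * ((norm (F m k - w))\<^sup>2 + e\<^sup>2 * real n)"
  using mn
proof (induction n arbitrary: m k)
  case 0
  show ?case
  proof (cases "norm (F m k - w) < s0")
    case True
    have "norm (F (fst A) (snd A) - w) < s0" if "(m, k) \<sqsubseteq> A" "A \<sqsubseteq> (m, k)" for A
      using dsub_antisym[OF that] True by auto
    then show ?thesis by (intro exI[of _ "{(m, k)}"]) (auto simp: less_imp_le)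
  next
    case False
    then have "s0\<^sup>2 \<le> (norm (F m k - w))\<^sup>2" using s0 by (intro power_mono) auto
    then have "s0\<^sup>2 * dlen (m, k) \<le> (norm (F m k - w))\<^sup>2 * dlen (m, k)"
      by (rule mult_right_mono) (auto simp: less_imp_le)
    then show ?thesis by (intro exI[of _ "{}"]) (auto simp: mult.commute)
  qed
next
  case (Suc n)
  show ?case
  proof (cases "norm (F m k - w) < s0")
    case False
    then have "s0\<^sup>2 \<le> (norm (F m k - w))\<^sup>2" using s0 by (intro power_mono) auto
    then have "s0\<^sup>2 \<le> (norm (F m k - w))\<^sup>2 + e\<^sup>2 * real (Suc n)" by (simp add: add_increasing2)
    then have "s0\<^sup>2 * dlen (m, k) \<le> ((norm (F m k - w))\<^sup>2 + e\<^sup>2 * real (Suc n)) * dlen (m, k)"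
      by (rule mult_right_mono) (auto simp: less_imp_le)
    then show ?thesis by (intro exI[of _ "{}"]) (auto simp: mult.commute)
  next
    case True
    define b where "b = F (Suc m) (2 * k) - F m k"
    have F1: "F (Suc m) (2 * k) - w = (F m k - w) + b" by (simp add: b_def)
    have F2: "F (Suc m) (2 * k + 1) - w = (F m k - w) - b"
      using mart[of m k] by (simp add: b_def field_simps)
    have "norm b \<le> e" using inc[of m k] Suc.prems by (simp add: b_def)
    then have be: "(norm b)\<^sup>2 \<le> e\<^sup>2" by (intro power_mono) auto
    obtain S1 where S1: "finite S1" "\<And>K. K \<in> S1 \<Longrightarrow> fst K = Suc m + n \<and> K \<sqsubseteq> (Suc m, 2 * k) \<and>
       (\<forall>A. K \<sqsubseteq> A \<and> A \<sqsubseteq> (Suc m, 2 * k) \<longrightarrow> norm (F (fst A) (snd A) - w) < s0)"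
       "s0\<^sup>2 * (dlen (Suc m, 2 * k) - (\<Sum>K\<in>S1. dlen K)) \<le>
         dlen (Suc m, 2 * k) * ((norm (F (Suc m) (2 * k) - w))\<^sup>2 + e\<^sup>2 * real n)"
      using Suc.IH[of "Suc m" "2 * k"] Suc.prems by auto
    obtain S2 where S2: "finite S2" "\<And>K. K \<in> S2 \<Longrightarrow> fst K = Suc m + n \<and> K \<sqsubseteq> (Suc m, 2 * k + 1) \<and>
       (\<forall>A. K \<sqsubseteq> A \<and> A \<sqsubseteq> (Suc m, 2 * k + 1) \<longrightarrow> norm (F (fst A) (snd A) - w) < s0)"
       "s0\<^sup>2 * (dlen (Suc m, 2 * k + 1) - (\<Sum>K\<in>S2. dlen K)) \<le>
         dlen (Suc m, 2 * k + 1) * ((norm (F (Suc m) (2 * k + 1) - w))\<^sup>2 + e\<^sup>2 * real n)"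
      using Suc.IH[of "Suc m" "2 * k + 1"] Suc.prems by auto
    have disj: "S1 \<inter> S2 = {}"
    proof (rule ccontr)
      assume "S1 \<inter> S2 \<noteq> {}"
      then obtain K where "K \<sqsubseteq> (Suc m, 2 * k)" "K \<sqsubseteq> (Suc m, 2 * k + 1)" using S1(2) S2(2) by blast
      then show False by (auto simp: dsub_def)
    qed
    have half: "dlen (Suc m, 2 * k) = dlen (m, k) / 2" "dlen (Suc m, 2 * k + 1) = dlen (m, k) / 2"
      by (simp_all add: dlen_def)
    show ?thesis
    proof (intro exI[of _ "S1 \<union> S2"] conjI ballI allI impI)
      show "finite (S1 \<union> S2)" using S1 S2 by simp
      have sums: "(\<Sum>K\<in>S1 \<union> S2. dlen K) = (\<Sum>K\<in>S1. dlen K) + (\<Sum>K\<in>S2. dlen K)"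
        using S1(1) S2(1) disj by (rule sum.union_disjoint)
      have par: "(norm (F m k - w + b))\<^sup>2 + (norm (F m k - w - b))\<^sup>2 = 2 * (norm (F m k - w))\<^sup>2 + 2 * (norm b)\<^sup>2"
        unfolding cmod_power2 by (simp add: power2_eq_square algebra_simps)
      have "s0\<^sup>2 * (dlen (m, k) - (\<Sum>K\<in>S1 \<union> S2. dlen K)) =
        s0\<^sup>2 * (dlen (m, k) / 2 - (\<Sum>K\<in>S1. dlen K)) + s0\<^sup>2 * (dlen (m, k) / 2 - (\<Sum>K\<in>S2. dlen K))"
        unfolding sums by (simp add: algebra_simps)
      also have "\<dots> \<le> dlen (m, k) / 2 * ((norm (F m k - w + b))\<^sup>2 + e\<^sup>2 * real n) +
         dlen (m, k) / 2 * ((norm (F m k - w - b))\<^sup>2 + e\<^sup>2 * real n)"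
        using S1(3) S2(3) unfolding half F1 F2 by (rule add_mono)
      also have "\<dots> = dlen (m, k) / 2 * (((norm (F m k - w + b))\<^sup>2 + (norm (F m k - w - b))\<^sup>2) + 2 * (e\<^sup>2 * real n))"
        by (simp add: distrib_left)
      also have "\<dots> = dlen (m, k) * ((norm (F m k - w))\<^sup>2 + (norm b)\<^sup>2 + e\<^sup>2 * real n)"
        unfolding par by (simp add: distrib_left)
      also have "\<dots> \<le> dlen (m, k) * ((norm (F m k - w))\<^sup>2 + e\<^sup>2 * real (Suc n))"
        using be by (intro mult_left_mono) (auto simp: less_imp_le algebra_simps)
      finally show "s0\<^sup>2 * (dlen (m, k) - (\<Sum>K\<in>S1 \<union> S2. dlen K)) \<le>
         dlen (m, k) * ((norm (F m k - w))\<^sup>2 + e\<^sup>2 * real (Suc n))" .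
      fix K assume "K \<in> S1 \<union> S2"
      then obtain j where j: "fst K = Suc m + n" "j = 2 * k \<or> j = 2 * k + 1" "K \<sqsubseteq> (Suc m, j)"
        "\<And>A. K \<sqsubseteq> A \<Longrightarrow> A \<sqsubseteq> (Suc m, j) \<Longrightarrow> norm (F (fst A) (snd A) - w) < s0"
        using S1(2)[of K] S2(2)[of K] by blast
      show "fst K = m + Suc n" using j by simp
      have "(Suc m, j) \<sqsubseteq> (m, k)" using j(2) dsub_child[of 0 m k] dsub_child[of 1 m k] by auto
      then show "K \<sqsubseteq> (m, k)" by (rule dsub_trans[OF j(3)])
      fix A assume A: "K \<sqsubseteq> A \<and> A \<sqsubseteq> (m, k)"
      then have "A = (m, k) \<or> A \<sqsubseteq> (Suc m, j)" using dsub_between_child[OF j(3)] by blast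
      then show "norm (F (fst A) (snd A) - w) < s0" using True j(4)[of A] A by auto
    qed
  qed
qed

section \<open>Branching with a gain\<close>

context hyp_lipschitz
begin

text \<open>The martingale consists of the increments of \<open>B - \<i> y g\<close>, \<open>B' = g\<close>, at the fixed height
  \<open>2\<^sup>-\<^sup>N\<close>; the vertical derivative of this function is \<open>y g'\<close>, which is \<open>O(d)\<close>.\<close>

lemma boundary_martingale:
  "\<exists>F. (\<forall>m k. F m k = (F (Suc m) (2 * k) + F (Suc m) (2 * k + 1)) / 2) \<and>
     (\<forall>m\<le>N. \<forall>k. norm (F m k - g (dpt (m, k))) \<le> 2 * d)"
proof -
  obtain B where "\<And>z. z \<in> {z. 0 < Im z} \<Longrightarrow> (B has_field_derivative g z) (at z within {z. 0 < Im z})"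
    using holomorphic_convex_primitive'[OF convex_halfspace_Im_gt open_halfspace_Im_gt holo] by blast
  then have B: "(B has_field_derivative g z) (at z)" if "0 < Im z" for z
    using that at_within_open[of z "{z. 0 < Im z}"] by (metis mem_Collect_eq open_halfspace_Im_gt)
  define P where "P z = B z - \<i> * of_real (Im z) * g z" for z
  have vert: "norm (P (Complex x b) - P (Complex x a)) \<le> d / 2 * (b - a)" if ab: "0 < a" "a \<le> b" for x a b
  proof (cases "a = b")
    case False
    then have "a < b" using ab by simp
    have der: "((\<lambda>y. P (Complex x y)) has_vector_derivative of_real y * deriv g (Complex x y)) (at y)" if "0 < y" for y
      using primitive_deriv_vertical[OF B field_deriv, of x y] that by (simp add: P_def)
    have "norm (P (Complex x b) - P (Complex x a)) \<le> d / 2 * b - d / 2 * a"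
    proof (rule differentiable_bound_general[OF \<open>a < b\<close>, of "\<lambda>y. P (Complex x y)" "\<lambda>y. d / 2 * y"
          "\<lambda>y. of_real y * deriv g (Complex x y)" "\<lambda>y. d / 2"])
      show "continuous_on {a..b} (\<lambda>y. P (Complex x y))"
        by (intro continuous_at_imp_continuous_on ballI has_vector_derivative_continuous[OF der]) (use ab in auto)
      show "continuous_on {a..b} (\<lambda>y. d / 2 * y)" by (intro continuous_intros)
      fix y assume "a < y" "y < b"
      then have y: "0 < y" using ab by simp
      show "((\<lambda>y. P (Complex x y)) has_vector_derivative of_real y * deriv g (Complex x y)) (at y)" by (rule der[OF y])
      show "((\<lambda>y. d / 2 * y) has_vector_derivative d / 2) (at y)"
        by (auto intro!: derivative_eq_intros)
      have "d * Q (Complex x y) \<le> d * 1" using d Q_le_1 by (intro mult_left_mono) auto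
      then show "norm (of_real y * deriv g (Complex x y)) \<le> d / 2"
        using lip[of "Complex x y"] y by (simp add: norm_mult Q_def)
    qed
    then show ?thesis by (simp add: algebra_simps)
  qed simp
  \<comment> \<open>Along the edge the derivative is \<open>g - \<i> y g'\<close>, which stays
    within d of g at the left end: d / 2 from the horizontal move and d / 2 from y g'.\<close>
  have hor: "norm (P (Complex (a + L) L) - P (Complex a L) - of_real L * g (Complex a L)) \<le> d * L" if L: "0 < L" for a L
  proof -
    define R where "R x = P (Complex x L) - of_real x * g (Complex a L)" for x
    have der: "(R has_vector_derivative (g (Complex x L) - \<i> * of_real L * deriv g (Complex x L)) - g (Complex a L)) (at x)" for x
    proof -
      have "((\<lambda>x. of_real x * g (Complex a L)) has_vector_derivative g (Complex a L)) (at x)"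
        by (auto intro!: derivative_eq_intros)
      then show ?thesis unfolding R_def P_def complex.sel
        using L by (intro has_vector_derivative_diff primitive_deriv_horizontal B field_deriv) auto
    qed
    have "a < a + L" using L by simp
    then have "norm (R (a + L) - R a) \<le> d * (a + L) - d * a"
    proof (rule differentiable_bound_general[where \<phi>' = "\<lambda>x. d"])
      show "continuous_on {a..a + L} R"
        by (intro continuous_at_imp_continuous_on ballI has_vector_derivative_continuous[OF der])
      show "continuous_on {a..a + L} (\<lambda>x. d * x)" by (intro continuous_intros)
      fix x assume x: "a < x" "x < a + L"
      show "(R has_vector_derivative (g (Complex x L) - \<i> * of_real L * deriv g (Complex x L)) - g (Complex a L)) (at x)"
        by (rule der)
      show "((\<lambda>x. d * x) has_vector_derivative d) (at x)" by (auto intro!: derivative_eq_intros)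
      have "d / 2 * (\<bar>x - a\<bar> / L) \<le> d / 2 * 1" using x L d by (intro mult_left_mono) (auto simp: field_simps)
      then have 1: "norm (g (Complex x L) - g (Complex a L)) \<le> d / 2"
        using order_trans[OF horizontal_bounds(2)[OF L, of x a]] by (simp only: mult_1_right)
      have "d * Q (Complex x L) \<le> d * 1" using d Q_le_1 by (intro mult_left_mono) auto
      then have 2: "norm (\<i> * of_real L * deriv g (Complex x L)) \<le> d / 2"
        using lip[of "Complex x L"] L by (simp add: norm_mult Q_def)
      have eq: "g (Complex x L) - \<i> * of_real L * deriv g (Complex x L) - g (Complex a L) =
        (g (Complex x L) - g (Complex a L)) - \<i> * of_real L * deriv g (Complex x L)" by simp
      show "norm (g (Complex x L) - \<i> * of_real L * deriv g (Complex x L) - g (Complex a L)) \<le> d"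
        unfolding eq using norm_triangle_ineq4[of "g (Complex x L) - g (Complex a L)" "\<i> * of_real L * deriv g (Complex x L)"] 1 2
        by linarith
    qed
    moreover have "R (a + L) - R a = P (Complex (a + L) L) - P (Complex a L) - of_real L * g (Complex a L)"
      by (simp add: R_def algebra_simps)
    moreover have "d * (a + L) - d * a = d * L" by (simp add: distrib_left)
    ultimately show ?thesis by simp
  qed
  define h where "h = 1 / (2::real) ^ N"
  \<comment> \<open>As difference quotients at one common height these average exactly over the two
    children. Comparing with g at height L costs d L along the top edge and (d / 2) (L - h) down
    each side, together at most 2 d L.\<close>
  define F where "F m k = 2 ^ m * (P (Complex (of_int (k + 1) / 2 ^ m) h) - P (Complex (of_int k / 2 ^ m) h))" for m :: nat and k :: int
  have "F m k = (F (Suc m) (2 * k) + F (Suc m) (2 * k + 1)) / 2" for m k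
  proof -
    have 1: "of_int (2 * k + 1 + 1) / 2 ^ Suc m = (of_int (k + 1) / 2 ^ m :: real)"
      "of_int (2 * k) / 2 ^ Suc m = (of_int k / 2 ^ m :: real)" by (simp_all add: field_simps)
    show ?thesis unfolding F_def 1 by (simp add: algebra_simps)
  qed
  moreover have "norm (F m k - g (dpt (m, k))) \<le> 2 * d" if m: "m \<le> N" for m k
  proof -
    define L where "L = 1 / (2::real) ^ m"
    define a where "a = of_int k / (2::real) ^ m"
    have hL: "0 < h" "h \<le> L" using m by (auto simp: h_def L_def field_simps)
    have e: "of_int (k + 1) / 2 ^ m = a + L" "dpt (m, k) = Complex a L"
      by (simp_all add: a_def L_def dpt_def dlen_def add_divide_distrib)
    have L: "0 < L" by (simp add: L_def)
    define X where "X = P (Complex (a + L) h) - P (Complex a h) - of_real L * g (Complex a L)"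
    have "X = (P (Complex (a + L) L) - P (Complex a L) - of_real L * g (Complex a L))
       - (P (Complex (a + L) L) - P (Complex (a + L) h)) + (P (Complex a L) - P (Complex a h))"
      by (simp add: X_def)
    also have "norm \<dots> \<le> (d * L + d / 2 * (L - h)) + d / 2 * (L - h)"
      by (rule order_trans[OF norm_triangle_ineq add_mono[OF order_trans[OF norm_triangle_ineq4
            add_mono[OF hor[OF L] vert[OF hL]]] vert[OF hL]]])
    also have "\<dots> = d * L + d * (L - h)" by simp
    also have "\<dots> \<le> d * L + d * L" using hL d by (intro add_left_mono mult_left_mono) auto
    finally have X: "norm X \<le> 2 * d * L" by (simp add: mult_ac)
    have "F m k - g (dpt (m, k)) = 2 ^ m * X"
      unfolding F_def e X_def a_def[symmetric] by (simp add: L_def algebra_simps)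
    then have "norm (F m k - g (dpt (m, k))) = 2 ^ m * norm X" by (simp add: norm_mult norm_power)
    also have "\<dots> \<le> 2 ^ m * (2 * d * L)" using X by (intro mult_left_mono) auto
    also have "\<dots> = 2 * d" by (simp add: L_def)
    finally show ?thesis .
  qed
  ultimately show ?thesis by blast
qed

text \<open>The maximal inequality is centred at the martingale's own value over I. The increments
  are at most 6 d, three differences of size 2 d, and passing between the martingale and g costs 2 d
  at A and again at I.\<close>

lemma survivors:
  assumes s0: "0 < s0"
  shows "\<exists>S. finite S \<and> (\<forall>K\<in>S. fst K = fst I + n \<and> K \<sqsubseteq> I \<and>
       (\<forall>A. K \<sqsubseteq> A \<and> A \<sqsubseteq> I \<longrightarrow> norm (g (dpt A)) \<le> norm (g (dpt I)) + s0 + 4 * d)) \<and>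
     s0\<^sup>2 * (dlen I - (\<Sum>K\<in>S. dlen K)) \<le> dlen I * ((6 * d)\<^sup>2 * real n)"
proof -
  obtain m k where I: "I = (m, k)" by (cases I)
  obtain F where "(\<forall>i j. F i j = (F (Suc i) (2 * j) + F (Suc i) (2 * j + 1)) / 2) \<and>
      (\<forall>i\<le>m + n. \<forall>j. norm (F i j - g (dpt (i, j))) \<le> 2 * d)"
    using boundary_martingale[of "m + n"] by blast
  then have F: "F i j = (F (Suc i) (2 * j) + F (Suc i) (2 * j + 1)) / 2"
    and Fg: "i \<le> m + n \<Longrightarrow> norm (F i j - g (dpt (i, j))) \<le> 2 * d" for i j
    by blast+
  have inc: "norm (F (Suc i) (2 * j) - F i j) \<le> 6 * d" if "i < m + n" for i j
  proof -
    have "norm (g (dpt (Suc i, 2 * j)) - g (dpt (i, j))) \<le> 2 * d"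
      by (rule near(3)) (auto simp: dlen_def field_simps)
    moreover have "F (Suc i) (2 * j) - F i j = (F (Suc i) (2 * j) - g (dpt (Suc i, 2 * j))) +
      (g (dpt (Suc i, 2 * j)) - g (dpt (i, j))) - (F i j - g (dpt (i, j)))" by simp
    moreover have "norm (F (Suc i) (2 * j) - g (dpt (Suc i, 2 * j))) \<le> 2 * d" "norm (F i j - g (dpt (i, j))) \<le> 2 * d"
      using Fg[of "Suc i" "2 * j"] Fg[of i j] that by auto
    moreover have "norm (x + y - z) \<le> 2 * d + 2 * d + 2 * d"
      if "norm y \<le> 2 * d" "norm x \<le> 2 * d" "norm z \<le> 2 * d" for x y z :: complex
      by (rule order_trans[OF norm_triangle_ineq4 add_mono[OF order_trans[OF norm_triangle_ineq add_mono]]]) (use that in auto)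
    ultimately have "norm (F (Suc i) (2 * j) - F i j) \<le> 2 * d + 2 * d + 2 * d" by metis
    then show ?thesis by simp
  qed
  obtain S where SS: "finite S \<and> (\<forall>K\<in>S. fst K = m + n \<and> K \<sqsubseteq> (m, k) \<and>
       (\<forall>A. K \<sqsubseteq> A \<and> A \<sqsubseteq> (m, k) \<longrightarrow> norm (F (fst A) (snd A) - F m k) < s0)) \<and>
     s0\<^sup>2 * (dlen (m, k) - (\<Sum>K\<in>S. dlen K)) \<le> dlen (m, k) * ((norm (F m k - F m k))\<^sup>2 + (6 * d)\<^sup>2 * real n)"
    using martingale_survivors[where F = F and w = "F m k" and e = "6 * d" and N = "m + n" and m = m and n = n and k = k,
        OF F inc s0 order_refl] by (rule exE)
  have S: "finite S" "\<And>K. K \<in> S \<Longrightarrow> fst K = m + n \<and> K \<sqsubseteq> (m, k) \<and>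
       (\<forall>A. K \<sqsubseteq> A \<and> A \<sqsubseteq> (m, k) \<longrightarrow> norm (F (fst A) (snd A) - F m k) < s0)"
     "s0\<^sup>2 * (dlen (m, k) - (\<Sum>K\<in>S. dlen K)) \<le> dlen (m, k) * ((6 * d)\<^sup>2 * real n)"
    using SS by simp_all
  show ?thesis
  proof (intro exI[of _ S] conjI ballI allI impI)
    fix K assume K: "K \<in> S"
    show "fst K = fst I + n" "K \<sqsubseteq> I" using S(2)[OF K] by (auto simp: I)
    fix A assume A: "K \<sqsubseteq> A \<and> A \<sqsubseteq> I"
    have "fst A \<le> m + n" using A S(2)[OF K] by (auto simp: dsub_def)
    then have 1: "norm (F (fst A) (snd A) - g (dpt A)) \<le> 2 * d" using Fg[of "fst A" "snd A"] by simp
    have 2: "norm (F (fst A) (snd A) - F m k) < s0" using A S(2)[OF K] I by blast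
    have 3: "norm (F m k - g (dpt I)) \<le> 2 * d" using Fg[of m k] by (simp add: I)
    show "norm (g (dpt A)) \<le> norm (g (dpt I)) + s0 + 4 * d"
      using 1 2 3 norm_triangle_ineq2[of "g (dpt A)" "F (fst A) (snd A)"]
        norm_triangle_ineq2[of "F (fst A) (snd A)" "F m k"] norm_triangle_ineq2[of "F m k" "g (dpt I)"]
        norm_minus_commute[of "g (dpt A)" "F (fst A) (snd A)"] by linarith
  qed (use S(1,3) in \<open>simp_all add: I\<close>)
qed

end

lemma returns_nonempty:
  assumes "returns g \<delta> t K c F" "0 < c"
  shows "\<exists>J. J \<sqsubseteq> K \<and> norm (g (dpt J)) \<le> \<delta>"
proof -
  have "0 < c * dlen K" using assms(2) by simp
  then have "F \<noteq> {}" using assms(1) by (auto simp: returns_def)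
  then show ?thesis using assms(1) by (auto simp: returns_def)
qed

text \<open>The hypothesis of \<open>cover_descent\<close> for a single I, with good meaning |g| <=
  \<delta>. Of the two upper bounds on w the first is the price of J itself, the second prevents
  weight from concentrating in sets between J and I.\<close>

definition branching :: "(complex \<Rightarrow> complex) \<Rightarrow> real \<Rightarrow> real \<Rightarrow> real \<Rightarrow> real \<Rightarrow> nat \<times> int \<Rightarrow> bool" where
  "branching g \<sigma> \<delta> t C I \<longleftrightarrow> (\<exists>F w. finite F \<and> dantichain F \<and>
        (\<forall>J\<in>F. J \<sqsubseteq> I \<and> J \<noteq> I \<and> norm (g (dpt J)) \<le> \<delta> \<and>
           (\<forall>A. J \<sqsubseteq> A \<and> A \<sqsubseteq> I \<longrightarrow> norm (g (dpt A)) \<le> t) \<and> 0 \<le> w J \<and>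
           w J \<le> dlen J powr \<sigma> \<and> w J \<le> C * dlen J * dlen I powr (\<sigma> - 1)) \<and>
        dlen I powr \<sigma> \<le> sum w F)"

text \<open>All members returned from one K get the same density \<open>\<omega> K\<close> per unit
  of length. \<open>om1\<close> is where the shortness of returns enters; \<open>tot\<close>
  balances the density against the proportion \<open>c K\<close> that returns.\<close>

lemma branching_combine:
  assumes S: "finite S" and n: "0 < n"
    and K1: "\<And>K. K \<in> S \<Longrightarrow> fst K = fst I + n" and K2: "\<And>K. K \<in> S \<Longrightarrow> K \<sqsubseteq> I"
    and path: "\<And>K A. K \<in> S \<Longrightarrow> K \<sqsubseteq> A \<Longrightarrow> A \<sqsubseteq> I \<Longrightarrow> norm (g (dpt A)) \<le> t"
    and rtn: "\<And>K. K \<in> S \<Longrightarrow> returns g \<delta> t K (c K) (FF K)"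
    and om0: "\<And>K. K \<in> S \<Longrightarrow> 0 \<le> \<omega> K"
    and om1: "\<And>K J. K \<in> S \<Longrightarrow> J \<sqsubseteq> K \<Longrightarrow> norm (g (dpt J)) \<le> \<delta> \<Longrightarrow> \<omega> K * dlen J \<le> dlen J powr \<sigma>"
    and om2: "\<And>K. K \<in> S \<Longrightarrow> \<omega> K \<le> C * dlen I powr (\<sigma> - 1)"
    and tot: "dlen I powr \<sigma> \<le> (\<Sum>K\<in>S. \<omega> K * (c K * dlen K))"
  shows "branching g \<sigma> \<delta> t C I"
proof -
  \<comment> \<open>The weight has to be a function of J alone; this recovers the K from which J was
    returned.\<close>
  define anc where "anc J = (fst I + n, snd J div 2 ^ (fst J - (fst I + n)))" for J :: "nat \<times> int"
  have anc: "anc J = K" if "K \<in> S" "J \<sqsubseteq> K" for J K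
    using that K1[OF that(1)] by (auto simp: anc_def dsub_def prod_eq_iff)
  have FK: "finite (FF K)" "dantichain (FF K)" "c K * dlen K \<le> (\<Sum>J\<in>FF K. dlen J)" if "K \<in> S" for K
    using rtn[OF that] by (auto simp: returns_def)
  have FJ: "J \<sqsubseteq> K" "norm (g (dpt J)) \<le> \<delta>" "\<And>A. J \<sqsubseteq> A \<Longrightarrow> A \<sqsubseteq> K \<Longrightarrow> norm (g (dpt A)) \<le> t"
    if "K \<in> S" "J \<in> FF K" for K J
    using rtn[OF that(1)] that(2) unfolding returns_def by blast+
  define F where "F = (\<Union>K\<in>S. FF K)"
  define w where "w J = \<omega> (anc J) * dlen J" for J
  show ?thesis
    unfolding branching_def
  proof (intro exI[of _ F] exI[of _ w] conjI ballI)
    show "finite F" using S FK(1) by (auto simp: F_def)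
    show "dantichain F" unfolding F_def by (rule dantichain_UN[OF K1 FK(2) FJ(1)])
    have "(\<Sum>K\<in>S. \<omega> K * (c K * dlen K)) \<le> (\<Sum>K\<in>S. \<omega> K * (\<Sum>J\<in>FF K. dlen J))"
      by (intro sum_mono mult_left_mono FK(3) om0)
    also have "\<dots> = (\<Sum>K\<in>S. \<Sum>J\<in>FF K. w J)"
      unfolding sum_distrib_left w_def by (intro sum.cong refl) (simp add: anc[OF _ FJ(1)])
    also have "\<dots> = sum w F"
      unfolding F_def by (rule sum_UN_families[OF S K1 FK(1) FJ(1), symmetric])
    finally show "dlen I powr \<sigma> \<le> sum w F" using tot by simp
    fix J assume "J \<in> F"
    then obtain K where K: "K \<in> S" "J \<in> FF K" by (auto simp: F_def)
    note J = FJ[OF K]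
    have wJ: "w J = \<omega> K * dlen J" using anc[OF K(1) J(1)] by (simp add: w_def)
    show "J \<sqsubseteq> I" by (rule dsub_trans[OF J(1) K2[OF K(1)]])
    have "fst K \<le> fst J" using J(1) by (simp add: dsub_def)
    then show "J \<noteq> I" using K1[OF K(1)] n by auto
    show "norm (g (dpt J)) \<le> \<delta>" by (rule J(2))
    show "0 \<le> w J" unfolding wJ using om0[OF K(1)] by (simp add: less_imp_le)
    show "w J \<le> dlen J powr \<sigma>" unfolding wJ by (rule om1[OF K(1) J(1,2)])
    have "\<omega> K * dlen J \<le> C * dlen I powr (\<sigma> - 1) * dlen J"
      using om2[OF K(1)] by (rule mult_right_mono) (simp add: less_imp_le)
    then show "w J \<le> C * dlen J * dlen I powr (\<sigma> - 1)" unfolding wJ by (simp add: mult_ac)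
    show "\<forall>A. J \<sqsubseteq> A \<and> A \<sqsubseteq> I \<longrightarrow> norm (g (dpt A)) \<le> t"
    proof (intro allI impI)
      fix A assume A: "J \<sqsubseteq> A \<and> A \<sqsubseteq> I"
      then have "A \<sqsubseteq> K \<or> K \<sqsubseteq> A" using dsub_comparable[OF _ J(1), of A] by blast
      then show "norm (g (dpt A)) \<le> t" using J(3)[of A] path[OF K(1), of A] A by blast
    qed
  qed
qed

lemma dlen_descendant: "fst K = fst I + n \<Longrightarrow> dlen K = dlen I / 2 ^ n"
  by (simp add: dlen_def power_add)

text \<open>Half of the descendants after n generations survive the martingale and a proportion p of
  each returns, so a gain of 2 / p in \<open>2 powr (real n * d)\<close> suffices. With n of order b
  / d the variance 36 d^2 n is of order b d and hence small.\<close>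

lemma branching_small:
  fixes t0 :: real assumes t0: "0 < t0" "t0 < 1"
  shows "\<exists>D0>0. \<forall>g d. hyp_lipschitz g d \<longrightarrow> d \<le> D0 \<longrightarrow>
    (\<exists>C\<ge>1. \<forall>I. norm (g (dpt I)) \<le> t0 / 16 \<longrightarrow> unimodular_boundary g (dcl I) \<longrightarrow> branching g (1 - d) (t0 / 16) (t0 / 2) C I)"
proof -
  obtain D1 p where D1: "0 < D1" "0 < p" and R: "\<And>g d K. hyp_lipschitz g d \<Longrightarrow> d \<le> D1 \<Longrightarrow>
      unimodular_boundary g (dcl K) \<Longrightarrow> norm (g (dpt K)) \<le> t0 / 4 \<Longrightarrow> \<exists>F. returns g (t0 / 16) (t0 / 2) K p F"
    using return_small[of "t0 / 16" "t0 / 4" "t0 / 2"] t0 by auto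
  define b where "b = max 1 (log 2 (2 / p))"
  define s0 where "s0 = t0 / 16"
  have b: "1 \<le> b" "2 / p \<le> 2 powr b"
  proof -
    have "2 / p = 2 powr (log 2 (2 / p))" using D1 by simp
    also have "\<dots> \<le> 2 powr b" by (intro powr_mono) (auto simp: b_def)
    finally show "2 / p \<le> 2 powr b" .
  qed (simp add: b_def)
  have s0: "0 < s0" using t0 by (simp add: s0_def)
  \<comment> \<open>t0 / 32 makes t0 / 16 + s0 + 4 d at most t0 / 4; the last bound makes the
    variance 36 d^2 n <= 72 b d at most s0^2 / 2.\<close>
  define D0 where "D0 = min D1 (min (t0 / 32) (s0\<^sup>2 / (144 * b)))"
  have D0: "0 < D0" using D1 t0 s0 b by (simp add: D0_def)
  have "\<exists>C\<ge>1. \<forall>I. norm (g (dpt I)) \<le> t0 / 16 \<longrightarrow> unimodular_boundary g (dcl I) \<longrightarrow> branching g (1 - d) (t0 / 16) (t0 / 2) C I"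
    if hl: "hyp_lipschitz g d" and dD: "d \<le> D0" for g d
  proof -
    interpret hyp_lipschitz g d by (rule hl)
    have dd: "d \<le> D1" "d \<le> t0 / 32" "d \<le> s0\<^sup>2 / (144 * b)" using dD by (auto simp: D0_def)
    define n where "n = nat \<lceil>b / d\<rceil>"
    have bd: "1 \<le> b / d" using b d by simp
    have n: "b / d \<le> real n" "real n \<le> 2 * (b / d)" "0 < n"
    proof -
      show "b / d \<le> real n" unfolding n_def by (rule real_nat_ceiling_ge)
      have "real n \<le> b / d + 1" unfolding n_def using bd by (simp add: of_nat_nat)
      then show "real n \<le> 2 * (b / d)" using bd by simp
      show "0 < n" using bd unfolding n_def by (simp add: less_ceiling_iff)
    qed
    have "b \<le> real n * d" using n(1) d by (simp add: field_simps)
    then have "2 powr b \<le> 2 powr (real n * d)" by (intro powr_mono) auto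
    then have "2 / p \<le> 2 powr (real n * d)" using b(2) by (rule order_trans[rotated])
    then have gain: "2 \<le> 2 powr (real n * d) * p" using D1 by (simp only: pos_divide_le_eq)
    have var: "(6 * d)\<^sup>2 * real n \<le> s0\<^sup>2 / 2"
    proof -
      have "(6 * d)\<^sup>2 * real n \<le> (6 * d)\<^sup>2 * (2 * (b / d))" using n(2) by (intro mult_left_mono) auto
      also have "\<dots> = 72 * b * d" using d by (simp add: power2_eq_square)
      also have "\<dots> \<le> 72 * b * (s0\<^sup>2 / (144 * b))" using dd(3) b by (intro mult_left_mono) auto
      also have "\<dots> = s0\<^sup>2 / 2" using b by simp
      finally show ?thesis .
    qed
    have "branching g (1 - d) (t0 / 16) (t0 / 2) (2 powr (real n * d)) I"
      if I: "norm (g (dpt I)) \<le> t0 / 16" and bdry: "unimodular_boundary g (dcl I)" for I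
    proof -
      obtain S where S: "finite S" and SK: "\<And>K. K \<in> S \<Longrightarrow> fst K = fst I + n" "\<And>K. K \<in> S \<Longrightarrow> K \<sqsubseteq> I"
         "\<And>K A. K \<in> S \<Longrightarrow> K \<sqsubseteq> A \<Longrightarrow> A \<sqsubseteq> I \<Longrightarrow> norm (g (dpt A)) \<le> norm (g (dpt I)) + s0 + 4 * d"
         and mass: "s0\<^sup>2 * (dlen I - (\<Sum>K\<in>S. dlen K)) \<le> dlen I * ((6 * d)\<^sup>2 * real n)"
        using survivors[OF s0, of I n] by blast
      have path: "norm (g (dpt A)) \<le> t0 / 4" if "K \<in> S" "K \<sqsubseteq> A" "A \<sqsubseteq> I" for K A
        using SK(3)[OF that] I dd(2) by (simp add: s0_def)
      have "\<exists>F. returns g (t0 / 16) (t0 / 2) K p F" if "K \<in> S" for K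
        by (rule R[OF hl dd(1) unimodular_boundary_subset[OF bdry dcl_mono[OF SK(2)[OF that]]] path[OF that dsub_refl SK(2)[OF that]]])
      then obtain FF where FF: "\<And>K. K \<in> S \<Longrightarrow> returns g (t0 / 16) (t0 / 2) K p (FF K)" by metis
      \<comment> \<open>This is |K| to the power -d for each K in S; any J inside K is at most as
        long, so the density is admissible whatever the length of the return.\<close>
      define om where "om = 2 powr (real n * d) * dlen I powr (- d)"
      show ?thesis
      proof (rule branching_combine[OF S n(3) SK(1,2) _ FF, where \<omega> = "\<lambda>K. om"])
        show "norm (g (dpt A)) \<le> t0 / 2" if "K \<in> S" "K \<sqsubseteq> A" "A \<sqsubseteq> I" for K A
          using path[OF that] t0 by simp
        show "0 \<le> om" by (simp add: om_def)
        show "om \<le> 2 powr (real n * d) * dlen I powr (1 - d - 1)" by (simp add: om_def)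
        show "om * dlen J \<le> dlen J powr (1 - d)" if "K \<in> S" "J \<sqsubseteq> K" for K J
        proof -
          have le: "dlen J \<le> dlen I / 2 ^ n" using dlen_mono[OF that(2)] dlen_descendant[OF SK(1)[OF that(1)]] by simp
          have "om = (dlen I / 2 ^ n) powr (- d)"
            by (simp add: om_def powr_divide powr_realpow[symmetric] powr_powr powr_minus less_imp_le field_simps)
          also have "\<dots> \<le> dlen J powr (- d)" using le d by (intro powr_mono2') auto
          finally have "om * dlen J \<le> dlen J powr (- d) * dlen J" by (rule mult_right_mono) (simp add: less_imp_le)
          then show ?thesis by (simp only: dlen_powr_mult)
        qed
        have half: "dlen I / 2 \<le> (\<Sum>K\<in>S. dlen K)"
        proof -
          have "s0\<^sup>2 * (dlen I - (\<Sum>K\<in>S. dlen K)) \<le> dlen I * (s0\<^sup>2 / 2)"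
            using mass var by (meson dlen_pos less_imp_le mult_left_mono order_trans)
          also have "\<dots> = s0\<^sup>2 * (dlen I / 2)" by simp
          finally have "dlen I - (\<Sum>K\<in>S. dlen K) \<le> dlen I / 2" using s0 by (simp only: mult_le_cancel_left_pos zero_less_power)
          then show ?thesis by linarith
        qed
        have "dlen I powr (1 - d) = dlen I powr (- d) * dlen I" by (rule dlen_powr_mult[symmetric])
        also have "\<dots> \<le> dlen I powr (- d) * (2 powr (real n * d) * p * (dlen I / 2))"
          using gain mult_right_mono[OF gain, of "dlen I / 2"] by (intro mult_left_mono) (auto simp: less_imp_le)
        also have "\<dots> = om * p * (dlen I / 2)" by (simp add: om_def)
        also have "\<dots> \<le> om * p * (\<Sum>K\<in>S. dlen K)" using half D1 by (intro mult_left_mono) (auto simp: om_def)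
        also have "\<dots> = (\<Sum>K\<in>S. om * (p * dlen K))" by (simp add: sum_distrib_left mult_ac)
        finally show "dlen I powr (1 - d) \<le> (\<Sum>K\<in>S. om * (p * dlen K))" .
      qed
    qed
    moreover have "1 \<le> 2 powr (real n * d)" using d by (simp add: ge_one_powr_ge_zero)
    ultimately show ?thesis by blast
  qed
  then show ?thesis using D0 by blast
qed

text \<open>n depends on D alone because d >= D / 2. The density is inversely proportional to Q
  above K: a return from K to a good J satisfies |J|^d <= (3 Q / \<kappa>) |K|^d, and the proportion
  returned is c0 Q, so Q cancels in the total and a gain of 3 / (\<kappa> c0) suffices.\<close>

lemma branching_large:
  fixes D :: real assumes D: "0 < D" "D < 1"
  shows "\<exists>\<delta> t. 0 < \<delta> \<and> \<delta> \<le> t \<and> t < 1 \<and> (\<forall>g d. hyp_lipschitz g d \<longrightarrow> D / 2 \<le> d \<longrightarrow> d \<le> D \<longrightarrow>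
    (\<exists>C\<ge>1. \<forall>I. norm (g (dpt I)) \<le> \<delta> \<longrightarrow> unimodular_boundary g (dcl I) \<longrightarrow> branching g (1 - d) \<delta> t C I) \<and>
    (\<forall>K. unimodular_boundary g (dcl K) \<longrightarrow> (\<exists>J. J \<sqsubseteq> K \<and> norm (g (dpt J)) \<le> \<delta>)))"
proof -
  obtain \<delta> c0 where \<delta>: "0 < \<delta>" "\<delta> < 1" and c0: "0 < c0" and RL: "\<And>q. 0 < q \<Longrightarrow> \<exists>t. \<delta> < t \<and> t < 1 \<and>
    (\<forall>g d K. hyp_lipschitz g d \<longrightarrow> d \<le> D \<longrightarrow> unimodular_boundary g (dcl K) \<longrightarrow>
      q \<le> 1 - (norm (g (dpt K)))\<^sup>2 \<longrightarrow> (\<exists>F. returns g \<delta> t K (c0 * (1 - (norm (g (dpt K)))\<^sup>2)) F))"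
    using return_large[OF D] by blast
  define \<kappa> where "\<kappa> = 1 - \<delta>\<^sup>2"
  have \<kappa>: "0 < \<kappa>" "\<kappa> < 1" using \<delta> by (auto simp: \<kappa>_def power_less_one_iff abs_square_less_1)
  define n where "n = Suc (nat \<lceil>log 2 (3 / (\<kappa> * c0)) / (D / 2)\<rceil>)"
  have n: "0 < n" by (simp add: n_def)
  have gain0: "3 / (\<kappa> * c0) \<le> 2 powr (real n * (D / 2))"
  proof -
    have "log 2 (3 / (\<kappa> * c0)) / (D / 2) \<le> real n"
      unfolding n_def using real_nat_ceiling_ge[of "log 2 (3 / (\<kappa> * c0)) / (D / 2)"] by simp
    then have "log 2 (3 / (\<kappa> * c0)) \<le> real n * (D / 2)" using D by (simp add: field_simps)
    then have "2 powr log 2 (3 / (\<kappa> * c0)) \<le> 2 powr (real n * (D / 2))" by (intro powr_mono) auto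
    then show ?thesis using \<kappa> c0 by simp
  qed
  \<comment> \<open>A lower bound for Q up to n generations below a good interval, from
    \<open>Q_dsub\<close> and \<open>2 powr (real n * d)\<close> <= \<open>2 ^ n\<close>.\<close>
  define q where "q = \<kappa> / (3 * 2 ^ n)"
  have q: "0 < q" "q < 1"
  proof -
    show "0 < q" using \<kappa> by (simp add: q_def)
    have "(1::real) \<le> 2 ^ n" by simp
    then have "\<kappa> < 3 * 2 ^ n" using \<kappa> by linarith
    then show "q < 1" by (simp add: q_def)
  qed
  obtain t1 where t1: "\<delta> < t1" "t1 < 1" and R: "\<And>g d K. hyp_lipschitz g d \<Longrightarrow> d \<le> D \<Longrightarrow>
      unimodular_boundary g (dcl K) \<Longrightarrow> q \<le> 1 - (norm (g (dpt K)))\<^sup>2 \<Longrightarrow>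
      \<exists>F. returns g \<delta> t1 K (c0 * (1 - (norm (g (dpt K)))\<^sup>2)) F"
    using RL[OF q(1)] by blast
  define t where "t = max t1 (sqrt (1 - q))"
  have t: "\<delta> \<le> t" "t < 1" using t1 q by (auto simp: t_def)
  have "\<exists>C\<ge>1. \<forall>I. norm (g (dpt I)) \<le> \<delta> \<longrightarrow> unimodular_boundary g (dcl I) \<longrightarrow> branching g (1 - d) \<delta> t C I"
    if hl: "hyp_lipschitz g d" and dD: "D / 2 \<le> d" "d \<le> D" for g d
  proof -
    interpret hyp_lipschitz g d by (rule hl)
    have p2n: "2 powr (real n * d) \<le> 2 ^ n"
      using d powr_mono[of "real n * d" "real n" 2] by (simp add: powr_realpow mult_left_le)
    have "2 powr (real n * (D / 2)) \<le> 2 powr (real n * d)" using dD by (intro powr_mono mult_left_mono) auto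
    then have "3 / (\<kappa> * c0) \<le> 2 powr (real n * d)" using gain0 by (rule order_trans[rotated])
    then have gain: "1 \<le> 2 powr (real n * d) * (\<kappa> * c0 / 3)"
      using \<kappa> c0 by (simp add: pos_divide_le_eq)
    have goodQ: "\<kappa> \<le> Q z" if "norm (g z) \<le> \<delta>" for z
      using power_mono[OF that, of 2] by (simp add: \<kappa>_def Q_def)
    have "branching g (1 - d) \<delta> t (2 ^ n * 2 ^ n) I"
      if I: "norm (g (dpt I)) \<le> \<delta>" and bdry: "unimodular_boundary g (dcl I)" for I
    proof -
      have Qanc: "q \<le> Q (dpt A)" if A: "A \<sqsubseteq> I" "fst A \<le> fst I + n" for A
      proof -
        have "dlen I / dlen A \<le> 2 ^ n"
        proof -
          have "fst I \<le> fst A" using A(1) by (simp add: dsub_def)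
          then have "dlen I / dlen A = 2 ^ (fst A - fst I)" by (simp add: dlen_def power_diff)
          also have "\<dots> \<le> 2 ^ n" using A(2) by (intro power_increasing) auto
          finally show ?thesis .
        qed
        then have "(dlen I / dlen A) powr d \<le> (2 ^ n) powr d" using d by (intro powr_mono2) (auto simp: less_imp_le)
        also have "\<dots> = 2 powr (real n * d)" by (simp add: powr_realpow[symmetric] powr_powr)
        also note p2n
        finally have "3 * (dlen I / dlen A) powr d * Q (dpt A) \<le> 3 * 2 ^ n * Q (dpt A)"
          using Q_pos[of "dpt A"] by (intro mult_right_mono) auto
        then have "\<kappa> \<le> 3 * 2 ^ n * Q (dpt A)" using Q_dsub(2)[OF A(1)] goodQ[OF I] by linarith
        then show ?thesis by (simp add: q_def field_simps)
      qed
      define S where "S = (\<lambda>i. (fst I + n, snd I * 2 ^ n + int i)) ` {..<2 ^ n}"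
      have cardS: "card S = 2 ^ n" unfolding S_def by (subst card_image) (auto simp: inj_on_def)
      have SK: "fst K = fst I + n" "K \<sqsubseteq> I" if "K \<in> S" for K
      proof -
        obtain i where i: "i < 2 ^ n" "K = (fst I + n, snd I * 2 ^ n + int i)" using \<open>K \<in> S\<close> by (auto simp: S_def)
        have "int i < 2 ^ n" using i(1) by (metis of_nat_less_iff of_nat_numeral of_nat_power)
        then have "(snd I * 2 ^ n + int i) div 2 ^ n = snd I" by simp
        then show "fst K = fst I + n" "K \<sqsubseteq> I" using i by (auto simp: dsub_def)
      qed
      have QK: "q \<le> Q (dpt K)" if "K \<in> S" for K using Qanc[OF SK(2)[OF that]] SK(1)[OF that] by simp
      have "\<exists>F. returns g \<delta> t1 K (c0 * Q (dpt K)) F" if "K \<in> S" for K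
        using R[OF hl dD(2) unimodular_boundary_subset[OF bdry dcl_mono[OF SK(2)[OF that]]]] QK[OF that]
        by (simp add: Q_def)
      then have "\<exists>F. returns g \<delta> t K (c0 * Q (dpt K)) F" if "K \<in> S" for K
        using returns_mono[of g \<delta> t1 K _ _ t] that by (fastforce simp: t_def)
      then obtain FF where FF: "\<And>K. K \<in> S \<Longrightarrow> returns g \<delta> t K (c0 * Q (dpt K)) (FF K)" by metis
      define om where "om K = \<kappa> / (3 * Q (dpt K)) * dlen K powr (- d)" for K
      have "finite S" by (simp add: S_def)
      show ?thesis
      proof (rule branching_combine[OF \<open>finite S\<close> n SK _ FF, where \<omega> = om])
        fix K assume K: "K \<in> S"
        have Qp: "0 < Q (dpt K)" by (rule Q_pos) simp
        show "norm (g (dpt A)) \<le> t" if "K \<sqsubseteq> A" "A \<sqsubseteq> I" for A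
        proof -
          have "fst A \<le> fst I + n" using that(1) SK(1)[OF K] by (simp add: dsub_def)
          then have "q \<le> Q (dpt A)" using Qanc[OF that(2)] by simp
          then have "norm (g (dpt A)) \<le> sqrt (1 - q)" using le_sqrt_iff[of "norm (g (dpt A))" q] by (simp add: Q_def)
          then show ?thesis by (simp add: t_def)
        qed
        show "0 \<le> om K" using \<kappa> Qp by (simp add: om_def)
        show "om K * dlen J \<le> dlen J powr (1 - d)" if J: "J \<sqsubseteq> K" "norm (g (dpt J)) \<le> \<delta>" for J
        proof -
          have "\<kappa> \<le> 3 * (dlen K / dlen J) powr d * Q (dpt K)" using goodQ[OF J(2)] Q_dsub(1)[OF J(1)] by linarith
          then have "\<kappa> / (3 * Q (dpt K)) \<le> (dlen K / dlen J) powr d" using Qp by (simp add: field_simps)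
          then have "om K \<le> (dlen K / dlen J) powr d * dlen K powr (- d)"
            unfolding om_def by (rule mult_right_mono) simp
          also have "\<dots> = dlen J powr (- d)"
            using dlen_pos[of K] by (simp add: powr_divide powr_minus less_imp_le field_simps del: dlen_pos)
          finally have "om K * dlen J \<le> dlen J powr (- d) * dlen J" by (rule mult_right_mono) (simp add: less_imp_le)
          then show ?thesis by (simp only: dlen_powr_mult)
        qed
        have lenK: "dlen K powr (- d) = 2 powr (real n * d) * dlen I powr (- d)"
          unfolding dlen_descendant[OF SK(1)[OF K]]
          by (simp add: powr_divide powr_realpow[symmetric] powr_powr powr_minus less_imp_le field_simps)
        have "\<kappa> / (3 * Q (dpt K)) \<le> \<kappa> / (3 * q)" using QK[OF K] q \<kappa> by (intro divide_left_mono) auto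
        also have "\<dots> = 2 ^ n" using \<kappa> by (simp add: q_def)
        finally have "om K \<le> 2 ^ n * (2 ^ n * dlen I powr (- d))"
          unfolding om_def lenK using p2n \<kappa> Qp by (intro mult_mono mult_right_mono) auto
        then show "om K \<le> 2 ^ n * 2 ^ n * dlen I powr (1 - d - 1)" by simp
      next
        have trm: "om K * (c0 * Q (dpt K) * dlen K) = \<kappa> * c0 / 3 * (2 powr (real n * d) * dlen I powr (- d)) * (dlen I / 2 ^ n)"
          if K: "K \<in> S" for K
        proof -
          have Qp: "0 < Q (dpt K)" by (rule Q_pos) simp
          have lenK: "dlen K powr (- d) = 2 powr (real n * d) * dlen I powr (- d)"
            unfolding dlen_descendant[OF SK(1)[OF K]]
            by (simp add: powr_divide powr_realpow[symmetric] powr_powr powr_minus less_imp_le field_simps)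
          show ?thesis unfolding om_def lenK unfolding dlen_descendant[OF SK(1)[OF K]] using Qp by simp
        qed
        have "dlen I powr (1 - d) = dlen I powr (- d) * dlen I" by (rule dlen_powr_mult[symmetric])
        also have "\<dots> \<le> 2 powr (real n * d) * (\<kappa> * c0 / 3) * (dlen I powr (- d) * dlen I)"
          using mult_right_mono[OF gain, of "dlen I powr (- d) * dlen I"] by (simp add: less_imp_le)
        also have "\<dots> = real (card S) * (\<kappa> * c0 / 3 * (2 powr (real n * d) * dlen I powr (- d)) * (dlen I / 2 ^ n))"
          by (simp add: cardS)
        also have "\<dots> = (\<Sum>K\<in>S. om K * (c0 * Q (dpt K) * dlen K))" by (simp add: trm)
        finally show "dlen I powr (1 - d) \<le> (\<Sum>K\<in>S. om K * (c0 * Q (dpt K) * dlen K))" .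
      qed
    qed
    moreover have "(1::real) \<le> 2 ^ n * 2 ^ n" by (simp add: power_add[symmetric])
    ultimately show ?thesis by blast
  qed
  moreover have "\<exists>J. J \<sqsubseteq> K \<and> norm (g (dpt J)) \<le> \<delta>"
    if hl: "hyp_lipschitz g d" and dD: "d \<le> D" and bdry: "unimodular_boundary g (dcl K)" for g d K
  proof -
    interpret hyp_lipschitz g d by (rule hl)
    have "0 < Q (dpt K)" by (rule Q_pos) simp
    then obtain s F where "returns g \<delta> s K (c0 * Q (dpt K)) F"
      using RL[of "Q (dpt K)"] hl dD bdry unfolding Q_def by blast
    then show ?thesis by (rule returns_nonempty) (use c0 \<open>0 < Q (dpt K)\<close> in simp)
  qed
  ultimately show ?thesis using \<delta>(1) t by blast
qed

text \<open>\<open>return_large\<close> leads from any K to the fixed level \<delta>L belonging to D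
  = 1 / 2, and \<open>return_small\<close> from there to the prescribed level.\<close>

lemma reach_small:
  fixes \<delta> :: real assumes \<delta>: "0 < \<delta>" "\<delta> < 1"
  shows "\<exists>D0>0. \<forall>g d K. hyp_lipschitz g d \<longrightarrow> d \<le> D0 \<longrightarrow> unimodular_boundary g (dcl K) \<longrightarrow>
    (\<exists>J. J \<sqsubseteq> K \<and> norm (g (dpt J)) \<le> \<delta>)"
proof -
  obtain \<delta>L c0 where L: "0 < \<delta>L" "\<delta>L < 1" "0 < c0" and RL: "\<And>q. 0 < q \<Longrightarrow> \<exists>t. \<delta>L < t \<and> t < 1 \<and>
    (\<forall>g d K. hyp_lipschitz g d \<longrightarrow> d \<le> 1 / 2 \<longrightarrow> unimodular_boundary g (dcl K) \<longrightarrow>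
      q \<le> 1 - (norm (g (dpt K)))\<^sup>2 \<longrightarrow> (\<exists>F. returns g \<delta>L t K (c0 * (1 - (norm (g (dpt K)))\<^sup>2)) F))"
    using return_large[of "1 / 2"] by auto
  define s where "s = max \<delta> \<delta>L"
  have s: "\<delta> \<le> s" "\<delta>L \<le> s" "s < 1" using \<delta> L by (auto simp: s_def)
  obtain D1 p where D1: "0 < D1" "0 < p" and R: "\<And>g d K. hyp_lipschitz g d \<Longrightarrow> d \<le> D1 \<Longrightarrow>
      unimodular_boundary g (dcl K) \<Longrightarrow> norm (g (dpt K)) \<le> s \<Longrightarrow> \<exists>F. returns g \<delta> ((1 + s) / 2) K p F"
    using return_small[of \<delta> s "(1 + s) / 2"] \<delta> s by auto
  have "\<exists>J. J \<sqsubseteq> K \<and> norm (g (dpt J)) \<le> \<delta>"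
    if hl: "hyp_lipschitz g d" and dD: "d \<le> min D1 (1 / 2)" and bdry: "unimodular_boundary g (dcl K)" for g d K
  proof -
    interpret hyp_lipschitz g d by (rule hl)
    have "0 < Q (dpt K)" by (rule Q_pos) simp
    have "d \<le> 1 / 2" using dD by simp
    then obtain t F where "returns g \<delta>L t K (c0 * Q (dpt K)) F"
      using RL[OF \<open>0 < Q (dpt K)\<close>] hl bdry unfolding Q_def by blast
    then obtain J where J: "J \<sqsubseteq> K" "norm (g (dpt J)) \<le> \<delta>L"
      using L \<open>0 < Q (dpt K)\<close> returns_nonempty[of g \<delta>L t K "c0 * Q (dpt K)" F] by auto
    obtain F' where "returns g \<delta> ((1 + s) / 2) J p F'"
      using R[OF hl _ unimodular_boundary_subset[OF bdry dcl_mono[OF J(1)]]] J(2) s dD by auto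
    then obtain J' where "J' \<sqsubseteq> J" "norm (g (dpt J')) \<le> \<delta>"
      using D1 returns_nonempty by blast
    then show ?thesis using dsub_trans[OF _ J(1)] by blast
  qed
  then show ?thesis using D1 by (intro exI[of _ "min D1 (1 / 2)"]) auto
qed

section \<open>From branching to Hausdorff measure\<close>

lemma norm_cis_diff_ge:
  fixes x y :: real assumes "\<bar>x - y\<bar> \<le> 1" shows "\<bar>x - y\<bar> \<le> 2 * norm (cis x - cis y)"
proof -
  define u where "u = x - y"
  have "cis x - cis y = cis y * (cis u - 1)" by (simp add: u_def algebra_simps cis_mult)
  then have "norm (cis x - cis y) = norm (cis u - 1)" by (simp add: norm_mult)
  also have "\<dots> \<ge> \<bar>sin u\<bar>" using abs_Im_le_cmod[of "cis u - 1"] by simp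
  finally have 1: "\<bar>sin u\<bar> \<le> norm (cis x - cis y)" .
  have "\<bar>sin u - (\<Sum>m<3. sin_coeff m * u ^ m)\<bar> \<le> inverse (fact 3) * \<bar>u\<bar> ^ 3" by (rule Maclaurin_sin_bound)
  moreover have "(\<Sum>m<3. sin_coeff m * u ^ m) = u" by (simp add: sin_coeff_def numeral_3_eq_3)
  moreover have "inverse (fact 3) * \<bar>u\<bar> ^ 3 \<le> \<bar>u\<bar> / 6"
  proof -
    have "\<bar>u\<bar> ^ 3 \<le> \<bar>u\<bar> ^ 1" using assms by (intro power_decreasing) (auto simp: u_def)
    then show ?thesis by (simp add: fact_numeral)
  qed
  ultimately have "6 * \<bar>sin u - u\<bar> \<le> \<bar>u\<bar>" by simp
  moreover have "\<bar>u\<bar> \<le> \<bar>sin u\<bar> + \<bar>sin u - u\<bar>" by linarith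
  moreover have "6 * b \<le> a \<Longrightarrow> a \<le> s + b \<Longrightarrow> 0 \<le> s \<Longrightarrow> a \<le> 2 * s" for a b s :: real by linarith
  ultimately have "\<bar>u\<bar> \<le> 2 * \<bar>sin u\<bar>" by (meson abs_ge_zero)
  then show ?thesis using 1 unfolding u_def by linarith
qed

lemma sum_div_4: "(\<Sum>n<4 * N. c (n div 4)) = 4 * (\<Sum>i<N. c i)" for c :: "nat \<Rightarrow> real"
proof (induction N)
  case (Suc N)
  have "4 * Suc N = Suc (Suc (Suc (Suc (4 * N))))" by simp
  then have "(\<Sum>n<4 * Suc N. c (n div 4)) = (\<Sum>n<4 * N. c (n div 4)) + c (4 * N div 4) + c (Suc (4 * N) div 4) +
     c (Suc (Suc (4 * N)) div 4) + c (Suc (Suc (Suc (4 * N))) div 4)"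
    by (simp only: sum.lessThan_Suc)
  moreover have "Suc (4 * N) div 4 = N" "Suc (Suc (4 * N)) div 4 = N" "Suc (Suc (Suc (4 * N))) div 4 = N" by simp_all
  ultimately show ?case using Suc by simp
qed simp

lemma summable_div_4:
  fixes c :: "nat \<Rightarrow> real" assumes c: "summable c" "\<And>i. 0 \<le> c i"
  shows "summable (\<lambda>n. c (n div 4))" "(\<Sum>n. c (n div 4)) \<le> 4 * (\<Sum>i. c i)"
proof -
  have bound: "(\<Sum>n<N. c (n div 4)) \<le> 4 * (\<Sum>i. c i)" for N
  proof -
    have "(\<Sum>n<N. c (n div 4)) \<le> (\<Sum>n<4 * N. c (n div 4))" by (rule sum_mono2) (auto simp: c)
    also have "\<dots> = 4 * (\<Sum>i<N. c i)" by (rule sum_div_4)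
    also have "\<dots> \<le> 4 * (\<Sum>i. c i)" using c by (intro mult_left_mono sum_le_suminf) auto
    finally show ?thesis .
  qed
  show "summable (\<lambda>n. c (n div 4))" by (rule summableI_nonneg_bounded[OF _ bound]) (rule c)
  then show "(\<Sum>n. c (n div 4)) \<le> 4 * (\<Sum>i. c i)" by (rule suminf_le_const) (rule bound)
qed

lemma powr_add_le:
  fixes x y \<sigma> :: real assumes "0 \<le> x" "0 < y" "0 < \<sigma>" "\<sigma> \<le> 1"
  shows "(4 * x + 2 * y) powr \<sigma> \<le> 8 * (x powr \<sigma> + y powr \<sigma>)"
proof -
  define M where "M = max x y"
  have M: "0 < M" "x \<le> M" "y \<le> M" using assms by (auto simp: M_def)
  have "(4 * x + 2 * y) powr \<sigma> \<le> (8 * M) powr \<sigma>" using M assms by (intro powr_mono2) auto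
  also have "\<dots> = 8 powr \<sigma> * M powr \<sigma>" using M by (simp add: powr_mult)
  also have "\<dots> \<le> 8 powr 1 * M powr \<sigma>" using assms by (intro mult_right_mono powr_mono) auto
  also have "M powr \<sigma> \<le> x powr \<sigma> + y powr \<sigma>" by (auto simp: M_def max_def)
  finally show ?thesis by simp
qed

lemma dyadic_scale:
  fixes \<rho> :: real assumes "0 < \<rho>" "\<rho> \<le> 1"
  shows "\<exists>m. \<rho> \<le> 1 / 2 ^ m \<and> 1 / 2 ^ m \<le> 2 * \<rho>"
proof -
  define m where "m = nat \<lfloor>- log 2 \<rho>\<rfloor>"
  have "log 2 \<rho> \<le> 0" using assms by simp
  then have m: "real m \<le> - log 2 \<rho>" "- log 2 \<rho> < real m + 1" unfolding m_def by linarith+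
  have "2 powr (log 2 \<rho>) \<le> 2 powr (- real m)" using m by (intro powr_mono) auto
  then have 1: "\<rho> \<le> 1 / 2 ^ m" using assms by (simp add: powr_minus powr_realpow divide_inverse)
  have "2 powr (- real m) \<le> 2 powr (1 + log 2 \<rho>)" using m by (intro powr_mono) auto
  then have "1 / 2 ^ m \<le> 2 * \<rho>" using assms by (simp add: powr_minus powr_realpow divide_inverse powr_add)
  then show ?thesis using 1 by blast
qed

text \<open>Covers of E by arbitrary sets become dyadic covers of angles: each set is replaced by
  four neighbouring dyadic intervals of comparable length. The angle that
  \<open>cover_descent\<close> finds has small dyadic intervals around it contained in none of
  these.\<close>

lemma hausdorff_measure_pos:
  fixes \<sigma> C s :: real and \<tau> good :: "nat \<times> int \<Rightarrow> bool" and E :: "complex set"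
  assumes \<sigma>: "0 < \<sigma>" "\<sigma> \<le> 1" and C: "1 \<le> C"
    and step: "\<And>I. good I \<Longrightarrow> \<exists>F w. finite F \<and> dantichain F \<and>
        (\<forall>J\<in>F. J \<sqsubseteq> I \<and> J \<noteq> I \<and> good J \<and> (\<forall>A. J \<sqsubseteq> A \<and> A \<sqsubseteq> I \<longrightarrow> \<tau> A) \<and> 0 \<le> w J \<and>
           w J \<le> dlen J powr \<sigma> \<and> w J \<le> C * dlen J * dlen I powr (\<sigma> - 1)) \<and>
        dlen I powr \<sigma> \<le> sum w F"
    and I0: "good I0"
    and E: "\<And>\<xi>. \<xi> \<in> dcl I0 \<Longrightarrow> (\<And>m. fst I0 \<le> m \<Longrightarrow> \<exists>k. \<xi> \<in> dcl (m, k) \<and> \<tau> (m, k)) \<Longrightarrow> cis \<xi> \<in> E"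
    and s: "0 \<le> s" "s \<le> \<sigma>"
  shows "hausdorff_measure s E \<noteq> 0"
proof
  assume "hausdorff_measure s E = 0"
  \<comment> \<open>Mesh 1 / 8 gives \<open>\<rho> i\<close> <= 2 / 8 + 1 / 2 <= 1, as
    \<open>dyadic_scale\<close> requires.\<close>
  then have "hausdorff_pre s (1 / 8) E \<le> 0"
    unfolding hausdorff_measure_def by (metis SUP_upper greaterThan_iff zero_less_divide_1_iff zero_less_numeral)
  then have pre: "hausdorff_pre s (1 / 8) E = 0" by simp
  \<comment> \<open>100 exceeds 4 * 16: there are four dyadic intervals per set, and one from each
    set costs at most 16 \<epsilon> in total.\<close>
  define \<epsilon> where "\<epsilon> = min 1 (dlen I0 powr \<sigma> / (100 * C))"
  have "0 < dlen I0 powr \<sigma>" using dlen_pos[of I0] by (simp only: powr_gt_zero)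
  then have \<epsilon>: "0 < \<epsilon>" "\<epsilon> \<le> 1" "\<epsilon> \<le> dlen I0 powr \<sigma> / (100 * C)" using C by (auto simp: \<epsilon>_def)
  have "hausdorff_pre s (1 / 8) E < ennreal \<epsilon>" using pre \<epsilon> by simp
  then obtain U where U: "E \<subseteq> (\<Union>i. U i)" "\<And>i. bounded (U i)" "\<And>i. diameter (U i) \<le> 1 / 8"
    and sumU: "(\<Sum>i. ennreal (diameter (U i) powr s)) < ennreal \<epsilon>"
    unfolding hausdorff_pre_def INF_less_iff by blast
  define D where "D i = diameter (U i)" for i
  have D: "0 \<le> D i" "D i \<le> 1 / 8" for i using U(3) diameter_ge_0[OF U(2)] by (auto simp: D_def)
  have "(\<Sum>i. ennreal (D i powr s)) \<noteq> top" using sumU by (auto simp: D_def)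
  then have smD: "summable (\<lambda>i. D i powr s)" by (rule summable_suminf_not_top[rotated]) simp
  have sD: "(\<Sum>i. D i powr s) < \<epsilon>"
  proof -
    have "(\<Sum>i. ennreal (D i powr s)) = ennreal (\<Sum>i. D i powr s)" by (rule suminf_ennreal2[OF _ smD]) simp
    then have "ennreal (\<Sum>i. D i powr s) < ennreal \<epsilon>" using sumU by (simp only: D_def)
    then show ?thesis by (subst (asm) ennreal_less_iff) (auto intro: suminf_nonneg[OF smD])
  qed
  have Ds: "D i powr \<sigma> \<le> D i powr s" for i
    using D[of i] s by (cases "D i = 0") (auto intro!: powr_mono')
  \<comment> \<open>Sets of diameter 0 cost nothing, even for s = 0 because
    \<open>0 powr 0 = 0\<close>, but still need a dyadic interval of positive length; the
    \<sigma>-th powers of these lengths sum to \<epsilon>.\<close>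
  define \<eta> where "\<eta> i = (\<epsilon> * (1 / 2) ^ Suc i) powr (1 / \<sigma>)" for i
  have \<eta>: "0 < \<eta> i" "\<eta> i powr \<sigma> = \<epsilon> * (1 / 2) ^ Suc i" "\<eta> i \<le> 1 / 2" for i
  proof -
    have le: "\<epsilon> * (1 / 2) ^ Suc i \<le> 1 * (1 / 2)"
      using \<epsilon> power_le_one[of "1 / 2 :: real" i] by (intro mult_mono) auto
    show "0 < \<eta> i" "\<eta> i powr \<sigma> = \<epsilon> * (1 / 2) ^ Suc i" using \<epsilon> \<sigma> by (auto simp: \<eta>_def powr_powr)
    have "\<eta> i \<le> (\<epsilon> * (1 / 2) ^ Suc i) powr 1"
      unfolding \<eta>_def using \<epsilon> \<sigma> le by (intro powr_mono') (auto simp: field_simps)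
    then show "\<eta> i \<le> 1 / 2" using le \<epsilon> by simp
  qed
  define \<rho> where "\<rho> i = 2 * D i + \<eta> i" for i
  have "\<exists>m. \<rho> i \<le> 1 / 2 ^ m \<and> 1 / 2 ^ m \<le> 2 * \<rho> i" for i
    by (rule dyadic_scale) (use D[of i] \<eta>(1,3)[of i] in \<open>auto simp: \<rho>_def\<close>)
  then obtain m where m: "\<And>i. \<rho> i \<le> 1 / 2 ^ m i" "\<And>i. 1 / 2 ^ m i \<le> 2 * \<rho> i" by metis
  define c where "c i = (1 / 2 ^ m i) powr \<sigma>" for i
  have c: "c i \<le> 8 * (D i powr s + \<epsilon> * (1 / 2) ^ Suc i)" for i
  proof -
    have "c i \<le> (4 * D i + 2 * \<eta> i) powr \<sigma>"
      unfolding c_def using m(2)[of i] \<sigma> by (intro powr_mono2) (auto simp: \<rho>_def)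
    also have "\<dots> \<le> 8 * (D i powr \<sigma> + \<eta> i powr \<sigma>)" using D[of i] \<eta>(1)[of i] \<sigma> by (intro powr_add_le) auto
    also have "\<dots> \<le> 8 * (D i powr s + \<epsilon> * (1 / 2) ^ Suc i)" using Ds[of i] \<eta>(2)[of i] by simp
    finally show ?thesis .
  qed
  have geo: "(\<lambda>i. \<epsilon> * (1 / 2) ^ Suc i) sums (\<epsilon> * 1)"
    by (intro sums_mult) (rule power_half_series)
  have smR: "summable (\<lambda>i. 8 * (D i powr s + \<epsilon> * (1 / 2) ^ Suc i))"
    by (intro summable_mult summable_add smD sums_summable[OF geo])
  have smc: "summable c"
    by (rule summable_comparison_test'[OF smR, of 0]) (use c in \<open>auto simp: c_def\<close>)
  have "(\<Sum>i. c i) \<le> (\<Sum>i. 8 * (D i powr s + \<epsilon> * (1 / 2) ^ Suc i))" by (intro suminf_le c smc smR)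
  also have "\<dots> = 8 * ((\<Sum>i. D i powr s) + \<epsilon>)"
    using sums_unique[OF sums_mult[OF sums_add[OF summable_sums[OF smD] geo], of 8]] by simp
  also have "\<dots> \<le> 16 * \<epsilon>" using sD by simp
  finally have sc: "(\<Sum>i. c i) \<le> 16 * \<epsilon>" .
  \<comment> \<open>An angle in I0 whose point lies in \<open>U i\<close>; if there is none, the
    value is arbitrary and such an i only adds to the cost.\<close>
  define x where "x i = (SOME x. x \<in> dcl I0 \<and> cis x \<in> U i)" for i
  have x: "x i \<in> dcl I0 \<and> cis (x i) \<in> U i" if "y \<in> dcl I0" "cis y \<in> U i" for y i
    unfolding x_def by (rule someI[of _ y]) (use that in simp)
  \<comment> \<open>With k the index of x at this scale, angles within one interval length of x lie
    in closed intervals of index k - 2 to k + 1; k - 2 occurs because an angle may be a right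
    endpoint.\<close>
  define W where "W n = (m (n div 4), \<lfloor>x (n div 4) * 2 ^ m (n div 4)\<rfloor> - 2 + int (n mod 4))" for n
  have W: "dlen (W n) powr \<sigma> = c (n div 4)" for n by (simp add: W_def dlen_def c_def)
  have c0: "0 \<le> c i" for i by (simp add: c_def)
  have smW: "summable (\<lambda>n. dlen (W n) powr \<sigma>)" unfolding W by (rule summable_div_4[OF smc c0])
  have "(\<Sum>n. dlen (W n) powr \<sigma>) \<le> 4 * (16 * \<epsilon>)"
    unfolding W using summable_div_4(2)[OF smc c0] sc by linarith
  also have "\<dots> < 100 * \<epsilon>" using \<epsilon> by simp
  also have "\<dots> \<le> dlen I0 powr \<sigma> / C" using \<epsilon>(3) C by (simp add: field_simps)
  finally have small: "(\<Sum>n. dlen (W n) powr \<sigma>) < dlen I0 powr \<sigma> / C" .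
  obtain \<xi> where \<xi>: "\<xi> \<in> dcl I0" "\<And>m. fst I0 \<le> m \<Longrightarrow> \<exists>k. \<xi> \<in> dcl (m, k) \<and> \<tau> (m, k)"
    "\<And>p. \<exists>J. p \<le> fst J \<and> \<xi> \<in> dcl J \<and> (\<forall>i. \<not> J \<sqsubseteq> W i)"
    using cover_descent[OF less_imp_le[OF \<sigma>(1)] \<sigma>(2) C step I0 smW small] by blast
  have "cis \<xi> \<in> E" by (rule E[OF \<xi>(1,2)])
  then obtain i where i: "cis \<xi> \<in> U i" using U(1) by blast
  have xi: "x i \<in> dcl I0" "cis (x i) \<in> U i" using x[OF \<xi>(1) i] by auto
  obtain J where J: "m i \<le> fst J" "\<xi> \<in> dcl J" "\<And>n. \<not> J \<sqsubseteq> W n" using \<xi>(3)[of "m i"] by blast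
  have "\<bar>\<xi> - x i\<bar> \<le> dlen I0"
    using \<xi>(1) xi(1) by (simp add: dcl_def dlen_def add_divide_distrib abs_le_iff)
  then have "\<bar>\<xi> - x i\<bar> \<le> 1" using dlen_le_1[of I0] by linarith
  then have "\<bar>\<xi> - x i\<bar> \<le> 2 * norm (cis \<xi> - cis (x i))" by (rule norm_cis_diff_ge)
  also have "norm (cis \<xi> - cis (x i)) \<le> D i"
    using diameter_bounded_bound[OF U(2) i xi(2)] by (simp add: dist_norm D_def)
  finally have "\<bar>\<xi> - x i\<bar> \<le> 1 / 2 ^ m i" using m(1)[of i] \<eta>(1)[of i] by (simp add: \<rho>_def)
  then have "\<bar>\<xi> - x i\<bar> * 2 ^ m i \<le> 1 / 2 ^ m i * 2 ^ m i" by (rule mult_right_mono) simp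
  moreover have "\<bar>\<xi> * 2 ^ m i - x i * 2 ^ m i\<bar> = \<bar>\<xi> - x i\<bar> * 2 ^ m i"
    unfolding left_diff_distrib[symmetric] abs_mult by simp
  ultimately have close: "\<bar>\<xi> * 2 ^ m i - x i * 2 ^ m i\<bar> \<le> 1" by simp
  define A where "A = (m i, snd J div 2 ^ (fst J - m i))"
  have JA: "J \<sqsubseteq> A" using J(1) by (simp add: A_def dsub_def)
  then have "\<xi> \<in> dcl A" using J(2) dcl_mono by blast
  then have a: "of_int (snd A) \<le> \<xi> * 2 ^ m i" "\<xi> * 2 ^ m i \<le> of_int (snd A) + 1"
    by (simp_all add: dcl_def A_def field_simps)
  define k where "k = \<lfloor>x i * 2 ^ m i\<rfloor>"
  have k: "of_int k \<le> x i * 2 ^ m i" "x i * 2 ^ m i < of_int k + 1" by (simp_all add: k_def)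
  have "real_of_int (snd A) < of_int (k + 2)" "real_of_int (k - 3) < of_int (snd A)"
    using a k close by (simp_all add: abs_le_iff)
  then have "snd A < k + 2" "k - 3 < snd A" by (simp_all only: of_int_less_iff)
  then have r: "0 \<le> snd A - (k - 2)" "snd A - (k - 2) < 4" by simp_all
  define n where "n = 4 * i + nat (snd A - (k - 2))"
  have "nat (snd A - (k - 2)) < 4" using r by simp
  then have "n div 4 = i" "n mod 4 = nat (snd A - (k - 2))" by (simp_all add: n_def)
  then have "W n = (m i, k - 2 + (snd A - (k - 2)))" using r by (simp add: W_def k_def)
  then have "W n = A" by (simp add: A_def)
  then show False using J(3)[of n] JA by simp
qed

section \<open>Lifting inner functions to the half-plane\<close>

text \<open>Cauchy's formula for \<open>f\<^sup>n\<close>; letting \<open>n \<rightarrow> \<infinity>\<close> gives \<open>\<bar>f\<bar> \<le> 1\<close> without Poisson kernels.\<close>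

lemma inner_power_bound:
  assumes f: "inner_function f" and z: "norm z < 1"
  shows "norm (f z) ^ n \<le> 1 / (1 - norm z)"
proof -
  have holf: "f holomorphic_on ball 0 1" and bf: "bounded (f ` ball 0 1)"
    and ae: "AE \<theta> in lebesgue_on {0..2*pi}. \<exists>L. ((\<lambda>r. f (complex_of_real r * cis \<theta>)) \<longlongrightarrow> L) (at_left 1) \<and> norm L = 1"
    using f by (auto simp: inner_function_def)
  obtain B where B: "0 < B" "\<And>w. norm w < 1 \<Longrightarrow> norm (f w) \<le> B"
    using bf unfolding bounded_pos by auto
  define P where "P \<theta> \<longleftrightarrow> (\<exists>L. ((\<lambda>r. f (complex_of_real r * cis \<theta>)) \<longlongrightarrow> L) (at_left 1) \<and> norm L = 1)" for \<theta>
  have "AE \<theta> in lebesgue. \<theta> \<in> {0..2*pi} \<longrightarrow> P \<theta>"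
    using ae unfolding P_def by (subst (asm) AE_restrict_space_iff) auto
  then obtain N where N: "negligible N" "\<And>\<theta>. \<theta> \<in> {0..2*pi} \<Longrightarrow> \<theta> \<notin> N \<Longrightarrow> P \<theta>"
    unfolding eventually_ae_filter_negligible by blast
  define N' where "N' = (\<lambda>\<theta>. \<theta> / (2 * pi)) ` N"
  have N': "negligible N'" unfolding N'_def
    by (rule negligible_differentiable_image_negligible[OF _ N(1)])
       (auto intro!: linear_imp_differentiable_on simp: linear_iff add_divide_distrib)
  define S where "S = {0..1} - N'"
  have PS: "P (2 * pi * t)" if "t \<in> S" for t
  proof (rule N(2))
    show "2 * pi * t \<in> {0..2*pi}" using that by (auto simp: S_def)
    show "2 * pi * t \<notin> N" using that by (auto simp: S_def N'_def image_iff)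
  qed
  define R where "R k = 1 - (1 - norm z) / (real k + 2)" for k
  have R: "norm z < R k" "R k < 1" "0 < R k" for k
  proof -
    have "(1 - norm z) / (real k + 2) < (1 - norm z) / 1" using z by (intro divide_strict_left_mono) auto
    then show "norm z < R k" by (simp add: R_def)
    then show "0 < R k" using norm_ge_zero[of z] by linarith
    show "R k < 1" using z by (simp add: R_def)
  qed
  have Rlim: "filterlim R (at_left 1) sequentially"
  proof -
    define e where "e = 1 - norm z"
    have e: "0 < e" using z by (simp add: e_def)
    have "filterlim (\<lambda>k. 1 - e / (real k + 2)) (at_left 1) sequentially" using e by real_asymp
    then show ?thesis unfolding R_def e_def .
  qed
  define h where "h k t = norm (f (of_real (R k) * cis (2 * pi * t))) ^ n" for k t
  have inball: "norm (of_real (R k) * cis (2 * pi * t)) < 1" for k t using R[of k] by (simp add: norm_mult)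
  have hcont: "continuous_on {0..1} (h k)" for k
  proof -
    have 1: "continuous_on {0..1} (\<lambda>t. of_real (R k) * cis (2 * pi * t))"
      by (intro continuous_intros)
    have "continuous_on {0..1} (\<lambda>t. f (of_real (R k) * cis (2 * pi * t)))"
      by (rule continuous_on_compose2[OF holomorphic_on_imp_continuous_on[OF holf] 1]) (use inball in auto)
    then show ?thesis unfolding h_def by (intro continuous_intros)
  qed
  have hint: "h k integrable_on {0..1}" for k by (rule integrable_continuous_interval[OF hcont])
  have spike: "negligible ({0..1} - S)" "negligible (S - {0..1})"
    by (rule negligible_subset[OF N'], auto simp: S_def)+
  have ineq: "norm (f z) ^ n \<le> R k / (R k - norm z) * integral {0..1} (h k)" for k
  proof -
    have "((\<lambda>u. f u ^ n / (u - z)) has_contour_integral (2 * of_real pi * \<i> * f z ^ n)) (circlepath 0 (R k))"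
    proof (rule Cauchy_integral_circlepath)
      have "f holomorphic_on cball 0 (R k)" by (rule holomorphic_on_subset[OF holf]) (use R[of k] in auto)
      then show "continuous_on (cball 0 (R k)) (\<lambda>u. f u ^ n)"
        by (intro continuous_intros holomorphic_on_imp_continuous_on)
      have "f holomorphic_on ball 0 (R k)" by (rule holomorphic_on_subset[OF holf]) (use R[of k] in auto)
      then show "(\<lambda>u. f u ^ n) holomorphic_on ball 0 (R k)" by (intro holomorphic_intros)
      show "norm (z - 0) < R k" using R by simp
    qed
    then have hi: "((\<lambda>t. f (circlepath 0 (R k) t) ^ n / (circlepath 0 (R k) t - z) *
        vector_derivative (circlepath 0 (R k)) (at t within {0..1})) has_integral (2 * of_real pi * \<i> * f z ^ n)) {0..1}"
      by (simp add: has_contour_integral_def)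
    have cp: "circlepath 0 (R k) t = of_real (R k) * cis (2 * pi * t)" for t
      by (simp add: circlepath cis_conv_exp mult_ac)
    have "norm (2 * of_real pi * \<i> * f z ^ n) = norm (integral {0..1} (\<lambda>t. f (circlepath 0 (R k) t) ^ n / (circlepath 0 (R k) t - z) *
        vector_derivative (circlepath 0 (R k)) (at t within {0..1})))"
      using integral_unique[OF hi] by simp
    also have "\<dots> \<le> integral {0..1} (\<lambda>t. 2 * pi * (R k / (R k - norm z)) * h k t)"
    proof (rule Henstock_Kurzweil_Integration.integral_norm_bound_integral)
      show "(\<lambda>t. f (circlepath 0 (R k) t) ^ n / (circlepath 0 (R k) t - z) *
        vector_derivative (circlepath 0 (R k)) (at t within {0..1})) integrable_on {0..1}" using hi by blast
      show "(\<lambda>t. 2 * pi * (R k / (R k - norm z)) * h k t) integrable_on {0..1}"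
        by (intro integrable_continuous_interval continuous_intros hcont)
      fix t :: real assume t: "t \<in> {0..1}"
      have vd: "norm (vector_derivative (circlepath 0 (R k)) (at t within {0..1})) = 2 * pi * R k"
        using t R(3)[of k] norm_exp_i_times[of "2 * pi * t"] by (simp add: vector_derivative_circlepath01 norm_mult mult_ac)
      have den: "R k - norm z \<le> norm (circlepath 0 (R k) t - z)"
        using norm_triangle_ineq2[of "circlepath 0 (R k) t" z] R(3)[of k] by (simp add: cp norm_mult)
      have "norm (f (circlepath 0 (R k) t) ^ n / (circlepath 0 (R k) t - z) * vector_derivative (circlepath 0 (R k)) (at t within {0..1}))
        = h k t / norm (circlepath 0 (R k) t - z) * (2 * pi * R k)"
        unfolding norm_mult vd norm_divide norm_power by (simp add: h_def cp)
      also have "\<dots> \<le> h k t / (R k - norm z) * (2 * pi * R k)"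
        using den R[of k] pi_gt_zero less_le_trans[OF _ den, of 0]
        by (intro mult_right_mono divide_left_mono mult_pos_pos) (auto simp: h_def)
      finally show "norm (f (circlepath 0 (R k) t) ^ n / (circlepath 0 (R k) t - z) *
        vector_derivative (circlepath 0 (R k)) (at t within {0..1})) \<le> 2 * pi * (R k / (R k - norm z)) * h k t"
        by (simp add: mult_ac)
    qed
    also have "\<dots> = 2 * pi * (R k / (R k - norm z) * integral {0..1} (h k))" by simp
    finally have "2 * pi * norm (f z) ^ n \<le> 2 * pi * (R k / (R k - norm z) * integral {0..1} (h k))"
      by (simp only: norm_mult norm_power norm_ii norm_of_real norm_numeral abs_of_pos[OF pi_gt_zero] mult_1_right)
    then show ?thesis by (rule mult_left_le_imp_le) (use pi_gt_zero in simp)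
  qed
  \<comment> \<open>On almost every radius |f|^n tends to 1 whatever n is, so the circular means
    tend to 1 and only the Cauchy kernel is left; the bound is therefore independent of n.\<close>
  have "(\<lambda>k. integral S (h k)) \<longlonglongrightarrow> integral S (\<lambda>t. 1)"
  proof (rule dominated_convergence(2)[where h = "\<lambda>t. B ^ n"])
    show "h k integrable_on S" for k
      by (rule integrable_spike_set[OF hint]) (auto intro: negligible_subset[OF spike(1)] negligible_subset[OF spike(2)])
    have "(\<lambda>t::real. B ^ n) integrable_on {0..1}" by (rule integrable_continuous_interval) (intro continuous_intros)
    then show "(\<lambda>t. B ^ n) integrable_on S"
      by (rule integrable_spike_set) (auto intro: negligible_subset[OF spike(1)] negligible_subset[OF spike(2)])
    show "norm (h k t) \<le> B ^ n" for k t
      unfolding h_def using B(2)[OF inball] by (simp add: power_mono)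
    fix t assume "t \<in> S"
    then obtain L where L: "((\<lambda>r. f (complex_of_real r * cis (2 * pi * t))) \<longlongrightarrow> L) (at_left 1)" "norm L = 1"
      using PS by (auto simp: P_def)
    have "(\<lambda>k. f (of_real (R k) * cis (2 * pi * t))) \<longlonglongrightarrow> L"
      using filterlim_compose[OF L(1) Rlim] .
    then have "(\<lambda>k. norm (f (of_real (R k) * cis (2 * pi * t))) ^ n) \<longlonglongrightarrow> norm L ^ n" by (intro tendsto_intros)
    then show "(\<lambda>k. h k t) \<longlonglongrightarrow> 1" by (simp add: h_def L(2))
  qed
  moreover have "integral S g = integral {0..1} g" for g :: "real \<Rightarrow> real"
    by (rule integral_spike_set) (auto intro: negligible_subset[OF spike(1)] negligible_subset[OF spike(2)])
  ultimately have lim: "(\<lambda>k. integral {0..1} (h k)) \<longlonglongrightarrow> 1" by simp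
  have R1: "R \<longlonglongrightarrow> 1" using Rlim by (simp add: filterlim_at)
  have "(\<lambda>k. R k / (R k - norm z) * integral {0..1} (h k)) \<longlonglongrightarrow> 1 / (1 - norm z) * 1"
    using z by (intro tendsto_intros R1 lim) auto
  then have "norm (f z) ^ n \<le> 1 / (1 - norm z) * 1"
    by (rule LIMSEQ_le_const) (use ineq in auto)
  then show ?thesis by simp
qed

lemma inner_norm_le_1:
  assumes f: "inner_function f" and z: "norm z < 1" shows "norm (f z) \<le> 1"
proof (rule ccontr)
  assume "\<not> norm (f z) \<le> 1"
  then obtain n where "1 / (1 - norm z) < norm (f z) ^ n" using real_arch_pow[of "norm (f z)"] by auto
  then show False using inner_power_bound[OF f z, of n] by linarith
qed

lemma inner_norm_less_1:
  assumes f: "inner_function f" and nc: "\<not> (\<exists>c. \<forall>z \<in> ball 0 1. f z = c)" and z: "norm z < 1"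
  shows "norm (f z) < 1"
proof (rule ccontr)
  assume "\<not> norm (f z) < 1"
  then have "norm (f w) \<le> norm (f z)" if "w \<in> ball 0 1" for w
    using inner_norm_le_1[OF f, of w] that by simp
  then have "f constant_on ball 0 1"
    using f z by (intro maximum_modulus_principle[of f "ball 0 1" "ball 0 1" z]) (auto simp: inner_function_def)
  then show False using nc by (auto simp: constant_on_def)
qed

text \<open>The covering does not increase hyperbolic length: with |w| = exp (-y), the inequality 2
  y |w| <= 1 - |w|^2 is y <= sinh y. So d survives the lift unchanged.\<close>

lemma hyp_lipschitz_lift:
  assumes f: "inner_function f" and nc: "\<not> (\<exists>c. \<forall>z \<in> ball 0 1. f z = c)"
    and hd: "\<And>z. z \<in> ball 0 1 \<Longrightarrow> hyp_deriv f z \<le> d" and d: "0 < d" "d < 1"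
  shows "hyp_lipschitz (\<lambda>z. f (exp (\<i> * z))) d"
proof
  have holf: "f holomorphic_on ball 0 1" using f by (simp add: inner_function_def)
  have nrm: "norm (exp (\<i> * z)) = exp (- Im z)" for z by (simp add: norm_exp_eq_Re)
  have lt: "norm (exp (\<i> * z)) < 1" if "0 < Im z" for z using that by (simp add: nrm)
  show "0 < d" "d < 1" by (fact d)+
  have "f \<circ> (\<lambda>z. exp (\<i> * z)) holomorphic_on {z. 0 < Im z}"
    by (rule holomorphic_on_compose_gen[OF _ holf]) (use lt in \<open>auto intro!: holomorphic_intros\<close>)
  then show "(\<lambda>z. f (exp (\<i> * z))) holomorphic_on {z. 0 < Im z}" by (simp add: o_def)
  fix z assume z: "0 < Im z"
  define w where "w = exp (\<i> * z)"
  define y where "y = Im z"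
  have w: "norm w < 1" using lt[OF z] by (simp add: w_def)
  show "norm (f (exp (\<i> * z))) < 1" using inner_norm_less_1[OF f nc lt[OF z]] .
  have "(f has_field_derivative deriv f w) (at w)"
    by (rule holomorphic_derivI[OF holf]) (use w in auto)
  then have "((\<lambda>z. f (exp (\<i> * z))) has_field_derivative deriv f w * (\<i> * w)) (at z)"
    unfolding w_def by (intro DERIV_chain2[of f]) (auto intro!: derivative_eq_intros simp: mult_ac)
  then have der: "deriv (\<lambda>z. f (exp (\<i> * z))) z = deriv f w * (\<i> * w)" by (rule DERIV_imp_deriv)
  have q: "0 < 1 - (norm (f w))\<^sup>2"
    using inner_norm_less_1[OF f nc w] by (simp add: power_less_one_iff abs_square_less_1)
  have nw: "norm w = exp (- y)" by (simp add: w_def nrm y_def)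
  have "(1 - (norm w)\<^sup>2) * norm (deriv f w) / (1 - (norm (f w))\<^sup>2) \<le> d"
    using hd[of w] w by (simp add: hyp_deriv_def)
  then have *: "(1 - (norm w)\<^sup>2) * norm (deriv f w) \<le> d * (1 - (norm (f w))\<^sup>2)" using q by (simp add: field_simps)
  have "2 * y \<le> exp y - exp (- y)" using real_le_x_sinh[of y] z by (simp add: y_def exp_minus)
  then have "2 * y * exp (- y) \<le> (exp y - exp (- y)) * exp (- y)" by (intro mult_right_mono) auto
  also have "\<dots> = 1 - (norm w)\<^sup>2" by (simp add: nw algebra_simps power2_eq_square flip: exp_add)
  finally have "2 * y * norm w * norm (deriv f w) \<le> (1 - (norm w)\<^sup>2) * norm (deriv f w)"
    unfolding nw by (intro mult_right_mono) auto
  then have "2 * y * norm w * norm (deriv f w) \<le> d * (1 - (norm (f w))\<^sup>2)" using * by (rule order_trans)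
  moreover have "2 * Im z * norm (deriv f w * (\<i> * w)) = 2 * y * norm w * norm (deriv f w)"
    by (simp add: norm_mult y_def mult_ac)
  ultimately show "2 * Im z * norm (deriv (\<lambda>z. f (exp (\<i> * z))) z) \<le> d * (1 - (norm (f (exp (\<i> * z))))\<^sup>2)"
    unfolding der w_def[symmetric] by simp
qed

lemma lift_polar: "exp (\<i> * Complex x y) = complex_of_real (exp (- y)) * cis x"
proof -
  have "\<i> * Complex x y = of_real (- y) + \<i> * of_real x" by (simp add: complex_eq_iff)
  then show ?thesis by (simp add: exp_add cis_conv_exp exp_of_real[symmetric] del: of_real_minus)
qed

lemma unimodular_boundary_lift:
  assumes f: "inner_function f"
  shows "unimodular_boundary (\<lambda>z. f (exp (\<i> * z))) {0..2*pi}"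
proof -
  have "AE \<theta> in lebesgue_on {0..2*pi}. \<exists>L. ((\<lambda>r. f (complex_of_real r * cis \<theta>)) \<longlongrightarrow> L) (at_left 1) \<and> norm L = 1"
    using f by (simp add: inner_function_def)
  then have "AE \<theta> in lebesgue. \<theta> \<in> {0..2*pi} \<longrightarrow>
      (\<exists>L. ((\<lambda>r. f (complex_of_real r * cis \<theta>)) \<longlongrightarrow> L) (at_left 1) \<and> norm L = 1)"
    by (subst (asm) AE_restrict_space_iff) auto
  then show ?thesis
    unfolding unimodular_boundary_def
  proof (rule eventually_mono, intro impI)
    fix x assume "x \<in> {0..2*pi} \<longrightarrow> (\<exists>L. ((\<lambda>r. f (complex_of_real r * cis x)) \<longlongrightarrow> L) (at_left 1) \<and> norm L = 1)" "x \<in> {0..2*pi}"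
    then obtain L where L: "((\<lambda>r. f (complex_of_real r * cis x)) \<longlongrightarrow> L) (at_left 1)" "norm L = 1" by auto
    have "filterlim (\<lambda>y::real. exp (- y)) (at_left 1) (at_right 0)" by real_asymp
    from filterlim_compose[OF L(1) this]
    have "((\<lambda>y. norm (f (complex_of_real (exp (- y)) * cis x))) \<longlongrightarrow> norm L) (at_right 0)"
      by (rule tendsto_norm)
    then show "((\<lambda>y. norm (f (exp (\<i> * Complex x y)))) \<longlongrightarrow> 1) (at_right 0)"
      by (simp only: lift_polar L(2))
  qed
qed

text \<open>Radial limits are given for angles in [0, 2 pi], so the arc is shifted by a multiple of
  2 pi and cut at 2 pi.\<close>

lemma subarc_in_period:
  assumes "a < b"
  obtains a' b' where "0 \<le> a'" "a' < b'" "b' \<le> 2 * pi" "cis ` {a'..b'} \<subseteq> Defs.arc a b"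
proof -
  define j where "j = \<lfloor>a / (2 * pi)\<rfloor>"
  have j: "of_int j \<le> a / (2 * pi)" "a / (2 * pi) < of_int j + 1" by (simp_all add: j_def)
  define a' where "a' = a - 2 * pi * of_int j"
  define b' where "b' = min (2 * pi) (a' + (b - a))"
  have 1: "0 \<le> a'" "a' < 2 * pi" using j pi_gt_zero by (simp_all add: a'_def field_simps)
  show thesis
  proof (rule that[of a' b'])
    show "0 \<le> a'" "a' < b'" "b' \<le> 2 * pi" using 1 assms by (auto simp: b'_def)
    show "cis ` {a'..b'} \<subseteq> Defs.arc a b"
    proof
      fix w assume "w \<in> cis ` {a'..b'}"
      then obtain x where x: "a' \<le> x" "x \<le> b'" "w = cis x" by auto
      have "cis (x + 2 * pi * of_int j) = cis x" by (simp flip: cis_mult)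
      moreover have "x + 2 * pi * of_int j \<in> {a..b}" using x by (auto simp: a'_def b'_def)
      ultimately show "w \<in> Defs.arc a b" unfolding Defs.arc_def using x(3) by (metis image_eqI)
    qed
  qed
qed

lemma dyadic_in_interval:
  fixes a b :: real assumes "a < b" obtains K where "dcl K \<subseteq> {a..b}"
proof -
  have "(\<lambda>m. 2 / 2 ^ m :: real) \<longlonglongrightarrow> 0" by real_asymp
  then have "\<forall>\<^sub>F m in sequentially. 2 / 2 ^ m < b - a" by (rule order_tendstoD) (use assms in simp)
  then obtain m where m: "2 / 2 ^ m < b - a" using eventually_happens'[OF sequentially_bot] by blast
  define k where "k = \<lceil>a * 2 ^ m\<rceil>"
  have "a * 2 ^ m \<le> of_int k" "of_int k < a * 2 ^ m + 1" unfolding k_def by linarith+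
  then have k: "a * 2 ^ m \<le> of_int k" "of_int k + 1 \<le> a * 2 ^ m + 2" by linarith+
  have "a \<le> of_int k / 2 ^ m" using k(1) by (simp add: field_simps)
  moreover have "(of_int k + 1) / 2 ^ m \<le> (a * 2 ^ m + 2) / 2 ^ m" using k(2) by (rule divide_right_mono) simp
  then have "(of_int k + 1) / 2 ^ m \<le> a + 2 / 2 ^ m" by (simp add: add_divide_distrib)
  ultimately have *: "a \<le> of_int k / 2 ^ m" "(of_int k + 1) / 2 ^ m \<le> a + 2 / 2 ^ m" by blast+
  then have "dcl (m, k) \<subseteq> {a..b}" using m by (auto simp: dcl_def simp del: of_int_add)
  then show thesis by (rule that)
qed

section \<open>The dimension bound\<close>

text \<open>Every r close to 1 is at height y = -ln r, within a factor 2 of some dyadic height, and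
  the interval of that generation on the path controls f there. One interval per generation is
  therefore enough.\<close>

lemma Limsup_radial_le:
  assumes path: "\<And>m. m0 \<le> m \<Longrightarrow> \<exists>k. \<xi> \<in> dcl (m, k) \<and> norm (f (exp (\<i> * dpt (m, k)))) \<le> t"
    and near: "\<And>z c. 0 < Im c \<Longrightarrow> \<bar>Re z - Re c\<bar> \<le> 2 * Im c \<Longrightarrow> Im c / 4 \<le> Im z \<Longrightarrow> Im z \<le> 2 * Im c \<Longrightarrow>
      norm (f (exp (\<i> * c))) \<le> t \<Longrightarrow> norm (f (exp (\<i> * z))) \<le> t'"
  shows "Limsup (at_left 1) (\<lambda>r. ereal (norm (f (complex_of_real r * cis \<xi>)))) \<le> ereal t'"
proof (rule Limsup_bounded)
  define b where "b = exp (- (1 / 2 ^ m0) :: real)"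
  have "norm (f (complex_of_real r * cis \<xi>)) \<le> t'" if r: "b < r" "r < 1" for r
  proof -
    have r0: "0 < r" using r(1) by (rule less_trans[rotated]) (simp add: b_def)
    define y where "y = - ln r"
    have ey: "exp (- y) = r" using r0 by (simp add: y_def)
    have y0: "0 < y" using r r0 by (simp add: y_def)
    have "exp (- (1 / 2 ^ m0)) < exp (- y)" using r(1) unfolding ey b_def .
    then have y1: "y < 1 / 2 ^ m0" by simp
    also have "\<dots> \<le> (1::real)" by simp
    finally obtain m where m: "y \<le> 1 / 2 ^ m" "1 / 2 ^ m \<le> 2 * y" using dyadic_scale[of y] y0 by auto
    have "m0 \<le> m"
    proof (rule ccontr)
      assume "\<not> m0 \<le> m"
      then have "Suc m \<le> m0" by simp
      then have "1 / 2 ^ m0 \<le> (1 / 2 ^ Suc m :: real)" by (intro divide_left_mono power_increasing) auto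
      then have "y < 1 / 2 ^ Suc m" using y1 by linarith
      then have "2 * y < 1 / 2 ^ m" by simp
      then show False using m(2) by linarith
    qed
    then obtain k where k: "\<xi> \<in> dcl (m, k)" "norm (f (exp (\<i> * dpt (m, k)))) \<le> t" using path by blast
    have "norm (f (exp (\<i> * Complex \<xi> y))) \<le> t'"
    proof (rule near[OF _ _ _ _ k(2)])
      show "\<bar>Re (Complex \<xi> y) - Re (dpt (m, k))\<bar> \<le> 2 * Im (dpt (m, k))"
        using k(1) by (simp add: dcl_def dlen_def add_divide_distrib)
    qed (use m y0 in \<open>simp_all add: dlen_def\<close>)
    then show ?thesis by (simp add: lift_polar ey)
  qed
  moreover have "b < 1" by (simp add: b_def)
  ultimately show "\<forall>\<^sub>F r in at_left 1. ereal (norm (f (complex_of_real r * cis \<xi>))) \<le> ereal t'"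
    using eventually_at_left_real[of b 1] by (auto elim!: eventually_mono)
qed

lemma hausdorff_dim_ge:
  fixes f :: "complex \<Rightarrow> complex" and d \<delta> t t' T a b :: real
  defines "g \<equiv> \<lambda>z. f (exp (\<i> * z))"
  assumes f: "inner_function f" and hl: "hyp_lipschitz g d" and ab: "a < b"
    and cyc: "\<exists>C\<ge>1. \<forall>I. norm (g (dpt I)) \<le> \<delta> \<longrightarrow> unimodular_boundary g (dcl I) \<longrightarrow> branching g (1 - d) \<delta> t C I"
    and start: "\<And>K. unimodular_boundary g (dcl K) \<Longrightarrow> \<exists>J. J \<sqsubseteq> K \<and> norm (g (dpt J)) \<le> \<delta>"
    and nbd: "\<And>z c. 0 < Im c \<Longrightarrow> \<bar>Re z - Re c\<bar> \<le> 2 * Im c \<Longrightarrow> Im c / 4 \<le> Im z \<Longrightarrow> Im z \<le> 2 * Im c \<Longrightarrow>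
      norm (g c) \<le> t \<Longrightarrow> norm (g z) \<le> t'"
    and T: "t' < T"
  shows "ereal (1 - d) \<le> hausdorff_dim {\<xi> \<in> Defs.arc a b.
      Limsup (at_left 1) (\<lambda>r. ereal (norm (f (complex_of_real r * \<xi>)))) < ereal T}" (is "_ \<le> hausdorff_dim ?E")
proof -
  interpret hyp_lipschitz g d by (rule hl)
  obtain a' b' where ab': "0 \<le> a'" "a' < b'" "b' \<le> 2 * pi" "cis ` {a'..b'} \<subseteq> Defs.arc a b"
    using subarc_in_period[OF ab] .
  obtain K where K: "dcl K \<subseteq> {a'..b'}" using dyadic_in_interval[OF ab'(2)] .
  have bK: "unimodular_boundary g (dcl K)"
    using unimodular_boundary_subset[OF unimodular_boundary_lift[OF f], of "dcl K"] K ab' by (force simp: g_def)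
  obtain I0 where I0: "I0 \<sqsubseteq> K" "norm (g (dpt I0)) \<le> \<delta>" using start[OF bK] by blast
  obtain C where C: "1 \<le> C" and cyc: "\<And>I. norm (g (dpt I)) \<le> \<delta> \<Longrightarrow> unimodular_boundary g (dcl I) \<Longrightarrow> branching g (1 - d) \<delta> t C I"
    using cyc by blast
  \<comment> \<open>Confining the descent to I0 makes the boundary hypothesis available at each of
    its intervals and keeps the limit angle in the arc.\<close>
  define good where "good J \<longleftrightarrow> J \<sqsubseteq> I0 \<and> norm (g (dpt J)) \<le> \<delta>" for J
  have "hausdorff_measure s ?E \<noteq> 0" if s: "0 \<le> s" "s \<le> 1 - d" for s
  proof (rule hausdorff_measure_pos[OF _ _ C, where \<sigma> = "1 - d" and good = good and \<tau> = "\<lambda>A. norm (g (dpt A)) \<le> t"])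
    show "good I0" using I0 by (simp add: good_def)
    fix I assume I: "good I"
    have "unimodular_boundary g (dcl I)"
      by (rule unimodular_boundary_subset[OF bK dcl_mono[OF dsub_trans[OF _ I0(1)]]]) (use I in \<open>simp add: good_def\<close>)
    then obtain F w where F: "finite F" "dantichain F" "dlen I powr (1 - d) \<le> sum w F"
      and FJ: "\<And>J. J \<in> F \<Longrightarrow> J \<sqsubseteq> I \<and> J \<noteq> I \<and> norm (g (dpt J)) \<le> \<delta> \<and>
           (\<forall>A. J \<sqsubseteq> A \<and> A \<sqsubseteq> I \<longrightarrow> norm (g (dpt A)) \<le> t) \<and> 0 \<le> w J \<and>
           w J \<le> dlen J powr (1 - d) \<and> w J \<le> C * dlen J * dlen I powr (1 - d - 1)"
      using cyc[of I] I unfolding branching_def good_def by blast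
    have gJ: "good J" if "J \<in> F" for J
      using FJ[OF that] I dsub_trans unfolding good_def by blast
    show "\<exists>F w. finite F \<and> dantichain F \<and> (\<forall>J\<in>F. J \<sqsubseteq> I \<and> J \<noteq> I \<and> good J \<and>
           (\<forall>A. J \<sqsubseteq> A \<and> A \<sqsubseteq> I \<longrightarrow> norm (g (dpt A)) \<le> t) \<and> 0 \<le> w J \<and>
           w J \<le> dlen J powr (1 - d) \<and> w J \<le> C * dlen J * dlen I powr (1 - d - 1)) \<and> dlen I powr (1 - d) \<le> sum w F"
      by (rule exI[of _ F], rule exI[of _ w]) (use F FJ gJ in blast)
  next
    fix \<xi> assume \<xi>: "\<xi> \<in> dcl I0" "\<And>m. fst I0 \<le> m \<Longrightarrow> \<exists>k. \<xi> \<in> dcl (m, k) \<and> norm (g (dpt (m, k))) \<le> t"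
    have "\<xi> \<in> {a'..b'}" using \<xi>(1) dcl_mono[OF I0(1)] K by blast
    then have 1: "cis \<xi> \<in> Defs.arc a b" using ab'(4) by blast
    have "Limsup (at_left 1) (\<lambda>r. ereal (norm (f (complex_of_real r * cis \<xi>)))) \<le> ereal t'"
      by (rule Limsup_radial_le[OF \<xi>(2)[unfolded g_def] nbd[unfolded g_def]])
    also have "\<dots> < ereal T" using T by simp
    finally show "cis \<xi> \<in> ?E" using 1 by simp
  qed (use d s in auto)
  then have "1 - d \<le> s" if "0 \<le> s" "hausdorff_measure s ?E = 0" for s
    using that by (meson linear)
  then show ?thesis unfolding hausdorff_dim_def by (intro INF_greatest) simp
qed

definition dim_bound :: "real \<Rightarrow> real \<Rightarrow> bool" where
  "dim_bound T D \<longleftrightarrow> (\<forall>f a b. inner_function f \<and> \<not> (\<exists>c. \<forall>z \<in> ball 0 1. f z = c) \<and>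
        (\<exists>c < D. \<forall>z \<in> ball 0 1. hyp_deriv f z \<le> c) \<and> a < b \<longrightarrow>
        hausdorff_dim {\<xi> \<in> Defs.arc a b.
            Limsup (at_left 1) (\<lambda>r. ereal (norm (f (complex_of_real r * \<xi>)))) < ereal T}
          > ereal (1 - D))"

text \<open>The midpoint of c and D is below D, which yields the strict inequality for the
  dimension, and at least D / 2 since c >= 0, which lets the number of generations depend on D
  alone.\<close>

lemma rate_exists:
  assumes f: "inner_function f" and nc: "\<not> (\<exists>c. \<forall>z \<in> ball 0 1. f z = c)"
    and hd: "\<exists>c < D. \<forall>z \<in> ball 0 1. hyp_deriv f z \<le> c" and D: "0 < D" "D < 1"
  obtains d where "D / 2 \<le> d" "d < D" "hyp_lipschitz (\<lambda>z. f (exp (\<i> * z))) d"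
proof -
  obtain c where c: "c < D" "\<And>z. z \<in> ball 0 1 \<Longrightarrow> hyp_deriv f z \<le> c" using hd by blast
  have "(norm (f 0))\<^sup>2 < 1"
    using inner_norm_less_1[OF f nc, of 0] by (simp add: power_less_one_iff abs_square_less_1)
  then have "0 \<le> hyp_deriv f 0" by (simp add: hyp_deriv_def)
  then have c0: "0 \<le> c" using c(2)[of 0] by simp
  show thesis
  proof (rule that[of "(c + D) / 2"])
    show "hyp_lipschitz (\<lambda>z. f (exp (\<i> * z))) ((c + D) / 2)"
    proof (rule hyp_lipschitz_lift[OF f nc])
      show "hyp_deriv f z \<le> (c + D) / 2" if "z \<in> ball 0 1" for z using c(2)[OF that] c(1) by simp
    qed (use c0 c(1) D in auto)
  qed (use c0 c(1) in auto)
qed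

lemma dim_bound_large:
  assumes D: "0 < D" "D < 1" shows "\<exists>T. 0 < T \<and> T < 1 \<and> dim_bound T D"
proof -
  obtain \<delta> t where dt: "0 < \<delta>" "\<delta> \<le> t" "t < 1" and cyc: "\<And>g d. hyp_lipschitz g d \<Longrightarrow> D / 2 \<le> d \<Longrightarrow> d \<le> D \<Longrightarrow>
    (\<exists>C\<ge>1. \<forall>I. norm (g (dpt I)) \<le> \<delta> \<longrightarrow> unimodular_boundary g (dcl I) \<longrightarrow> branching g (1 - d) \<delta> t C I) \<and>
    (\<forall>K. unimodular_boundary g (dcl K) \<longrightarrow> (\<exists>J. J \<sqsubseteq> K \<and> norm (g (dpt J)) \<le> \<delta>))"
    using branching_large[OF D] by blast
  \<comment> \<open>\<open>near\<close> loses a factor 36 in Q on passing from the corners on the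
    path to the points of the radius.\<close>
  define t' where "t' = sqrt (1 - (1 - t\<^sup>2) / 36)"
  have t2: "0 < t\<^sup>2" "t\<^sup>2 < 1" using dt by (auto simp: power_less_one_iff abs_square_less_1)
  have "0 < t\<^sup>2 + 35" using t2(1) by linarith
  then have "0 < 1 - (1 - t\<^sup>2) / 36" "1 - (1 - t\<^sup>2) / 36 < 1" using t2(2) by (simp_all add: field_simps)
  then have t': "0 < t'" "t' < 1" unfolding t'_def by (simp_all only: real_sqrt_gt_0_iff real_sqrt_lt_1_iff)
  have "dim_bound ((1 + t') / 2) D"
    unfolding dim_bound_def
  proof (intro allI impI, elim conjE)
    fix f :: "complex \<Rightarrow> complex" and a b :: real
    assume f: "inner_function f" and nc: "\<not> (\<exists>c. \<forall>z \<in> ball 0 1. f z = c)"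
      and hd: "\<exists>c < D. \<forall>z \<in> ball 0 1. hyp_deriv f z \<le> c" and ab: "a < b"
    obtain d where dD: "D / 2 \<le> d" "d < D" and hl: "hyp_lipschitz (\<lambda>z. f (exp (\<i> * z))) d"
      using rate_exists[OF f nc hd D] .
    interpret hyp_lipschitz "\<lambda>z. f (exp (\<i> * z))" d by (rule hl)
    note cy = cyc[OF hl dD(1) less_imp_le[OF dD(2)]]
    have "ereal (1 - d) \<le> hausdorff_dim {\<xi> \<in> Defs.arc a b.
       Limsup (at_left 1) (\<lambda>r. ereal (norm (f (complex_of_real r * \<xi>)))) < ereal ((1 + t') / 2)}"
    proof (rule hausdorff_dim_ge[OF f hl ab conjunct1[OF cy]])
      show "\<exists>J. J \<sqsubseteq> K \<and> norm (f (exp (\<i> * dpt J))) \<le> \<delta>" if "unimodular_boundary (\<lambda>z. f (exp (\<i> * z))) (dcl K)" for K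
        using conjunct2[OF cy] that by blast
      show "t' < (1 + t') / 2" using t' by simp
      fix z c assume c: "0 < Im c" "\<bar>Re z - Re c\<bar> \<le> 2 * Im c" "Im c / 4 \<le> Im z" "Im z \<le> 2 * Im c"
        and ct: "norm (f (exp (\<i> * c))) \<le> t"
      have "(norm (f (exp (\<i> * c))))\<^sup>2 \<le> t\<^sup>2" using ct by (intro power_mono) auto
      then have "(1 - t\<^sup>2) / 36 \<le> 1 - (norm (f (exp (\<i> * z))))\<^sup>2" using near(2)[OF c] by (simp add: Q_def)
      then show "norm (f (exp (\<i> * z))) \<le> t'" unfolding t'_def by (subst le_sqrt_iff) auto
    qed
    moreover have "ereal (1 - D) < ereal (1 - d)" using dD by simp
    ultimately show "ereal (1 - D) < hausdorff_dim {\<xi> \<in> Defs.arc a b.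
       Limsup (at_left 1) (\<lambda>r. ereal (norm (f (complex_of_real r * \<xi>)))) < ereal ((1 + t') / 2)}" by (rule less_le_trans[rotated])
  qed
  then show ?thesis using t' by (intro exI[of _ "(1 + t') / 2"]) auto
qed

lemma dim_bound_small:
  assumes t0: "0 < t0" "t0 < 1" shows "\<exists>D0>0. \<forall>D. 0 < D \<and> D < 1 \<and> D \<le> D0 \<longrightarrow> dim_bound t0 D"
proof -
  obtain D1 where D1: "0 < D1" and cyc: "\<And>g d. hyp_lipschitz g d \<Longrightarrow> d \<le> D1 \<Longrightarrow>
    \<exists>C\<ge>1. \<forall>I. norm (g (dpt I)) \<le> t0 / 16 \<longrightarrow> unimodular_boundary g (dcl I) \<longrightarrow> branching g (1 - d) (t0 / 16) (t0 / 2) C I"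
    using branching_small[OF t0] by blast
  have "0 < t0 / 16" "t0 / 16 < 1" using t0 by auto
  then obtain D2 where D2: "0 < D2" and start: "\<And>g d K. hyp_lipschitz g d \<Longrightarrow> d \<le> D2 \<Longrightarrow> unimodular_boundary g (dcl K) \<Longrightarrow>
    \<exists>J. J \<sqsubseteq> K \<and> norm (g (dpt J)) \<le> t0 / 16"
    using reach_small[of "t0 / 16"] by blast
  \<comment> \<open>t0 / 16 gives t0 / 2 + 2 d <= 3 / 4 t0 on the radius.\<close>
  define D0 where "D0 = min D1 (min D2 (t0 / 16))"
  have "dim_bound t0 D" if D: "0 < D" "D < 1" "D \<le> D0" for D
    unfolding dim_bound_def
  proof (intro allI impI, elim conjE)
    fix f :: "complex \<Rightarrow> complex" and a b :: real
    assume f: "inner_function f" and nc: "\<not> (\<exists>c. \<forall>z \<in> ball 0 1. f z = c)"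
      and hd: "\<exists>c < D. \<forall>z \<in> ball 0 1. hyp_deriv f z \<le> c" and ab: "a < b"
    obtain d where dD: "D / 2 \<le> d" "d < D" and hl: "hyp_lipschitz (\<lambda>z. f (exp (\<i> * z))) d"
      using rate_exists[OF f nc hd D(1,2)] .
    interpret hyp_lipschitz "\<lambda>z. f (exp (\<i> * z))" d by (rule hl)
    have dd: "d \<le> D1" "d \<le> D2" "d \<le> t0 / 16" using dD D by (auto simp: D0_def)
    have "ereal (1 - d) \<le> hausdorff_dim {\<xi> \<in> Defs.arc a b.
       Limsup (at_left 1) (\<lambda>r. ereal (norm (f (complex_of_real r * \<xi>)))) < ereal t0}"
    proof (rule hausdorff_dim_ge[OF f hl ab cyc[OF hl dd(1)] start[OF hl dd(2)]])
      show "3 / 4 * t0 < t0" using t0 by simp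
      fix z c assume c: "0 < Im c" "\<bar>Re z - Re c\<bar> \<le> 2 * Im c" "Im c / 4 \<le> Im z" "Im z \<le> 2 * Im c"
        and ct: "norm (f (exp (\<i> * c))) \<le> t0 / 2"
      have "norm (f (exp (\<i> * z)) - f (exp (\<i> * c))) \<le> 2 * d" using near(3)[OF c] .
      then have "norm (f (exp (\<i> * z))) \<le> t0 / 2 + 2 * d"
        using norm_triangle_ineq2[of "f (exp (\<i> * z))" "f (exp (\<i> * c))"] ct by linarith
      then show "norm (f (exp (\<i> * z))) \<le> 3 / 4 * t0" using dd(3) t0 by simp
    qed
    moreover have "ereal (1 - D) < ereal (1 - d)" using dD by simp
    ultimately show "ereal (1 - D) < hausdorff_dim {\<xi> \<in> Defs.arc a b.
       Limsup (at_left 1) (\<lambda>r. ereal (norm (f (complex_of_real r * \<xi>)))) < ereal t0}" by (rule less_le_trans[rotated])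
  qed
  moreover have "0 < D0" using D1 D2 t0 by (simp add: D0_def)
  ultimately show ?thesis by blast
qed

text \<open>T D is admissible and within D of the infimum of the admissible thresholds, so it falls
  below t + D as soon as t is admissible for D. This gives the limit without any monotonicity of
  P.\<close>

lemma threshold_function_exists:
  fixes P :: "real \<Rightarrow> real \<Rightarrow> bool"
  assumes large: "\<And>D. 0 < D \<Longrightarrow> D < 1 \<Longrightarrow> \<exists>T. 0 < T \<and> T < 1 \<and> P T D"
    and small: "\<And>t. 0 < t \<Longrightarrow> t < 1 \<Longrightarrow> \<exists>D0>0. \<forall>D. 0 < D \<and> D < 1 \<and> D \<le> D0 \<longrightarrow> P t D"
  shows "\<exists>T. (\<forall>D \<in> {0<..<1}. T D \<in> {0<..<1} \<and> P (T D) D) \<and> (T \<longlongrightarrow> 0) (at_right 0)"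
proof -
  have "\<exists>T. 0 < T \<and> T < 1 \<and> P T D \<and> (\<forall>t. 0 < t \<and> t < 1 \<and> P t D \<longrightarrow> T < t + D)" if D: "0 < D" "D < 1" for D
  proof -
    define S where "S = {t. 0 < t \<and> t < 1 \<and> P t D}"
    have S: "S \<noteq> {}" "bdd_below S" using large[OF D] by (auto simp: S_def intro!: bdd_belowI[of _ 0])
    obtain T where T: "T \<in> S" "T < Inf S + D" using cInf_lessD[OF S(1), of "Inf S + D"] D by auto
    have "T < t + D" if "t \<in> S" for t using cInf_lower[OF that S(2)] T(2) by simp
    then show ?thesis using T(1) by (auto simp: S_def)
  qed
  then obtain T where T: "\<And>D. 0 < D \<Longrightarrow> D < 1 \<Longrightarrow> 0 < T D \<and> T D < 1 \<and> P (T D) D \<and>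
      (\<forall>t. 0 < t \<and> t < 1 \<and> P t D \<longrightarrow> T D < t + D)" by metis
  have "(T \<longlongrightarrow> 0) (at_right 0)"
  proof (rule tendstoI)
    fix e :: real assume e: "0 < e"
    define t where "t = min (e / 2) (1 / 2)"
    have t: "0 < t" "t < 1" "t \<le> e / 2" using e by (auto simp: t_def)
    obtain D0 where D0: "0 < D0" "\<And>D. 0 < D \<Longrightarrow> D < 1 \<Longrightarrow> D \<le> D0 \<Longrightarrow> P t D" using small[OF t(1,2)] by blast
    define b where "b = min D0 (min (e / 2) 1)"
    have "dist (T D) 0 < e" if "0 < D" "D < b" for D
    proof -
      have D: "D < 1" "D \<le> D0" "D < e / 2" using that by (auto simp: b_def)
      have "T D < t + D" "0 < T D" using T[OF that(1) D(1)] t(1,2) D0(2)[OF that(1) D(1,2)] by blast+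
      then show ?thesis using t(3) D(3) by (simp add: dist_norm)
    qed
    moreover have "0 < b" using D0 e by (simp add: b_def)
    ultimately show "\<forall>\<^sub>F D in at_right 0. dist (T D) 0 < e"
      unfolding eventually_at_right_field by blast
  qed
  then show ?thesis using T by (intro exI[of _ T]) auto
qed

theorem theorem5:
  shows "\<exists>T :: real \<Rightarrow> real.
    (\<forall>D \<in> {0<..<1}. T D \<in> {0<..<1}) \<and>
    (T \<longlongrightarrow> 0) (at_right 0) \<and>
    (\<forall>D f a b. 0 < D \<and> D < 1 \<and> inner_function f \<and>
        \<not> (\<exists>c. \<forall>z \<in> ball 0 1. f z = c) \<and>
        (\<exists>c < D. \<forall>z \<in> ball 0 1. hyp_deriv f z \<le> c) \<and>
        a < b \<longrightarrow>
        hausdorff_dim {\<xi> \<in> arc a b.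
            Limsup (at_left 1) (\<lambda>r. ereal (norm (f (complex_of_real r * \<xi>)))) < ereal (T D)}
          > ereal (1 - D))"
proof -
  obtain T where T: "\<And>D. D \<in> {0<..<1} \<Longrightarrow> T D \<in> {0<..<1} \<and> dim_bound (T D) D" "(T \<longlongrightarrow> 0) (at_right 0)"
    using threshold_function_exists[of dim_bound, OF dim_bound_large dim_bound_small] by blast
  then show ?thesis
    by (intro exI[of _ T]) (auto simp: dim_bound_def)
qed

end
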